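(* Let $A\,|\,B$ be a ring extension, with centralizer $R=C_A(B)$ and $T=(A\otimes_B A)^B$. Then $A\,|\,B$ is H-separable if and only if the right module $R_T$ is a generator (of the category of right $T$-modules) and $R\otimes_T(A\otimes_B A)\cong A$ as natural $A$-$A$-bimodules.
   Context: Rings are associative and unital. A ring extension $A\,|\,B$ is a unital ring homomorphism $B\to A$, making $A$ a $B$-bimodule. For a $B$-bimodule $M$, $M^B=\{m\in M: bm=mb\ \forall b\in B\}$. The centralizer is $R=C_A(B)=A^B$. Elements $t\in T=(A\otimes_B A)^B$ are written $t=t^1\otimes t^2$ with a possible summation suppressed. $T$ is a ring with unit $1\otimes 1$ and multiplication $tt'={t'}^1t^1\otimes t^2{t'}^2$. $R$ is a right $T$-module via $r\cdot t=t^1rt^2$. $A\otimes_B A$ is a left $T$-module via $t\cdot(a\otimes a')=at^1\otimes t^2a'$; this commutes with its usual (outer) $A$-$A$-bimodule structure, which gives $R\otimes_T(A\otimes_B A)$ its natural $A$-$A$-bimodule structure. The extension $A\,|\,B$ is H-separable if there is a positive integer $n$ such that $A\otimes_B A\oplus *\cong A^n$ as $A$-$A$-bimodules, where $M\oplus *\cong N$ means that $M$ is isomorphic to a direct summand of $N$. *)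

theory Defs
  imports "HOL-Algebra.AbelCoset" "HOL-Algebra.Free_Abelian_Groups"
begin

section \<open>Modules and bimodules over not necessarily commutative rings\<close>

text \<open>
  The locale \<open>module\<close> of \<open>HOL-Algebra\<close> is restricted to commutative rings of scalars.
  As in the library, only the additive part of the underlying \<^typ>\<open>'m ring\<close> record of a
  module is meaningful.
\<close>

record ('s, 'm) rmodule = "'m ring" +
  rsmult :: "['m, 's] \<Rightarrow> 'm" (infixl \<open>\<triangleleft>\<index>\<close> 70)

record ('r, 's, 'm) bimodule = "('s, 'm) rmodule" +
  lsmult :: "['r, 'm] \<Rightarrow> 'm" (infixr \<open>\<triangleright>\<index>\<close> 71)

locale right_module = S?: ring S + M?: abelian_group M
  for S :: "('s, 'k) ring_scheme" (structure)
    and M :: "('s, 'm, 'i) rmodule_scheme" (structure) +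
  assumes rsmult_closed: "\<lbrakk>x \<in> carrier M; s \<in> carrier S\<rbrakk> \<Longrightarrow> x \<triangleleft>\<^bsub>M\<^esub> s \<in> carrier M"
    and rsmult_add_left: "\<lbrakk>x \<in> carrier M; y \<in> carrier M; s \<in> carrier S\<rbrakk> \<Longrightarrow>
      (x \<oplus>\<^bsub>M\<^esub> y) \<triangleleft>\<^bsub>M\<^esub> s = x \<triangleleft>\<^bsub>M\<^esub> s \<oplus>\<^bsub>M\<^esub> y \<triangleleft>\<^bsub>M\<^esub> s"
    and rsmult_add_right: "\<lbrakk>x \<in> carrier M; s \<in> carrier S; s' \<in> carrier S\<rbrakk> \<Longrightarrow>
      x \<triangleleft>\<^bsub>M\<^esub> (s \<oplus>\<^bsub>S\<^esub> s') = x \<triangleleft>\<^bsub>M\<^esub> s \<oplus>\<^bsub>M\<^esub> x \<triangleleft>\<^bsub>M\<^esub> s'"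
    and rsmult_assoc: "\<lbrakk>x \<in> carrier M; s \<in> carrier S; s' \<in> carrier S\<rbrakk> \<Longrightarrow>
      x \<triangleleft>\<^bsub>M\<^esub> (s \<otimes>\<^bsub>S\<^esub> s') = (x \<triangleleft>\<^bsub>M\<^esub> s) \<triangleleft>\<^bsub>M\<^esub> s'"
    and rsmult_one: "x \<in> carrier M \<Longrightarrow> x \<triangleleft>\<^bsub>M\<^esub> \<one>\<^bsub>S\<^esub> = x"

definition rmodule_hom ::
  "('s, 'k) ring_scheme \<Rightarrow> ('s, 'm, 'i) rmodule_scheme \<Rightarrow> ('s, 'n, 'j) rmodule_scheme \<Rightarrow> ('m \<Rightarrow> 'n) set"
  where "rmodule_hom S M N = {h \<in> hom (add_monoid M) (add_monoid N).
    \<forall>x\<in>carrier M. \<forall>s\<in>carrier S. h (x \<triangleleft>\<^bsub>M\<^esub> s) = h x \<triangleleft>\<^bsub>N\<^esub> s}"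

definition bimodule_iso ::
  "('r, 'k) ring_scheme \<Rightarrow> ('s, 'l) ring_scheme \<Rightarrow> ('r, 's, 'm, 'i) bimodule_scheme
    \<Rightarrow> ('r, 's, 'n, 'j) bimodule_scheme \<Rightarrow> ('m \<Rightarrow> 'n) set"
  where "bimodule_iso R S M N = {h \<in> iso (add_monoid M) (add_monoid N).
    (\<forall>x\<in>carrier M. \<forall>r\<in>carrier R. h (r \<triangleright>\<^bsub>M\<^esub> x) = r \<triangleright>\<^bsub>N\<^esub> h x) \<and>
    (\<forall>x\<in>carrier M. \<forall>s\<in>carrier S. h (x \<triangleleft>\<^bsub>M\<^esub> s) = h x \<triangleleft>\<^bsub>N\<^esub> s)}"

definition bimodule_isomorphic ::
  "('r, 'k) ring_scheme \<Rightarrow> ('s, 'l) ring_scheme \<Rightarrow> ('r, 's, 'm, 'i) bimodule_scheme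
    \<Rightarrow> ('r, 's, 'n, 'j) bimodule_scheme \<Rightarrow> bool"
  where "bimodule_isomorphic R S M N \<longleftrightarrow> bimodule_iso R S M N \<noteq> {}"

definition subbimodule ::
  "('r, 'k) ring_scheme \<Rightarrow> ('s, 'l) ring_scheme \<Rightarrow> 'm set \<Rightarrow> ('r, 's, 'm, 'i) bimodule_scheme \<Rightarrow> bool"
  where "subbimodule R S P M \<longleftrightarrow> additive_subgroup P M \<and>
    (\<forall>x\<in>P. \<forall>r\<in>carrier R. r \<triangleright>\<^bsub>M\<^esub> x \<in> P) \<and> (\<forall>x\<in>P. \<forall>s\<in>carrier S. x \<triangleleft>\<^bsub>M\<^esub> s \<in> P)"

definition bimodule_direct_summand ::
  "('r, 'k) ring_scheme \<Rightarrow> ('s, 'l) ring_scheme \<Rightarrow> 'm set \<Rightarrow> ('r, 's, 'm, 'i) bimodule_scheme \<Rightarrow> bool"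
  where "bimodule_direct_summand R S P M \<longleftrightarrow> subbimodule R S P M \<and>
    (\<exists>Q. subbimodule R S Q M \<and> P \<inter> Q = {\<zero>\<^bsub>M\<^esub>} \<and> P <+>\<^bsub>M\<^esub> Q = carrier M)"

text \<open>The relation \<open>M \<oplus> * \<cong> N\<close>.\<close>

definition isomorphic_to_summand ::
  "('r, 'k) ring_scheme \<Rightarrow> ('s, 'l) ring_scheme \<Rightarrow> ('r, 's, 'm, 'i) bimodule_scheme
    \<Rightarrow> ('r, 's, 'n, 'j) bimodule_scheme \<Rightarrow> bool"
  where "isomorphic_to_summand R S M N \<longleftrightarrow>
    (\<exists>P. bimodule_direct_summand R S P N \<and> bimodule_isomorphic R S M (N\<lparr>carrier := P\<rparr>))"

definition regular_bimodule :: "('a, 'k) ring_scheme \<Rightarrow> ('a, 'a, 'a) bimodule"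
  where "regular_bimodule A = \<lparr>carrier = carrier A, monoid.mult = monoid.mult A, one = one A, ring.zero = ring.zero A,
    add = add A, rsmult = (\<lambda>x a. x \<otimes>\<^bsub>A\<^esub> a), lsmult = (\<lambda>a x. a \<otimes>\<^bsub>A\<^esub> x)\<rparr>"

definition bimodule_power ::
  "nat \<Rightarrow> ('r, 's, 'm, 'i) bimodule_scheme \<Rightarrow> ('r, 's, nat \<Rightarrow> 'm) bimodule"
  where "bimodule_power n M = \<lparr>carrier = {..<n} \<rightarrow>\<^sub>E carrier M,
    monoid.mult = (\<lambda>x y. \<lambda>i\<in>{..<n}. x i \<otimes>\<^bsub>M\<^esub> y i), one = (\<lambda>i\<in>{..<n}. \<one>\<^bsub>M\<^esub>),
    ring.zero = (\<lambda>i\<in>{..<n}. \<zero>\<^bsub>M\<^esub>), add = (\<lambda>x y. \<lambda>i\<in>{..<n}. x i \<oplus>\<^bsub>M\<^esub> y i),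
    rsmult = (\<lambda>x s. \<lambda>i\<in>{..<n}. x i \<triangleleft>\<^bsub>M\<^esub> s), lsmult = (\<lambda>r x. \<lambda>i\<in>{..<n}. r \<triangleright>\<^bsub>M\<^esub> x i)\<rparr>"


section \<open>Generators\<close>

text \<open>
  \<open>G\<close> is a generator if parallel homomorphisms \<open>f, g : M \<rightarrow> N\<close> that differ are
  distinguished by some homomorphism \<open>G \<rightarrow> M\<close>, i.e. if \<open>Hom(G, -)\<close> is faithful. A HOL formula
  cannot quantify over modules of all types, so \<open>generator_in\<close> carries the type of the
  elements of \<open>M\<close> and \<open>N\<close> as a parameter, and \<open>generator\<close> uses subsets of
  the base ring as elements. This is no restriction: by \<open>generator_imp_generator_in\<close> below,
  a \<open>generator\<close> has the defining property with respect to modules over every type.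
\<close>

definition generator_in ::
  "'m itself \<Rightarrow> ('s, 'k) ring_scheme \<Rightarrow> ('s, 'g, 'i) rmodule_scheme \<Rightarrow> bool"
  where "generator_in _ S G \<longleftrightarrow> right_module S G \<and>
    (\<forall>(M :: ('s, 'm) rmodule) (N :: ('s, 'm) rmodule). right_module S M \<longrightarrow> right_module S N \<longrightarrow>
      (\<forall>f\<in>rmodule_hom S M N. \<forall>g\<in>rmodule_hom S M N. (\<exists>x\<in>carrier M. f x \<noteq> g x) \<longrightarrow>
        (\<exists>h\<in>rmodule_hom S G M. \<exists>x\<in>carrier G. f (h x) \<noteq> g (h x))))"

definition generator :: "('s, 'k) ring_scheme \<Rightarrow> ('s, 'g, 'i) rmodule_scheme \<Rightarrow> bool"
  where "generator S G \<longleftrightarrow> generator_in TYPE('s set) S G"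


lemma right_module_regular_quotient:
  fixes S :: "('s, 'k) ring_scheme" (structure)
  assumes "ring S" and J: "additive_subgroup J S"
    and Jr: "\<forall>x\<in>J. \<forall>s\<in>carrier S. x \<otimes> s \<in> J"
  defines "Q \<equiv> \<lparr>carrier = a_rcosets J, monoid.mult = (\<lambda>_ _. undefined), one = undefined,
      ring.zero = J, add = set_add S, rsmult = (\<lambda>X s. \<Union>x\<in>X. J +> (x \<otimes> s))\<rparr>"
  shows "right_module S Q"
    and "(\<lambda>s. J +> s) \<in> hom (add_monoid S) (add_monoid Q)"
    and "\<And>x s. \<lbrakk>x \<in> carrier S; s \<in> carrier S\<rbrakk> \<Longrightarrow> (J +> x) \<triangleleft>\<^bsub>Q\<^esub> s = J +> (x \<otimes> s)"
    and "carrier Q = (\<lambda>s. J +> s) ` carrier S"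
proof -
  interpret S: ring S by fact
  interpret J: additive_subgroup J S by fact
  interpret J: abelian_subgroup J S
    by (rule abelian_subgroupI3) (use J S.abelian_group_axioms in auto)
  have carQ: "carrier Q = (\<lambda>s. J +> s) ` carrier S"
    by (auto simp: Q_def A_RCOSETS_def')
  then show "carrier Q = (\<lambda>s. J +> s) ` carrier S" .
  have act: "(J +> x) \<triangleleft>\<^bsub>Q\<^esub> s = J +> (x \<otimes> s)" if x: "x \<in> carrier S" and s: "s \<in> carrier S" for x s
  proof -
    have "J +> (y \<otimes> s) = J +> (x \<otimes> s)" if y: "y \<in> J +> x" for y
    proof -
      obtain j where j: "j \<in> J" "y = j \<oplus> x" using y by (auto simp: a_r_coset_def')
      have "y \<otimes> s = j \<otimes> s \<oplus> x \<otimes> s" using j x s by (simp add: S.l_distr J.a_Hcarr)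
      then have "y \<otimes> s \<in> J +> (x \<otimes> s)" using Jr j(1) s by (auto simp: a_r_coset_def')
      then show ?thesis using J.a_repr_independence' x s by simp
    qed
    then have "\<forall>y\<in>J +> x. J +> (y \<otimes> s) = J +> (x \<otimes> s)" by blast
    then have "(\<Union>y\<in>J +> x. J +> (y \<otimes> s)) = J +> (x \<otimes> s)"
      by (rule UN_constant_eq[OF J.a_rcos_self[OF x]])
    then show ?thesis by (simp add: Q_def)
  qed
  then show "\<And>x s. \<lbrakk>x \<in> carrier S; s \<in> carrier S\<rbrakk> \<Longrightarrow> (J +> x) \<triangleleft>\<^bsub>Q\<^esub> s = J +> (x \<otimes> s)" .
  have add: "(J +> x) \<oplus>\<^bsub>Q\<^esub> (J +> y) = J +> (x \<oplus> y)" if "x \<in> carrier S" "y \<in> carrier S" for x y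
    using J.a_rcos_sum that by (simp add: Q_def)
  show "(\<lambda>s. J +> s) \<in> hom (add_monoid S) (add_monoid Q)"
    by (auto simp: hom_def carQ add)
  have zero: "\<zero>\<^bsub>Q\<^esub> = J +> \<zero>"
    using J.a_subset by (simp add: Q_def S.a_coset_add_zero)
  have abQ: "abelian_group Q"
  proof (rule abelian_groupI)
    fix X assume "X \<in> carrier Q"
    then obtain x where "x \<in> carrier S" "X = J +> x" by (auto simp: carQ)
    then show "\<exists>Y\<in>carrier Q. Y \<oplus>\<^bsub>Q\<^esub> X = \<zero>\<^bsub>Q\<^esub>"
      by (intro bexI[of _ "J +> \<ominus> x"]) (auto simp: carQ add zero S.l_neg)
  qed (auto simp: carQ add zero S.a_ac)
  show "right_module S Q"
  proof (intro right_module.intro right_module_axioms.intro)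
  qed (use abQ S.ring_axioms in \<open>auto simp: carQ act add S.l_distr S.r_distr S.m_assoc\<close>)
qed

lemma generator_imp_generator_in:
  fixes S :: "('s, 'k) ring_scheme" and G :: "('s, 'g, 'i) rmodule_scheme"
  assumes "generator S G"
  shows "generator_in TYPE('m) S G"
proof -
  have gen: "generator_in TYPE('s set) S G" using assms by (simp add: generator_def)
  then interpret G: right_module S G by (simp add: generator_in_def)
  note [simp] = G.S.add.is_group
  define reg :: "('s, 's) rmodule" where "reg = \<lparr>carrier = carrier S, monoid.mult = monoid.mult S,
    one = one S, ring.zero = ring.zero S, add = add S, rsmult = (\<lambda>x s. x \<otimes>\<^bsub>S\<^esub> s)\<rparr>"
  define H where "H = {h x | h x. h \<in> rmodule_hom S G reg \<and> x \<in> carrier G}"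
  define I where "I = generate (add_monoid S) H"
  have HS: "H \<subseteq> carrier S" by (auto simp: H_def rmodule_hom_def hom_def reg_def)
  have Isub: "subgroup I (add_monoid S)"
    unfolding I_def using HS by (intro G.S.add.generate_is_subgroup) simp
  have Hr: "x \<otimes>\<^bsub>S\<^esub> s \<in> H" if xs: "x \<in> H" "s \<in> carrier S" for x s
  proof -
    obtain h y where h: "h \<in> rmodule_hom S G reg" "y \<in> carrier G" "x = h y"
      using xs(1) unfolding H_def by blast
    then have "x \<otimes>\<^bsub>S\<^esub> s = h (y \<triangleleft>\<^bsub>G\<^esub> s)" using xs(2) by (simp add: rmodule_hom_def reg_def)
    then show ?thesis using h xs(2) G.rsmult_closed unfolding H_def by blast
  qed
  have IS: "I \<subseteq> carrier S" using subgroup.subset[OF Isub] by simp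
  have Ir: "x \<otimes>\<^bsub>S\<^esub> s \<in> I" if "x \<in> I" "s \<in> carrier S" for x s
    using that(1) unfolding I_def
  proof (induction x rule: generate.induct)
    case one
    then show ?case using that(2) generate.one[of "add_monoid S" H] by simp
  next
    case (incl h)
    then show ?case using Hr that(2) by (intro generate.incl)
  next
    case (inv h)
    then have "h \<in> carrier S" using HS by auto
    then have "inv\<^bsub>add_monoid S\<^esub> h \<otimes>\<^bsub>S\<^esub> s = inv\<^bsub>add_monoid S\<^esub> (h \<otimes>\<^bsub>S\<^esub> s)"
      using that(2) G.S.l_minus by (simp flip: a_inv_def)
    then show ?case using inv Hr that(2) by (metis generate.inv)
  next
    case (eng h1 h2)
    then have "h1 \<in> carrier S" "h2 \<in> carrier S" using IS by (auto simp: I_def)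
    then show ?case using eng that(2) generate.eng[of _ "add_monoid S" H]
      by (simp add: G.S.l_distr)
  qed
  have addI: "additive_subgroup I S" and add0: "additive_subgroup {\<zero>\<^bsub>S\<^esub>} S"
    using Isub G.S.add.triv_subgroup by (auto intro: additive_subgroup.intro)
  define Q :: "'s set \<Rightarrow> ('s, 's set) rmodule" where
    "Q J = \<lparr>carrier = a_rcosets\<^bsub>S\<^esub> J, monoid.mult = (\<lambda>_ _. undefined), one = undefined,
      ring.zero = J, add = set_add S, rsmult = (\<lambda>X s. \<Union>x\<in>X. J +>\<^bsub>S\<^esub> (x \<otimes>\<^bsub>S\<^esub> s))\<rparr>" for J
  have Ir': "\<forall>x\<in>I. \<forall>s\<in>carrier S. x \<otimes>\<^bsub>S\<^esub> s \<in> I"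
    using Ir by blast
  note QI = right_module_regular_quotient[OF G.S.ring_axioms addI Ir', folded Q_def]
  have zr: "\<forall>x\<in>{\<zero>\<^bsub>S\<^esub>}. \<forall>s\<in>carrier S. x \<otimes>\<^bsub>S\<^esub> s \<in> {\<zero>\<^bsub>S\<^esub>}"
    by simp
  note Q0 = right_module_regular_quotient[OF G.S.ring_axioms add0 zr, folded Q_def]
  have c0: "{\<zero>\<^bsub>S\<^esub>} +>\<^bsub>S\<^esub> s = {s}" if "s \<in> carrier S" for s
    using that by (simp add: a_r_coset_def')
  have one: "\<one>\<^bsub>S\<^esub> \<in> I"
  proof (rule ccontr)
    assume n: "\<one>\<^bsub>S\<^esub> \<notin> I"
    define f where "f X = I +>\<^bsub>S\<^esub> the_elem X" for X
    define g where "g X = I" for X :: "'s set"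
    have act0: "{x} \<triangleleft>\<^bsub>Q {\<zero>\<^bsub>S\<^esub>}\<^esub> s = {x \<otimes>\<^bsub>S\<^esub> s}" if "x \<in> carrier S" "s \<in> carrier S" for x s
      using Q0(3)[OF that] that by (simp add: c0)
    have car0: "carrier (Q {\<zero>\<^bsub>S\<^esub>}) = (\<lambda>s. {s}) ` carrier S"
      unfolding Q0(4) by (intro image_cong) (auto simp: c0)
    have ad0: "{x} \<oplus>\<^bsub>Q {\<zero>\<^bsub>S\<^esub>}\<^esub> {y} = {x \<oplus>\<^bsub>S\<^esub> y}" for x y
      by (simp add: Q_def set_add_def')
    have adI: "(I +>\<^bsub>S\<^esub> x) \<oplus>\<^bsub>Q I\<^esub> (I +>\<^bsub>S\<^esub> y) = I +>\<^bsub>S\<^esub> (x \<oplus>\<^bsub>S\<^esub> y)"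
      if "x \<in> carrier S" "y \<in> carrier S" for x y
      using QI(2) that by (simp add: hom_def)
    have I0: "I +>\<^bsub>S\<^esub> \<zero>\<^bsub>S\<^esub> = I" using IS by (simp add: G.S.a_coset_add_zero)
    have f: "f \<in> rmodule_hom S (Q {\<zero>\<^bsub>S\<^esub>}) (Q I)"
      by (auto simp: rmodule_hom_def hom_def car0 f_def QI(4) ad0 adI act0 QI(3))
    have g: "g \<in> rmodule_hom S (Q {\<zero>\<^bsub>S\<^esub>}) (Q I)"
      using adI[of "\<zero>\<^bsub>S\<^esub>" "\<zero>\<^bsub>S\<^esub>"] QI(3)[of "\<zero>\<^bsub>S\<^esub>"]
      by (auto simp: rmodule_hom_def hom_def g_def QI(4) I0 intro: image_eqI[where x = "\<zero>\<^bsub>S\<^esub>"])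
    have mem: "s \<in> I +>\<^bsub>S\<^esub> s" if "s \<in> carrier S" for s
      using that subgroup.one_closed[OF Isub] by (force simp: a_r_coset_def')
    have "{\<one>\<^bsub>S\<^esub>} \<in> carrier (Q {\<zero>\<^bsub>S\<^esub>})" "f {\<one>\<^bsub>S\<^esub>} \<noteq> g {\<one>\<^bsub>S\<^esub>}"
      using n mem[of "\<one>\<^bsub>S\<^esub>"] by (auto simp: car0 f_def g_def)
    then obtain h x where h: "h \<in> rmodule_hom S G (Q {\<zero>\<^bsub>S\<^esub>})" and x: "x \<in> carrier G"
      and ne: "f (h x) \<noteq> g (h x)"
      using gen Q0(1) QI(1) f g unfolding generator_in_def by meson
    have hc: "\<exists>s\<in>carrier S. h y = {s}" if "y \<in> carrier G" for y
    proof -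
      have "h y \<in> carrier (Q {\<zero>\<^bsub>S\<^esub>})" using h that by (auto simp: rmodule_hom_def hom_def)
      then show ?thesis by (auto simp: car0)
    qed
    have "(\<lambda>y. the_elem (h y)) \<in> rmodule_hom S G reg"
    proof -
      have "the_elem (h (y \<oplus>\<^bsub>G\<^esub> z)) = the_elem (h y) \<oplus>\<^bsub>S\<^esub> the_elem (h z)"
        if "y \<in> carrier G" "z \<in> carrier G" for y z
      proof -
        have "h (y \<oplus>\<^bsub>G\<^esub> z) = h y \<oplus>\<^bsub>Q {\<zero>\<^bsub>S\<^esub>}\<^esub> h z"
          using h that by (simp add: rmodule_hom_def hom_def)
        then show ?thesis using hc[OF that(1)] hc[OF that(2)] by (auto simp: ad0)
      qed
      moreover have "the_elem (h (y \<triangleleft>\<^bsub>G\<^esub> s)) = the_elem (h y) \<otimes>\<^bsub>S\<^esub> s"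
        if "y \<in> carrier G" "s \<in> carrier S" for y s
      proof -
        have "h (y \<triangleleft>\<^bsub>G\<^esub> s) = h y \<triangleleft>\<^bsub>Q {\<zero>\<^bsub>S\<^esub>}\<^esub> s"
          using h that by (simp add: rmodule_hom_def)
        then show ?thesis using hc[OF that(1)] that(2) by (auto simp: act0)
      qed
      moreover have "the_elem (h y) \<in> carrier S" if "y \<in> carrier G" for y
        using hc[OF that] by auto
      ultimately show ?thesis by (auto simp: rmodule_hom_def hom_def reg_def)
    qed
    then have "the_elem (h x) \<in> I" unfolding I_def H_def
      by (intro generate.incl CollectI exI[of _ "\<lambda>y. the_elem (h y)"] exI[of _ x]) (use x in simp)
    moreover have "abelian_subgroup I S"
      by (rule abelian_subgroupI3[OF addI]) (rule G.S.abelian_group_axioms)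
    ultimately have "f (h x) = I"
      unfolding f_def by (intro abelian_subgroup.a_rcos_const)
    then show False using ne by (simp add: g_def)
  qed
  show ?thesis
    unfolding generator_in_def
  proof (intro conjI allI impI ballI G.right_module_axioms)
    fix M N :: "('s, 'm) rmodule" and f g
    assume M: "right_module S M" and N: "right_module S N"
      and f: "f \<in> rmodule_hom S M N" and g: "g \<in> rmodule_hom S M N"
      and "\<exists>x\<in>carrier M. f x \<noteq> g x"
    then obtain m where m: "m \<in> carrier M" and ne: "f m \<noteq> g m" by blast
    interpret M: right_module S M by fact
    interpret N: right_module S N by fact
    have fadd: "f (x \<oplus>\<^bsub>M\<^esub> y) = f x \<oplus>\<^bsub>N\<^esub> f y" "g (x \<oplus>\<^bsub>M\<^esub> y) = g x \<oplus>\<^bsub>N\<^esub> g y"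
      if "x \<in> carrier M" "y \<in> carrier M" for x y
      using f g that by (auto simp: rmodule_hom_def hom_def)
    have fact: "f (x \<triangleleft>\<^bsub>M\<^esub> s) = f x \<triangleleft>\<^bsub>N\<^esub> s" "g (x \<triangleleft>\<^bsub>M\<^esub> s) = g x \<triangleleft>\<^bsub>N\<^esub> s"
      if "x \<in> carrier M" "s \<in> carrier S" for x s
      using f g that by (auto simp: rmodule_hom_def)
    have fcar: "f m \<in> carrier N" "g m \<in> carrier N"
      using f g m by (auto simp: rmodule_hom_def hom_def)
    show "\<exists>h\<in>rmodule_hom S G M. \<exists>x\<in>carrier G. f (h x) \<noteq> g (h x)"
    proof (rule ccontr)
      assume "\<not> ?thesis"
      then have eq: "f (h x) = g (h x)" if "h \<in> rmodule_hom S G M" "x \<in> carrier G" for h x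
        using that by blast
      define K where "K = {s \<in> carrier S. f m \<triangleleft>\<^bsub>N\<^esub> s = g m \<triangleleft>\<^bsub>N\<^esub> s}"
      have actinv: "x \<triangleleft>\<^bsub>N\<^esub> (\<ominus>\<^bsub>S\<^esub> s) = \<ominus>\<^bsub>N\<^esub> (x \<triangleleft>\<^bsub>N\<^esub> s)"
        if "x \<in> carrier N" "s \<in> carrier S" for x s
      proof -
        have z: "x \<triangleleft>\<^bsub>N\<^esub> \<zero>\<^bsub>S\<^esub> = \<zero>\<^bsub>N\<^esub>"
          using N.rsmult_add_right[of x "\<zero>\<^bsub>S\<^esub>" "\<zero>\<^bsub>S\<^esub>"] N.rsmult_closed[of x "\<zero>\<^bsub>S\<^esub>"] that
          by (simp add: N.M.add.l_cancel_one')
        have "x \<triangleleft>\<^bsub>N\<^esub> (\<ominus>\<^bsub>S\<^esub> s) \<oplus>\<^bsub>N\<^esub> x \<triangleleft>\<^bsub>N\<^esub> s = \<zero>\<^bsub>N\<^esub>"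
          using N.rsmult_add_right[of x "\<ominus>\<^bsub>S\<^esub> s" s] that z by (simp add: G.S.l_neg)
        then show ?thesis using that N.rsmult_closed by (simp add: N.M.minus_equality)
      qed
      have Kz: "f m \<triangleleft>\<^bsub>N\<^esub> \<zero>\<^bsub>S\<^esub> = g m \<triangleleft>\<^bsub>N\<^esub> \<zero>\<^bsub>S\<^esub>"
      proof -
        have "x \<triangleleft>\<^bsub>N\<^esub> \<zero>\<^bsub>S\<^esub> = \<zero>\<^bsub>N\<^esub>" if "x \<in> carrier N" for x
          using N.rsmult_add_right[of x "\<zero>\<^bsub>S\<^esub>" "\<zero>\<^bsub>S\<^esub>"] N.rsmult_closed[of x "\<zero>\<^bsub>S\<^esub>"] that
          by (simp add: N.M.add.l_cancel_one')
        then show ?thesis using fcar by simp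
      qed
      have "subgroup K (add_monoid S)"
      proof (rule G.S.add.subgroupI)
        fix s assume "s \<in> K"
        then show "\<ominus>\<^bsub>S\<^esub> s \<in> K" using fcar by (simp add: K_def actinv)
      qed (use Kz fcar in \<open>auto simp: K_def N.rsmult_add_right\<close>)
      moreover have "H \<subseteq> K"
      proof
        fix s assume "s \<in> H"
        then obtain h x where h: "h \<in> rmodule_hom S G reg" and x: "x \<in> carrier G" and s: "s = h x"
          unfolding H_def by blast
        have hc: "h y \<in> carrier S" if "y \<in> carrier G" for y
          using h that by (auto simp: rmodule_hom_def hom_def reg_def)
        have "(\<lambda>y. m \<triangleleft>\<^bsub>M\<^esub> h y) \<in> rmodule_hom S G M"
          using h hc m by (auto simp: rmodule_hom_def hom_def reg_def M.rsmult_closed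
              M.rsmult_add_right M.rsmult_assoc)
        from eq[OF this x] show "s \<in> K" using hc[OF x] m by (simp add: K_def s fact)
      qed
      ultimately have "I \<subseteq> K" unfolding I_def by (intro G.S.add.generate_subgroup_incl)
      then have "f m \<triangleleft>\<^bsub>N\<^esub> \<one>\<^bsub>S\<^esub> = g m \<triangleleft>\<^bsub>N\<^esub> \<one>\<^bsub>S\<^esub>" using one by (auto simp: K_def)
      then show False using fcar ne by (simp add: N.rsmult_one)
    qed
  qed
qed


section \<open>Tensor products\<close>

text \<open>
  \<open>M \<otimes>\<^sub>S N\<close> for a right \<open>S\<close>-module \<open>M\<close> and a left \<open>S\<close>-module \<open>N\<close> (only
  the left action of the record \<open>N\<close> is used), as the quotient of the free abelian group on the
  pairs by the subgroup generated by the usual relations.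
\<close>

definition tensor_relations ::
  "('s, 'k) ring_scheme \<Rightarrow> ('s, 'm, 'i) rmodule_scheme \<Rightarrow> ('s, 'q, 'n, 'j) bimodule_scheme
    \<Rightarrow> ('m \<times> 'n \<Rightarrow>\<^sub>0 int) set"
  where "tensor_relations S M N =
      {frag_of (x \<oplus>\<^bsub>M\<^esub> y, z) - frag_of (x, z) - frag_of (y, z) | x y z.
        x \<in> carrier M \<and> y \<in> carrier M \<and> z \<in> carrier N}
    \<union> {frag_of (x, y \<oplus>\<^bsub>N\<^esub> z) - frag_of (x, y) - frag_of (x, z) | x y z.
        x \<in> carrier M \<and> y \<in> carrier N \<and> z \<in> carrier N}
    \<union> {frag_of (x \<triangleleft>\<^bsub>M\<^esub> s, z) - frag_of (x, s \<triangleright>\<^bsub>N\<^esub> z) | x s z.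
        x \<in> carrier M \<and> s \<in> carrier S \<and> z \<in> carrier N}"

definition tensor_free ::
  "('s, 'm, 'i) rmodule_scheme \<Rightarrow> ('s, 'q, 'n, 'j) bimodule_scheme \<Rightarrow> ('m \<times> 'n \<Rightarrow>\<^sub>0 int) monoid"
  where "tensor_free M N = free_Abelian_group (carrier M \<times> carrier N)"

definition tensor_kernel ::
  "('s, 'k) ring_scheme \<Rightarrow> ('s, 'm, 'i) rmodule_scheme \<Rightarrow> ('s, 'q, 'n, 'j) bimodule_scheme
    \<Rightarrow> ('m \<times> 'n \<Rightarrow>\<^sub>0 int) set"
  where "tensor_kernel S M N = generate (tensor_free M N) (tensor_relations S M N)"

definition tensor_group ::
  "('s, 'k) ring_scheme \<Rightarrow> ('s, 'm, 'i) rmodule_scheme \<Rightarrow> ('s, 'q, 'n, 'j) bimodule_scheme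
    \<Rightarrow> ('m \<times> 'n \<Rightarrow>\<^sub>0 int) set ring"
  where "tensor_group S M N = (let Q = tensor_free M N Mod tensor_kernel S M N in
    \<lparr>carrier = carrier Q, monoid.mult = (\<lambda>_ _. undefined), one = undefined,
     ring.zero = one Q, add = monoid.mult Q\<rparr>)"

definition pure_tensor ::
  "('s, 'k) ring_scheme \<Rightarrow> ('s, 'm, 'i) rmodule_scheme \<Rightarrow> ('s, 'q, 'n, 'j) bimodule_scheme
    \<Rightarrow> 'm \<Rightarrow> 'n \<Rightarrow> ('m \<times> 'n \<Rightarrow>\<^sub>0 int) set"
  where "pure_tensor S M N x y = tensor_kernel S M N #>\<^bsub>tensor_free M N\<^esub> frag_of (x, y)"

text \<open>
  \<open>tensor_lift G \<phi> t\<close> is \<open>\<phi>(t\<^sup>1, t\<^sup>2)\<close> (summation suppressed) for a balanced map \<open>\<phi>\<close>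
  into the abelian group \<open>G\<close>, i.e. the common value of
  the sums \<open>\<Sum> k\<^sub>i \<phi>(x\<^sub>i, y\<^sub>i)\<close> over all representatives \<open>\<Sum> k\<^sub>i (x\<^sub>i, y\<^sub>i)\<close> of the class \<open>t\<close>.
\<close>

definition free_extend :: "('g, 'i) ring_scheme \<Rightarrow> ('m \<Rightarrow> 'n \<Rightarrow> 'g) \<Rightarrow> ('m \<times> 'n \<Rightarrow>\<^sub>0 int) \<Rightarrow> 'g"
  where "free_extend G \<phi> p =
    (\<Oplus>\<^bsub>G\<^esub>z\<in>Poly_Mapping.keys p. [Poly_Mapping.lookup p z] \<cdot>\<^bsub>G\<^esub> \<phi> (fst z) (snd z))"

definition tensor_lift ::
  "('g, 'i) ring_scheme \<Rightarrow> ('m \<Rightarrow> 'n \<Rightarrow> 'g) \<Rightarrow> ('m \<times> 'n \<Rightarrow>\<^sub>0 int) set \<Rightarrow> 'g"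
  where "tensor_lift G \<phi> t = the_elem (free_extend G \<phi> ` t)"

definition balanced ::
  "('s, 'k) ring_scheme \<Rightarrow> ('s, 'm, 'i) rmodule_scheme \<Rightarrow> ('s, 'q, 'n, 'j) bimodule_scheme
    \<Rightarrow> ('g, 'l) ring_scheme \<Rightarrow> ('m \<Rightarrow> 'n \<Rightarrow> 'g) \<Rightarrow> bool"
  where "balanced S M N G \<phi> \<longleftrightarrow>
    (\<forall>x\<in>carrier M. \<forall>z\<in>carrier N. \<phi> x z \<in> carrier G) \<and>
    (\<forall>x\<in>carrier M. \<forall>y\<in>carrier M. \<forall>z\<in>carrier N. \<phi> (x \<oplus>\<^bsub>M\<^esub> y) z = \<phi> x z \<oplus>\<^bsub>G\<^esub> \<phi> y z) \<and>
    (\<forall>x\<in>carrier M. \<forall>y\<in>carrier N. \<forall>z\<in>carrier N. \<phi> x (y \<oplus>\<^bsub>N\<^esub> z) = \<phi> x y \<oplus>\<^bsub>G\<^esub> \<phi> x z) \<and>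
    (\<forall>x\<in>carrier M. \<forall>s\<in>carrier S. \<forall>z\<in>carrier N. \<phi> (x \<triangleleft>\<^bsub>M\<^esub> s) z = \<phi> x (s \<triangleright>\<^bsub>N\<^esub> z))"


lemma tensor_free_comm_group: "comm_group (tensor_free M N)"
  by (simp add: tensor_free_def abelian_free_Abelian_group)

lemma free_extend_frag_of:
  assumes "abelian_group G" and "\<phi> x y \<in> carrier G"
  shows "free_extend G \<phi> (frag_of (x, y)) = \<phi> x y"
proof -
  interpret abelian_group G by fact
  show ?thesis using assms(2)
    by (simp add: free_extend_def keys_frag_of)
qed

lemma free_extend_hom:
  fixes M :: "('s, 'm, 'i) rmodule_scheme" and N :: "('s, 'q, 'n, 'j) bimodule_scheme"
    and \<phi> :: "'m \<Rightarrow> 'n \<Rightarrow> 'g"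
  assumes "abelian_group G" and \<phi>: "\<And>x y. \<lbrakk>x \<in> carrier M; y \<in> carrier N\<rbrakk> \<Longrightarrow> \<phi> x y \<in> carrier G"
  shows "free_extend G \<phi> \<in> hom (tensor_free M N) (add_monoid G)"
proof -
  interpret G: abelian_group G by fact
  let ?c = "\<lambda>(p :: 'm \<times> 'n \<Rightarrow>\<^sub>0 int) z. [Poly_Mapping.lookup p z] \<cdot>\<^bsub>G\<^esub> \<phi> (fst z) (snd z)"
  have cc: "?c p z \<in> carrier G" if "z \<in> carrier M \<times> carrier N" for p z
    using that \<phi> by auto
  have z: "[(0 :: int)] \<cdot>\<^bsub>G\<^esub> a = \<zero>\<^bsub>G\<^esub>" for a
    by (simp add: add_pow_def)
  have ext: "free_extend G \<phi> p = (\<Oplus>\<^bsub>G\<^esub>z\<in>A. ?c p z)"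
    if "finite A" "Poly_Mapping.keys p \<subseteq> A" "A \<subseteq> carrier M \<times> carrier N" for p A
    unfolding free_extend_def using that cc
    by (intro G.add.finprod_mono_neutral_cong_left) 
      (auto simp: in_keys_iff subset_iff z)
  have "free_extend G \<phi> (p + q) = free_extend G \<phi> p \<oplus>\<^bsub>G\<^esub> free_extend G \<phi> q"
    if "Poly_Mapping.keys p \<subseteq> carrier M \<times> carrier N" "Poly_Mapping.keys q \<subseteq> carrier M \<times> carrier N" for p q
  proof -
    let ?A = "Poly_Mapping.keys p \<union> Poly_Mapping.keys q"
    have A: "?A \<subseteq> carrier M \<times> carrier N" using that by auto
    have "free_extend G \<phi> (p + q) = (\<Oplus>\<^bsub>G\<^esub>z\<in>?A. ?c (p + q) z)"
      by (rule ext) (use A keys_add[of p q] in auto)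
    also have "\<dots> = (\<Oplus>\<^bsub>G\<^esub>z\<in>?A. ?c p z \<oplus>\<^bsub>G\<^esub> ?c q z)"
      using A \<phi> cc by (intro G.finsum_cong')
        (auto simp: lookup_add subset_iff G.add.int_pow_mult)
    also have "\<dots> = (\<Oplus>\<^bsub>G\<^esub>z\<in>?A. ?c p z) \<oplus>\<^bsub>G\<^esub> (\<Oplus>\<^bsub>G\<^esub>z\<in>?A. ?c q z)"
      using A cc by (intro G.finsum_addf) (auto simp: subset_iff)
    also have "\<dots> = free_extend G \<phi> p \<oplus>\<^bsub>G\<^esub> free_extend G \<phi> q"
      using ext[of ?A p] ext[of ?A q] A by simp
    finally show ?thesis .
  qed
  moreover have "free_extend G \<phi> p \<in> carrier G" if "Poly_Mapping.keys p \<subseteq> carrier M \<times> carrier N" for p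
    unfolding free_extend_def using that cc by (intro G.finsum_closed) (auto simp: subset_iff)
  ultimately show ?thesis by (auto simp: hom_def tensor_free_def)
qed

lemma balanced_closed:
  "\<lbrakk>balanced S M N G \<phi>; x \<in> carrier M; y \<in> carrier N\<rbrakk> \<Longrightarrow> \<phi> x y \<in> carrier G"
  by (auto simp: balanced_def)

context
  fixes S :: "('s, 'k) ring_scheme" and M :: "('s, 'm, 'i) rmodule_scheme"
    and N :: "('s, 'q, 'n, 'j) bimodule_scheme"
  assumes Mact: "\<And>x s. \<lbrakk>x \<in> carrier M; s \<in> carrier S\<rbrakk> \<Longrightarrow> x \<triangleleft>\<^bsub>M\<^esub> s \<in> carrier M"
    and Madd: "\<And>x y. \<lbrakk>x \<in> carrier M; y \<in> carrier M\<rbrakk> \<Longrightarrow> x \<oplus>\<^bsub>M\<^esub> y \<in> carrier M"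
    and Nact: "\<And>x s. \<lbrakk>x \<in> carrier N; s \<in> carrier S\<rbrakk> \<Longrightarrow> s \<triangleright>\<^bsub>N\<^esub> x \<in> carrier N"
    and Nadd: "\<And>x y. \<lbrakk>x \<in> carrier N; y \<in> carrier N\<rbrakk> \<Longrightarrow> x \<oplus>\<^bsub>N\<^esub> y \<in> carrier N"
begin

lemma tensor_free_frag_of:
  "\<lbrakk>x \<in> carrier M; y \<in> carrier N\<rbrakk> \<Longrightarrow> frag_of (x, y) \<in> carrier (tensor_free M N)"
  by (simp add: tensor_free_def)

lemma tensor_free_diff:
  "\<lbrakk>p \<in> carrier (tensor_free M N); q \<in> carrier (tensor_free M N)\<rbrakk> \<Longrightarrow> p - q \<in> carrier (tensor_free M N)"
  using keys_diff[of p q] unfolding tensor_free_def carrier_free_Abelian_group_iff by blast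

lemma tensor_relations_subset: "tensor_relations S M N \<subseteq> carrier (tensor_free M N)"
  unfolding tensor_relations_def
  by (auto simp del: carrier_free_Abelian_group_iff
      intro!: tensor_free_diff tensor_free_frag_of Mact Madd Nact Nadd)

lemma tensor_kernel_subgroup: "subgroup (tensor_kernel S M N) (tensor_free M N)"
proof -
  interpret comm_group "tensor_free M N" by (rule tensor_free_comm_group)
  show ?thesis
    unfolding tensor_kernel_def by (rule generate_is_subgroup[OF tensor_relations_subset])
qed

lemma tensor_kernel_normal: "tensor_kernel S M N \<lhd> tensor_free M N"
  using comm_group.subgroup_imp_normal[OF tensor_free_comm_group tensor_kernel_subgroup] .

lemma tensor_group_add_monoid:
  "add_monoid (tensor_group S M N) = tensor_free M N Mod tensor_kernel S M N"
  by (simp add: tensor_group_def Let_def FactGroup_def)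

lemma tensor_group_abelian: "abelian_group (tensor_group S M N)"
proof -
  have "comm_group (tensor_free M N Mod tensor_kernel S M N)"
    by (rule comm_group.abelian_FactGroup[OF tensor_free_comm_group tensor_kernel_subgroup])
  then show ?thesis
    by (intro abelian_group.intro abelian_group_axioms.intro abelian_monoid.intro)
      (simp_all add: tensor_group_add_monoid[simplified] comm_group_def)
qed

context
  fixes G :: "('g, 'l) ring_scheme" and \<phi> :: "'m \<Rightarrow> 'n \<Rightarrow> 'g"
  assumes G: "abelian_group G" and bal: "balanced S M N G \<phi>"
begin

lemma free_extend_kernel: "p \<in> tensor_kernel S M N \<Longrightarrow> free_extend G \<phi> p = \<zero>\<^bsub>G\<^esub>"
proof -
  interpret G: abelian_group G by (rule G)
  have hom: "free_extend G \<phi> \<in> hom (tensor_free M N) (add_monoid G)"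
    by (rule free_extend_hom[OF G balanced_closed[OF bal]])
  interpret h: group_hom "tensor_free M N" "add_monoid G" "free_extend G \<phi>"
    using hom comm_group.axioms(2)[OF tensor_free_comm_group, of M N] G.a_group
    by (simp add: group_hom_def group_hom_axioms_def)
  have diff: "free_extend G \<phi> (p - q) = free_extend G \<phi> p \<ominus>\<^bsub>G\<^esub> free_extend G \<phi> q"
    if "p \<in> carrier (tensor_free M N)" "q \<in> carrier (tensor_free M N)" for p q
  proof -
    have "free_extend G \<phi> (- q) = \<ominus>\<^bsub>G\<^esub> free_extend G \<phi> q"
      using h.hom_inv[OF that(2)] that(2) by (simp add: tensor_free_def a_inv_def)
    moreover have "- q \<in> carrier (tensor_free M N)" using that(2) by (simp add: tensor_free_def)
    ultimately show ?thesis
      using h.hom_mult[of p "- q"] that by (simp add: tensor_free_def a_minus_def)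
  qed
  have fr: "free_extend G \<phi> (frag_of (x, y)) = \<phi> x y" if "x \<in> carrier M" "y \<in> carrier N" for x y
    using free_extend_frag_of[OF G, of \<phi>] balanced_closed[OF bal that] .
  note cl = balanced_closed[OF bal]
  have zero: "(a \<oplus>\<^bsub>G\<^esub> b) \<ominus>\<^bsub>G\<^esub> a \<ominus>\<^bsub>G\<^esub> b = \<zero>\<^bsub>G\<^esub>" if "a \<in> carrier G" "b \<in> carrier G" for a b
    using that G.a_comm[OF that] by (simp add: a_minus_def G.a_assoc G.r_neg G.r_neg2)
  have rel: "free_extend G \<phi> p = \<zero>\<^bsub>G\<^esub>" if "p \<in> tensor_relations S M N" for p
  proof -
    from that consider
      (a) x y z where "x \<in> carrier M" "y \<in> carrier M" "z \<in> carrier N"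
        "p = frag_of (x \<oplus>\<^bsub>M\<^esub> y, z) - frag_of (x, z) - frag_of (y, z)"
    | (b) x y z where "x \<in> carrier M" "y \<in> carrier N" "z \<in> carrier N"
        "p = frag_of (x, y \<oplus>\<^bsub>N\<^esub> z) - frag_of (x, y) - frag_of (x, z)"
    | (c) x s z where "x \<in> carrier M" "s \<in> carrier S" "z \<in> carrier N"
        "p = frag_of (x \<triangleleft>\<^bsub>M\<^esub> s, z) - frag_of (x, s \<triangleright>\<^bsub>N\<^esub> z)"
      unfolding tensor_relations_def by blast
    then show ?thesis
    proof cases
      case a
      moreover have "\<phi> (x \<oplus>\<^bsub>M\<^esub> y) z = \<phi> x z \<oplus>\<^bsub>G\<^esub> \<phi> y z" using bal a by (simp add: balanced_def)
      ultimately show ?thesis by (simp add: diff tensor_free_frag_of tensor_free_diff fr cl zero Madd)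
    next
      case b
      moreover have "\<phi> x (y \<oplus>\<^bsub>N\<^esub> z) = \<phi> x y \<oplus>\<^bsub>G\<^esub> \<phi> x z" using bal b by (simp add: balanced_def)
      ultimately show ?thesis by (simp add: diff tensor_free_frag_of tensor_free_diff fr cl zero Nadd)
    next
      case c
      moreover have "\<phi> (x \<triangleleft>\<^bsub>M\<^esub> s) z = \<phi> x (s \<triangleright>\<^bsub>N\<^esub> z)" using bal c by (simp add: balanced_def)
      ultimately show ?thesis by (simp add: diff tensor_free_frag_of tensor_free_diff fr cl Mact Nact G.r_neg a_minus_def)
    qed
  qed
  have "tensor_kernel S M N \<subseteq> kernel (tensor_free M N) (add_monoid G) (free_extend G \<phi>)"
    unfolding tensor_kernel_def
    by (rule group.generate_subgroup_incl[OF h.G.is_group _ h.subgroup_kernel])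
      (use tensor_relations_subset rel in \<open>auto simp: kernel_def\<close>)
  then show "p \<in> tensor_kernel S M N \<Longrightarrow> free_extend G \<phi> p = \<zero>\<^bsub>G\<^esub>" by (auto simp: kernel_def)
qed

lemma tensor_lift_coset:
  assumes "p \<in> carrier (tensor_free M N)"
  shows "tensor_lift G \<phi> (tensor_kernel S M N #>\<^bsub>tensor_free M N\<^esub> p) = free_extend G \<phi> p"
proof -
  interpret G: abelian_group G by (rule G)
  have hom: "free_extend G \<phi> \<in> hom (tensor_free M N) (add_monoid G)"
    by (rule free_extend_hom[OF G balanced_closed[OF bal]])
  have sub: "tensor_kernel S M N \<subseteq> carrier (tensor_free M N)"
    using subgroup.subset[OF tensor_kernel_subgroup] .
  have "free_extend G \<phi> (q \<otimes>\<^bsub>tensor_free M N\<^esub> p) = free_extend G \<phi> p"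
    if "q \<in> tensor_kernel S M N" for q
    using hom_mult[OF hom subsetD[OF sub that] assms] hom_in_carrier[OF hom assms]
      free_extend_kernel[OF that] by simp
  moreover have "tensor_kernel S M N \<noteq> {}"
    using subgroup.one_closed[OF tensor_kernel_subgroup] by blast
  ultimately have "free_extend G \<phi> ` (tensor_kernel S M N #>\<^bsub>tensor_free M N\<^esub> p) = {free_extend G \<phi> p}"
    unfolding r_coset_def by (auto simp: image_UN)
  then show ?thesis by (simp add: tensor_lift_def)
qed

lemma tensor_lift_pure:
  assumes "x \<in> carrier M" "y \<in> carrier N"
  shows "tensor_lift G \<phi> (pure_tensor S M N x y) = \<phi> x y"
  using tensor_lift_coset[of "frag_of (x, y)"] assms
    free_extend_frag_of[OF G, of \<phi>, OF balanced_closed[OF bal assms]]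
  by (simp add: pure_tensor_def tensor_free_def)

lemma tensor_lift_hom: "tensor_lift G \<phi> \<in> hom (add_monoid (tensor_group S M N)) (add_monoid G)"
proof -
  interpret F: comm_group "tensor_free M N" by (rule tensor_free_comm_group)
  have hom: "free_extend G \<phi> \<in> hom (tensor_free M N) (add_monoid G)"
    by (rule free_extend_hom[OF G balanced_closed[OF bal]])
  show ?thesis
    unfolding tensor_group_add_monoid
    using hom_in_carrier[OF hom] hom_mult[OF hom]
    by (auto simp: hom_def carrier_FactGroup tensor_lift_coset
        normal.rcos_sum[OF tensor_kernel_normal])
qed

end

end


section \<open>Ring extensions\<close>

text \<open>A ring extension \<open>A | B\<close> is given by the rings \<open>A\<close>, \<open>B\<close> and the homomorphism \<open>\<iota> : B \<rightarrow> A\<close>.\<close>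

definition ext_right :: "('a, 'k) ring_scheme \<Rightarrow> ('b \<Rightarrow> 'a) \<Rightarrow> ('b, 'a) rmodule"
  where "ext_right A \<iota> = \<lparr>carrier = carrier A, monoid.mult = monoid.mult A, one = one A, ring.zero = ring.zero A,
    add = add A, rsmult = (\<lambda>a b. a \<otimes>\<^bsub>A\<^esub> \<iota> b)\<rparr>"

definition ext_left :: "('a, 'k) ring_scheme \<Rightarrow> ('b \<Rightarrow> 'a) \<Rightarrow> ('b, 'a, 'a) bimodule"
  where "ext_left A \<iota> = \<lparr>carrier = carrier A, monoid.mult = monoid.mult A, one = one A, ring.zero = ring.zero A,
    add = add A, rsmult = (\<lambda>x a. x \<otimes>\<^bsub>A\<^esub> a), lsmult = (\<lambda>b a. \<iota> b \<otimes>\<^bsub>A\<^esub> a)\<rparr>"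

definition ext_tensor_group ::
  "('a, 'k) ring_scheme \<Rightarrow> ('b, 'l) ring_scheme \<Rightarrow> ('b \<Rightarrow> 'a) \<Rightarrow> ('a \<times> 'a \<Rightarrow>\<^sub>0 int) set ring"
  where "ext_tensor_group A B \<iota> = tensor_group B (ext_right A \<iota>) (ext_left A \<iota>)"

definition ext_tensor ::
  "('a, 'k) ring_scheme \<Rightarrow> ('b, 'l) ring_scheme \<Rightarrow> ('b \<Rightarrow> 'a) \<Rightarrow> 'a \<Rightarrow> 'a \<Rightarrow> ('a \<times> 'a \<Rightarrow>\<^sub>0 int) set"
  where "ext_tensor A B \<iota> a a' = pure_tensor B (ext_right A \<iota>) (ext_left A \<iota>) a a'"

text \<open>\<open>A \<otimes>\<^sub>B A\<close> with its outer \<open>A\<close>-\<open>A\<close>-bimodule structure.\<close>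

definition tensor_square ::
  "('a, 'k) ring_scheme \<Rightarrow> ('b, 'l) ring_scheme \<Rightarrow> ('b \<Rightarrow> 'a)
    \<Rightarrow> ('a, 'a, ('a \<times> 'a \<Rightarrow>\<^sub>0 int) set) bimodule"
  where "tensor_square A B \<iota> = (let G = ext_tensor_group A B \<iota> in
    \<lparr>carrier = carrier G, monoid.mult = monoid.mult G, one = one G, ring.zero = ring.zero G, add = add G,
     rsmult = (\<lambda>x c. tensor_lift G (\<lambda>a a'. ext_tensor A B \<iota> a (a' \<otimes>\<^bsub>A\<^esub> c)) x),
     lsmult = (\<lambda>c x. tensor_lift G (\<lambda>a a'. ext_tensor A B \<iota> (c \<otimes>\<^bsub>A\<^esub> a) a') x)\<rparr>)"

text \<open>
  \<open>M\<^sup>B\<close> for an \<open>A\<close>-\<open>A\<close>-bimodule \<open>M\<close>, regarded as a \<open>B\<close>-\<open>B\<close>-bimodule by restriction along \<open>\<iota>\<close>.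
\<close>

definition invariants ::
  "('b, 'l) ring_scheme \<Rightarrow> ('b \<Rightarrow> 'a) \<Rightarrow> ('a, 'a, 'm, 'i) bimodule_scheme \<Rightarrow> 'm set"
  where "invariants B \<iota> M = {m \<in> carrier M. \<forall>b\<in>carrier B. \<iota> b \<triangleright>\<^bsub>M\<^esub> m = m \<triangleleft>\<^bsub>M\<^esub> \<iota> b}"

text \<open>
  \<open>t \<cdot> (a \<otimes> a') = a t\<^sup>1 \<otimes> t\<^sup>2 a'\<close>. The order of nesting matters: for fixed \<open>a, a'\<close> the inner map is
  balanced in \<open>(t\<^sup>1, t\<^sup>2)\<close>, whereas the outer map is balanced in \<open>(a, a')\<close> only because
  \<open>t\<close> is \<open>B\<close>-invariant.
\<close>

definition T_action ::
  "('a, 'k) ring_scheme \<Rightarrow> ('b, 'l) ring_scheme \<Rightarrow> ('b \<Rightarrow> 'a)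
    \<Rightarrow> ('a \<times> 'a \<Rightarrow>\<^sub>0 int) set \<Rightarrow> ('a \<times> 'a \<Rightarrow>\<^sub>0 int) set \<Rightarrow> ('a \<times> 'a \<Rightarrow>\<^sub>0 int) set"
  where "T_action A B \<iota> t x = (let G = ext_tensor_group A B \<iota> in
    tensor_lift G (\<lambda>a a'. tensor_lift G (\<lambda>t1 t2. ext_tensor A B \<iota> (a \<otimes>\<^bsub>A\<^esub> t1) (t2 \<otimes>\<^bsub>A\<^esub> a')) t) x)"

text \<open>
  The product \<open>t t' = t'\<^sup>1 t\<^sup>1 \<otimes> t\<^sup>2 t'\<^sup>2\<close> of \<open>T\<close> is the same expression as \<open>t \<cdot> t'\<close>.
\<close>

definition T_ring ::
  "('a, 'k) ring_scheme \<Rightarrow> ('b, 'l) ring_scheme \<Rightarrow> ('b \<Rightarrow> 'a) \<Rightarrow> ('a \<times> 'a \<Rightarrow>\<^sub>0 int) set ring"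
  where "T_ring A B \<iota> = (let G = ext_tensor_group A B \<iota> in
    \<lparr>carrier = invariants B \<iota> (tensor_square A B \<iota>),
     monoid.mult = T_action A B \<iota>, one = ext_tensor A B \<iota> \<one>\<^bsub>A\<^esub> \<one>\<^bsub>A\<^esub>,
     ring.zero = ring.zero G, add = add G\<rparr>)"

text \<open>The centralizer \<open>R\<close> as a right \<open>T\<close>-module, \<open>r \<cdot> t = t\<^sup>1 r t\<^sup>2\<close>.\<close>

definition centralizer_module ::
  "('a, 'k) ring_scheme \<Rightarrow> ('b, 'l) ring_scheme \<Rightarrow> ('b \<Rightarrow> 'a)
    \<Rightarrow> (('a \<times> 'a \<Rightarrow>\<^sub>0 int) set, 'a) rmodule"
  where "centralizer_module A B \<iota> =
    \<lparr>carrier = invariants B \<iota> (regular_bimodule A), monoid.mult = monoid.mult A, one = one A, ring.zero = ring.zero A,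
     add = add A, rsmult = (\<lambda>r t. tensor_lift A (\<lambda>t1 t2. t1 \<otimes>\<^bsub>A\<^esub> r \<otimes>\<^bsub>A\<^esub> t2) t)\<rparr>"

text \<open>\<open>A \<otimes>\<^sub>B A\<close> as a \<open>T\<close>-\<open>A\<close>-bimodule.\<close>

definition T_tensor_square ::
  "('a, 'k) ring_scheme \<Rightarrow> ('b, 'l) ring_scheme \<Rightarrow> ('b \<Rightarrow> 'a)
    \<Rightarrow> (('a \<times> 'a \<Rightarrow>\<^sub>0 int) set, 'a, ('a \<times> 'a \<Rightarrow>\<^sub>0 int) set) bimodule"
  where "T_tensor_square A B \<iota> = (let M = tensor_square A B \<iota> in
    \<lparr>carrier = carrier M, monoid.mult = monoid.mult M, one = one M, ring.zero = ring.zero M, add = add M,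
     rsmult = rsmult M, lsmult = T_action A B \<iota>\<rparr>)"

text \<open>
  \<open>R \<otimes>\<^sub>T (A \<otimes>\<^sub>B A)\<close> with the \<open>A\<close>-\<open>A\<close>-bimodule structure coming from the outer one on the second factor.
\<close>

definition R_tensor_square ::
  "('a, 'k) ring_scheme \<Rightarrow> ('b, 'l) ring_scheme \<Rightarrow> ('b \<Rightarrow> 'a)
    \<Rightarrow> ('a, 'a, ('a \<times> ('a \<times> 'a \<Rightarrow>\<^sub>0 int) set \<Rightarrow>\<^sub>0 int) set) bimodule"
  where "R_tensor_square A B \<iota> = (let
      T = T_ring A B \<iota>; R = centralizer_module A B \<iota>;
      N = T_tensor_square A B \<iota>; M = tensor_square A B \<iota>;
      G = tensor_group T R N
    in \<lparr>carrier = carrier G, monoid.mult = monoid.mult G, one = one G, ring.zero = ring.zero G, add = add G,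
      rsmult = (\<lambda>z c. tensor_lift G (\<lambda>r x. pure_tensor T R N r (x \<triangleleft>\<^bsub>M\<^esub> c)) z),
      lsmult = (\<lambda>c z. tensor_lift G (\<lambda>r x. pure_tensor T R N r (c \<triangleright>\<^bsub>M\<^esub> x)) z)\<rparr>)"

definition H_separable ::
  "('a, 'k) ring_scheme \<Rightarrow> ('b, 'l) ring_scheme \<Rightarrow> ('b \<Rightarrow> 'a) \<Rightarrow> bool"
  where "H_separable A B \<iota> \<longleftrightarrow> (\<exists>n>0.
    isomorphic_to_summand A A (tensor_square A B \<iota>) (bimodule_power n (regular_bimodule A)))"

end

theory Submission
  imports Defs
begin

text \<open>
  Bimodule maps \<open>A \<otimes>\<^sub>B A \<rightarrow> X\<close> correspond to elements of \<open>X\<^sup>B\<close>, the images of \<open>1 \<otimes> 1\<close>, and bimodule maps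
  \<open>A \<rightarrow> A \<otimes>\<^sub>B A\<close> to Casimir elements \<open>e\<close>, those with \<open>a e = e a\<close> for all \<open>a\<close>. Hence \<open>A | B\<close> is H-separable
  iff \<open>1 \<otimes> 1 = \<Sum> r\<^sub>i e\<^sub>i\<close> with \<open>r\<^sub>i \<in> R\<close> and \<open>e\<^sub>i\<close> Casimir.

  Given such a decomposition, the maps \<open>r \<mapsto> r e\<^sub>i\<close> from \<open>R\<close> to \<open>T\<close> have \<open>1\<close> in their trace, so \<open>R\<^sub>T\<close> is a
  generator. The evaluation \<open>r \<otimes> x \<mapsto> x\<^sup>1 r x\<^sup>2\<close> is clearly onto \<open>A\<close>. The central elements that annihilate
  its kernel form an ideal \<open>K\<close> which contains all \<open>e\<^sup>1 r e\<^sup>2\<close>, and \<open>r = \<Sum> (e\<^sub>i\<^sup>1 r e\<^sub>i\<^sup>2) r\<^sub>i\<close> shows \<open>R = K R\<close> with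
  \<open>R\<close> finitely generated, so \<open>1 \<in> K\<close> by Nakayama's lemma, and the evaluation is injective.

  Conversely, let \<open>\<Phi> : R \<otimes>\<^sub>T (A \<otimes>\<^sub>B A) \<cong> A\<close> be any bimodule isomorphism. For \<open>h : R \<rightarrow> T\<close> linear, the bimodule map
  \<open>r \<otimes> x \<mapsto> h(r) \<cdot> x\<close> composed with \<open>\<Phi>\<^sup>-\<^sup>1\<close> sends \<open>1\<close> to a Casimir element \<open>e\<close>, and \<open>h(r) = c e\<close> with
  \<open>c = \<Phi>(r \<otimes> (1 \<otimes> 1)) \<in> R\<close>. As \<open>R\<^sub>T\<close> is a generator, \<open>1 \<otimes> 1\<close> is a sum of such values \<open>h(r)\<close>.
\<close>

section \<open>Bimodules\<close>

text \<open>The bimodule records carry operations but no laws. Building on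
  \<open>right_module\<close>, it remains to add the laws of the left action and its commutation
  with the right one.\<close>

locale two_sided_module = L?: ring R + right_module S M
  for R :: "('r, 'k) ring_scheme" and S :: "('s, 'l) ring_scheme"
    and M :: "('r, 's, 'm, 'i) bimodule_scheme" +
  assumes lsmult_closed: "\<lbrakk>r \<in> carrier R; x \<in> carrier M\<rbrakk> \<Longrightarrow> r \<triangleright>\<^bsub>M\<^esub> x \<in> carrier M"
    and lsmult_add_right: "\<lbrakk>r \<in> carrier R; x \<in> carrier M; y \<in> carrier M\<rbrakk> \<Longrightarrow>
      r \<triangleright>\<^bsub>M\<^esub> (x \<oplus>\<^bsub>M\<^esub> y) = r \<triangleright>\<^bsub>M\<^esub> x \<oplus>\<^bsub>M\<^esub> r \<triangleright>\<^bsub>M\<^esub> y"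
    and lsmult_add_left: "\<lbrakk>r \<in> carrier R; r' \<in> carrier R; x \<in> carrier M\<rbrakk> \<Longrightarrow>
      (r \<oplus>\<^bsub>R\<^esub> r') \<triangleright>\<^bsub>M\<^esub> x = r \<triangleright>\<^bsub>M\<^esub> x \<oplus>\<^bsub>M\<^esub> r' \<triangleright>\<^bsub>M\<^esub> x"
    and lsmult_assoc: "\<lbrakk>r \<in> carrier R; r' \<in> carrier R; x \<in> carrier M\<rbrakk> \<Longrightarrow>
      (r \<otimes>\<^bsub>R\<^esub> r') \<triangleright>\<^bsub>M\<^esub> x = r \<triangleright>\<^bsub>M\<^esub> r' \<triangleright>\<^bsub>M\<^esub> x"
    and lsmult_one: "x \<in> carrier M \<Longrightarrow> \<one>\<^bsub>R\<^esub> \<triangleright>\<^bsub>M\<^esub> x = x"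
    and smult_commute: "\<lbrakk>r \<in> carrier R; x \<in> carrier M; s \<in> carrier S\<rbrakk> \<Longrightarrow>
      (r \<triangleright>\<^bsub>M\<^esub> x) \<triangleleft>\<^bsub>M\<^esub> s = r \<triangleright>\<^bsub>M\<^esub> (x \<triangleleft>\<^bsub>M\<^esub> s)"

definition bimodule_hom ::
  "('r, 'k) ring_scheme \<Rightarrow> ('s, 'l) ring_scheme \<Rightarrow> ('r, 's, 'm, 'i) bimodule_scheme
    \<Rightarrow> ('r, 's, 'n, 'j) bimodule_scheme \<Rightarrow> ('m \<Rightarrow> 'n) set"
  where "bimodule_hom R S M N = {h \<in> hom (add_monoid M) (add_monoid N).
    (\<forall>x\<in>carrier M. \<forall>r\<in>carrier R. h (r \<triangleright>\<^bsub>M\<^esub> x) = r \<triangleright>\<^bsub>N\<^esub> h x) \<and>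
    (\<forall>x\<in>carrier M. \<forall>s\<in>carrier S. h (x \<triangleleft>\<^bsub>M\<^esub> s) = h x \<triangleleft>\<^bsub>N\<^esub> s)}"

lemma bimodule_homI:
  assumes "\<And>x. x \<in> carrier M \<Longrightarrow> h x \<in> carrier N"
    and "\<And>x y. \<lbrakk>x \<in> carrier M; y \<in> carrier M\<rbrakk> \<Longrightarrow> h (x \<oplus>\<^bsub>M\<^esub> y) = h x \<oplus>\<^bsub>N\<^esub> h y"
    and "\<And>x r. \<lbrakk>x \<in> carrier M; r \<in> carrier R\<rbrakk> \<Longrightarrow> h (r \<triangleright>\<^bsub>M\<^esub> x) = r \<triangleright>\<^bsub>N\<^esub> h x"
    and "\<And>x s. \<lbrakk>x \<in> carrier M; s \<in> carrier S\<rbrakk> \<Longrightarrow> h (x \<triangleleft>\<^bsub>M\<^esub> s) = h x \<triangleleft>\<^bsub>N\<^esub> s"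
  shows "h \<in> bimodule_hom R S M N"
  using assms by (auto simp: bimodule_hom_def hom_def)

lemma bimodule_homD:
  assumes "h \<in> bimodule_hom R S M N"
  shows "h \<in> hom (add_monoid M) (add_monoid N)"
    and "x \<in> carrier M \<Longrightarrow> h x \<in> carrier N"
    and "\<lbrakk>x \<in> carrier M; y \<in> carrier M\<rbrakk> \<Longrightarrow> h (x \<oplus>\<^bsub>M\<^esub> y) = h x \<oplus>\<^bsub>N\<^esub> h y"
    and "\<lbrakk>x \<in> carrier M; r \<in> carrier R\<rbrakk> \<Longrightarrow> h (r \<triangleright>\<^bsub>M\<^esub> x) = r \<triangleright>\<^bsub>N\<^esub> h x"
    and "\<lbrakk>x \<in> carrier M; s \<in> carrier S\<rbrakk> \<Longrightarrow> h (x \<triangleleft>\<^bsub>M\<^esub> s) = h x \<triangleleft>\<^bsub>N\<^esub> s"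
  using assms by (auto simp: bimodule_hom_def hom_def)

lemma bimodule_hom_compose:
  assumes "g \<in> bimodule_hom R S M N" "h \<in> bimodule_hom R S N P"
  shows "(\<lambda>x. h (g x)) \<in> bimodule_hom R S M P"
  by (rule bimodule_homI) (simp_all add: bimodule_homD[OF assms(1)] bimodule_homD[OF assms(2)])

lemma additive_hom_zero:
  assumes "abelian_group M" "abelian_group N" "h \<in> hom (add_monoid M) (add_monoid N)"
  shows "h \<zero>\<^bsub>M\<^esub> = \<zero>\<^bsub>N\<^esub>"
  using group_hom.hom_one[of "add_monoid M" "add_monoid N" h] assms
  by (simp add: group_hom_def group_hom_axioms_def abelian_group.a_group)

lemma additive_hom_minus:
  assumes "abelian_group M" "abelian_group N" "h \<in> hom (add_monoid M) (add_monoid N)"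
    and "x \<in> carrier M"
  shows "h (\<ominus>\<^bsub>M\<^esub> x) = \<ominus>\<^bsub>N\<^esub> h x"
  using group_hom.hom_inv[of "add_monoid M" "add_monoid N" h x] assms
  by (simp add: group_hom_def group_hom_axioms_def abelian_group.a_group a_inv_def)

lemma additive_hom_finsum:
  assumes M: "abelian_group M" and N: "abelian_group N"
    and h: "h \<in> hom (add_monoid M) (add_monoid N)"
    and f: "f \<in> {..<n :: nat} \<rightarrow> carrier M"
  shows "h (\<Oplus>\<^bsub>M\<^esub>i\<in>{..<n}. f i) = (\<Oplus>\<^bsub>N\<^esub>i\<in>{..<n}. h (f i))"
  using f
proof (induction n)
  case 0
  interpret M: abelian_group M by fact
  interpret N: abelian_group N by fact
  show ?case by (simp add: additive_hom_zero[OF M N h])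
next
  case (Suc n)
  interpret M: abelian_group M by fact
  interpret N: abelian_group N by fact
  have "f n \<in> carrier M" "f \<in> {..<n} \<rightarrow> carrier M" using Suc.prems by auto
  moreover from this have "h (f n) \<in> carrier N" "(\<lambda>i. h (f i)) \<in> {..<n} \<rightarrow> carrier N"
    using hom_in_carrier[OF h] by auto
  ultimately show ?case
    using Suc.IH hom_mult[OF h, of "f n" "\<Oplus>\<^bsub>M\<^esub>i\<in>{..<n}. f i"]
    by (simp add: lessThan_Suc)
qed

context right_module
begin

lemma rsmult_hom: "s \<in> carrier S \<Longrightarrow> (\<lambda>x. x \<triangleleft>\<^bsub>M\<^esub> s) \<in> hom (add_monoid M) (add_monoid M)"
  by (auto simp: hom_def rsmult_closed rsmult_add_left)

lemma rsmult_zero_left: "s \<in> carrier S \<Longrightarrow> \<zero>\<^bsub>M\<^esub> \<triangleleft>\<^bsub>M\<^esub> s = \<zero>\<^bsub>M\<^esub>"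
  by (rule additive_hom_zero[OF M.abelian_group_axioms M.abelian_group_axioms rsmult_hom])

lemma rsmult_scalar_hom: "x \<in> carrier M \<Longrightarrow> (\<lambda>s. x \<triangleleft>\<^bsub>M\<^esub> s) \<in> hom (add_monoid S) (add_monoid M)"
  by (auto simp: hom_def rsmult_closed rsmult_add_right)

lemma rsmult_zero_right: "x \<in> carrier M \<Longrightarrow> x \<triangleleft>\<^bsub>M\<^esub> \<zero>\<^bsub>S\<^esub> = \<zero>\<^bsub>M\<^esub>"
  by (rule additive_hom_zero[OF S.abelian_group_axioms M.abelian_group_axioms rsmult_scalar_hom])

end

context two_sided_module
begin

lemma lsmult_hom: "r \<in> carrier R \<Longrightarrow> (\<lambda>x. r \<triangleright>\<^bsub>M\<^esub> x) \<in> hom (add_monoid M) (add_monoid M)"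
  by (auto simp: hom_def lsmult_closed lsmult_add_right)

lemma lsmult_zero_right: "r \<in> carrier R \<Longrightarrow> r \<triangleright>\<^bsub>M\<^esub> \<zero>\<^bsub>M\<^esub> = \<zero>\<^bsub>M\<^esub>"
  by (rule additive_hom_zero[OF M.abelian_group_axioms M.abelian_group_axioms lsmult_hom])

lemma lsmult_scalar_hom: "x \<in> carrier M \<Longrightarrow> (\<lambda>r. r \<triangleright>\<^bsub>M\<^esub> x) \<in> hom (add_monoid R) (add_monoid M)"
  by (auto simp: hom_def lsmult_closed lsmult_add_left)

lemma lsmult_zero_left: "x \<in> carrier M \<Longrightarrow> \<zero>\<^bsub>R\<^esub> \<triangleright>\<^bsub>M\<^esub> x = \<zero>\<^bsub>M\<^esub>"
  by (rule additive_hom_zero[OF L.abelian_group_axioms M.abelian_group_axioms lsmult_scalar_hom])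

lemma lsmult_minus_left: "\<lbrakk>r \<in> carrier R; x \<in> carrier M\<rbrakk> \<Longrightarrow> (\<ominus>\<^bsub>R\<^esub> r) \<triangleright>\<^bsub>M\<^esub> x = \<ominus>\<^bsub>M\<^esub> (r \<triangleright>\<^bsub>M\<^esub> x)"
  by (rule additive_hom_minus[OF L.abelian_group_axioms M.abelian_group_axioms lsmult_scalar_hom])

end

section \<open>The regular bimodule and its finite powers\<close>

lemma regular_bimodule_simps [simp]:
  "carrier (regular_bimodule A) = carrier A"
  "\<zero>\<^bsub>regular_bimodule A\<^esub> = \<zero>\<^bsub>A\<^esub>"
  "x \<oplus>\<^bsub>regular_bimodule A\<^esub> y = x \<oplus>\<^bsub>A\<^esub> y"
  "x \<triangleleft>\<^bsub>regular_bimodule A\<^esub> a = x \<otimes>\<^bsub>A\<^esub> a"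
  "a \<triangleright>\<^bsub>regular_bimodule A\<^esub> x = a \<otimes>\<^bsub>A\<^esub> x"
  by (simp_all add: regular_bimodule_def)

lemma two_sided_module_regular:
  fixes A :: "('a, 'k) ring_scheme"
  assumes "ring A"
  shows "two_sided_module A A (regular_bimodule A)"
proof -
  interpret ring A by fact
  have ab: "abelian_group (regular_bimodule A)"
  proof (rule abelian_groupI)
    fix x assume "x \<in> carrier (regular_bimodule A)"
    then show "\<exists>y\<in>carrier (regular_bimodule A). y \<oplus>\<^bsub>regular_bimodule A\<^esub> x = \<zero>\<^bsub>regular_bimodule A\<^esub>"
      by (intro bexI[of _ "\<ominus>\<^bsub>A\<^esub> x"]) (auto simp: regular_bimodule_def l_neg)
  qed (auto simp: regular_bimodule_def a_ac)
  show ?thesis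
    by (intro two_sided_module.intro right_module.intro right_module_axioms.intro
        two_sided_module_axioms.intro ring_axioms ab)
      (auto simp: regular_bimodule_def l_distr r_distr m_assoc)
qed

lemma bimodule_power_simps:
  "x \<in> carrier (bimodule_power n M) \<longleftrightarrow> (\<forall>i<n. x i \<in> carrier M) \<and> x \<in> extensional {..<n}"
  "\<zero>\<^bsub>bimodule_power n M\<^esub> = (\<lambda>i\<in>{..<n}. \<zero>\<^bsub>M\<^esub>)"
  "x \<oplus>\<^bsub>bimodule_power n M\<^esub> y = (\<lambda>i\<in>{..<n}. x i \<oplus>\<^bsub>M\<^esub> y i)"
  "x \<triangleleft>\<^bsub>bimodule_power n M\<^esub> s = (\<lambda>i\<in>{..<n}. x i \<triangleleft>\<^bsub>M\<^esub> s)"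
  "r \<triangleright>\<^bsub>bimodule_power n M\<^esub> x = (\<lambda>i\<in>{..<n}. r \<triangleright>\<^bsub>M\<^esub> x i)"
  by (auto simp: bimodule_power_def PiE_iff)

lemma two_sided_module_power:
  fixes M :: "('r, 's, 'm, 'i) bimodule_scheme"
  assumes "two_sided_module R S M"
  shows "two_sided_module R S (bimodule_power n M)"
proof -
  interpret two_sided_module R S M by fact
  \<comment> \<open>Elements of a power are \<open>undefined\<close> outside \<open>{..<n}\<close>,
    so each law has to be checked only at the indices below \<open>n\<close>.\<close>
  have eqI: "x = y" if "x \<in> extensional {..<n}" "y \<in> extensional {..<n}" "\<And>i. i < n \<Longrightarrow> x i = y i"
    for x y :: "nat \<Rightarrow> 'm"
    using that by (intro extensionalityI[of _ "{..<n}"]) auto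
  have ab: "abelian_group (bimodule_power n M)"
  proof (rule abelian_groupI)
    fix x assume "x \<in> carrier (bimodule_power n M)"
    then show "\<exists>y\<in>carrier (bimodule_power n M). y \<oplus>\<^bsub>bimodule_power n M\<^esub> x = \<zero>\<^bsub>bimodule_power n M\<^esub>"
      by (intro bexI[of _ "\<lambda>i\<in>{..<n}. \<ominus>\<^bsub>M\<^esub> x i"] eqI) (simp_all add: bimodule_power_simps M.l_neg)
  qed (auto simp: bimodule_power_simps M.a_ac intro!: eqI)
  show ?thesis
    by (intro two_sided_module.intro right_module.intro right_module_axioms.intro
        two_sided_module_axioms.intro L.ring_axioms S.ring_axioms ab;
        (rule eqI)?)
      (simp_all add: bimodule_power_simps rsmult_closed rsmult_add_left rsmult_add_right rsmult_assoc
        rsmult_one lsmult_closed lsmult_add_left lsmult_add_right lsmult_assoc lsmult_one smult_commute)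
qed

section \<open>Isomorphisms and direct summands in terms of pairs of homomorphisms\<close>

lemma bimodule_iso_inverse:
  assumes "two_sided_module R S M" and \<Phi>: "\<Phi> \<in> bimodule_iso R S M N"
  obtains \<Psi> where "\<Psi> \<in> bimodule_hom R S N M" "\<And>x. x \<in> carrier M \<Longrightarrow> \<Psi> (\<Phi> x) = x"
proof -
  interpret M: two_sided_module R S M by fact
  have h: "\<Phi> \<in> bimodule_hom R S M N" and inj: "inj_on \<Phi> (carrier M)" and im: "carrier N = \<Phi> ` carrier M"
    using \<Phi> by (auto simp: bimodule_iso_def bimodule_hom_def iso_def bij_betw_def)
  let ?\<Psi> = "inv_into (carrier M) \<Phi>"
  have inv: "?\<Psi> (\<Phi> x) = x" if "x \<in> carrier M" for x using inv_into_f_f[OF inj that] .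
  \<comment> \<open>Every element of \<open>N\<close> has the form \<open>\<Phi> x\<close>, so
    linearity of the inverse is linearity of \<open>\<Phi>\<close> read from right to left.\<close>
  have "?\<Psi> \<in> bimodule_hom R S N M"
    by (rule bimodule_homI)
      (auto simp: im inv M.lsmult_closed M.rsmult_closed simp flip: bimodule_homD(3,4,5)[OF h])
  with inv that show ?thesis by blast
qed

text \<open>A retraction splits: the image of \<open>f\<close> and the kernel of \<open>g\<close>
  are complementary, because \<open>y = f (g y) + (y - f (g y))\<close> and \<open>g\<close> is
  injective on the image of \<open>f\<close>.\<close>

lemma isomorphic_to_summandI:
  fixes M :: "('r, 's, 'm, 'i) bimodule_scheme" and N :: "('r, 's, 'n, 'j) bimodule_scheme"
  assumes M: "two_sided_module R S M" and N: "two_sided_module R S N"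
    and f: "f \<in> bimodule_hom R S M N" and g: "g \<in> bimodule_hom R S N M"
    and gf: "\<And>x. x \<in> carrier M \<Longrightarrow> g (f x) = x"
  shows "isomorphic_to_summand R S M N"
proof -
  interpret M: two_sided_module R S M by fact
  interpret N: two_sided_module R S N by fact
  note Mab = M.M.abelian_group_axioms and Nab = N.M.abelian_group_axioms
  note fD = bimodule_homD[OF f] and gD = bimodule_homD[OF g]
  note f0 = additive_hom_zero[OF Mab Nab fD(1)] and fm = additive_hom_minus[OF Mab Nab fD(1)]
  note g0 = additive_hom_zero[OF Nab Mab gD(1)] and gm = additive_hom_minus[OF Nab Mab gD(1)]
  define P where "P = f ` carrier M"
  define Q where "Q = {y \<in> carrier N. g y = \<zero>\<^bsub>M\<^esub>}"
  have "subgroup P (add_monoid N)"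
    using f0 by (intro N.M.add.subgroupI) (auto simp: P_def fD(3)[symmetric] fD(2) fm[symmetric])
  then have P: "subbimodule R S P N"
    by (auto simp: subbimodule_def additive_subgroup_def P_def fD(4,5)[symmetric] M.lsmult_closed M.rsmult_closed)
  have "subgroup Q (add_monoid N)"
    using g0 by (intro N.M.add.subgroupI) (auto simp: Q_def gD(3) gm)
  then have Q: "subbimodule R S Q N"
    by (auto simp: subbimodule_def additive_subgroup_def Q_def gD(4,5) N.lsmult_closed N.rsmult_closed
        M.lsmult_zero_right M.rsmult_zero_left)
  have int: "P \<inter> Q = {\<zero>\<^bsub>N\<^esub>}"
    using f0 g0 gf by (auto simp: P_def Q_def intro: image_eqI[of _ _ "\<zero>\<^bsub>M\<^esub>"])
  have "P <+>\<^bsub>N\<^esub> Q = carrier N"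
  proof (rule equalityI)
    show "P <+>\<^bsub>N\<^esub> Q \<subseteq> carrier N" by (auto simp: set_add_def' P_def Q_def fD(2))
    show "carrier N \<subseteq> P <+>\<^bsub>N\<^esub> Q"
    proof
      fix y assume y: "y \<in> carrier N"
      then have fg: "f (g y) \<in> carrier N" by (simp add: fD(2) gD(2))
      have "\<ominus>\<^bsub>N\<^esub> f (g y) \<oplus>\<^bsub>N\<^esub> y \<in> Q"
        using y fg by (simp add: Q_def gD(2,3) gm gf M.M.l_neg)
      moreover have "y = f (g y) \<oplus>\<^bsub>N\<^esub> (\<ominus>\<^bsub>N\<^esub> f (g y) \<oplus>\<^bsub>N\<^esub> y)"
        using y fg by (simp add: N.M.r_neg2)
      ultimately show "y \<in> P <+>\<^bsub>N\<^esub> Q" using y gD(2) by (auto simp: set_add_def' P_def)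
    qed
  qed
  with P Q int have "bimodule_direct_summand R S P N"
    unfolding bimodule_direct_summand_def by blast
  moreover have "inj_on f (carrier M)" using gf by (rule inj_on_inverseI)
  then have "f \<in> bimodule_iso R S M (N\<lparr>carrier := P\<rparr>)"
    using fD by (auto simp: bimodule_iso_def iso_def hom_def P_def bij_betw_def)
  ultimately show ?thesis
    unfolding isomorphic_to_summand_def bimodule_isomorphic_def by blast
qed

text \<open>Each element of \<open>N\<close> is a sum of some \<open>f x\<close> and some
  \<open>q\<close> in the complement, and \<open>x\<close> is unique because the two summands meet
  in zero and \<open>f\<close> is injective. The projection that reads off \<open>x\<close> is the
  map \<open>g\<close>.\<close>

lemma isomorphic_to_summandE:
  fixes M :: "('r, 's, 'm, 'i) bimodule_scheme" and N :: "('r, 's, 'n, 'j) bimodule_scheme"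
  assumes M: "two_sided_module R S M" and N: "two_sided_module R S N"
    and "isomorphic_to_summand R S M N"
  obtains f g where "f \<in> bimodule_hom R S M N" "g \<in> bimodule_hom R S N M"
    "\<And>x. x \<in> carrier M \<Longrightarrow> g (f x) = x"
proof -
  interpret M: two_sided_module R S M by fact
  interpret N: two_sided_module R S N by fact
  obtain P Q f where P: "subbimodule R S P N" and Q: "subbimodule R S Q N"
    and int: "P \<inter> Q = {\<zero>\<^bsub>N\<^esub>}" and sum: "P <+>\<^bsub>N\<^esub> Q = carrier N"
    and f: "f \<in> bimodule_iso R S M (N\<lparr>carrier := P\<rparr>)"
    using assms(3) unfolding isomorphic_to_summand_def bimodule_isomorphic_def bimodule_direct_summand_def
    by blast
  interpret P: additive_subgroup P N using P by (simp add: subbimodule_def)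
  interpret Q: additive_subgroup Q N using Q by (simp add: subbimodule_def)
  have fP: "f ` carrier M = P" and inj: "inj_on f (carrier M)"
    using f by (auto simp: bimodule_iso_def iso_def bij_betw_def)
  then have fP': "\<And>x. x \<in> carrier M \<Longrightarrow> f x \<in> P" by blast
  have fh: "f \<in> bimodule_hom R S M N"
    using f fP' by (intro bimodule_homI) (auto simp: bimodule_iso_def iso_def hom_def)
  note fD = bimodule_homD[OF fh]
  have uniq: "x = x'" if x: "x \<in> carrier M" "x' \<in> carrier M" and q: "q \<in> Q" "q' \<in> Q"
    and eq: "f x \<oplus>\<^bsub>N\<^esub> q = f x' \<oplus>\<^bsub>N\<^esub> q'" for x x' q q'
  proof -
    have c: "f x \<in> carrier N" "f x' \<in> carrier N" "q \<in> carrier N" "q' \<in> carrier N" using x q fD(2) by auto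
    have "\<ominus>\<^bsub>N\<^esub> f x' \<oplus>\<^bsub>N\<^esub> f x = \<ominus>\<^bsub>N\<^esub> f x' \<oplus>\<^bsub>N\<^esub> ((f x \<oplus>\<^bsub>N\<^esub> q) \<oplus>\<^bsub>N\<^esub> \<ominus>\<^bsub>N\<^esub> q)"
      using c by (simp add: N.M.a_assoc N.M.r_neg)
    also have "\<dots> = q' \<oplus>\<^bsub>N\<^esub> \<ominus>\<^bsub>N\<^esub> q"
      unfolding eq using c by (simp add: N.M.a_assoc N.M.r_neg1)
    finally have "\<ominus>\<^bsub>N\<^esub> f x' \<oplus>\<^bsub>N\<^esub> f x \<in> Q" using q by simp
    moreover have "\<ominus>\<^bsub>N\<^esub> f x' \<oplus>\<^bsub>N\<^esub> f x \<in> P" using fP' x by simp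
    ultimately have "\<ominus>\<^bsub>N\<^esub> f x' \<oplus>\<^bsub>N\<^esub> f x = \<zero>\<^bsub>N\<^esub>" using int by blast
    then have "f x = f x'" using c
      by (metis N.M.a_inv_closed N.M.minus_equality N.M.minus_minus N.M.a_comm)
    then show ?thesis using inj x by (simp add: inj_on_eq_iff)
  qed
  have ex: "\<exists>x. x \<in> carrier M \<and> (\<exists>q\<in>Q. y = f x \<oplus>\<^bsub>N\<^esub> q)" if "y \<in> carrier N" for y
    using that unfolding sum[symmetric] set_add_def' fP[symmetric] by blast
  \<comment> \<open>By \<open>uniq\<close>, any decomposition of \<open>y\<close> that can be
    exhibited determines \<open>g y\<close>; this is \<open>gI\<close> below. Linearity of
    \<open>g\<close> then follows by adding and multiplying decompositions.\<close>
  define g where "g y = (SOME x. x \<in> carrier M \<and> (\<exists>q\<in>Q. y = f x \<oplus>\<^bsub>N\<^esub> q))" for y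
  have g: "g y \<in> carrier M" "\<exists>q\<in>Q. y = f (g y) \<oplus>\<^bsub>N\<^esub> q" if "y \<in> carrier N" for y
    using someI_ex[OF ex[OF that]] by (simp_all add: g_def)
  have gI: "g y = x" if "x \<in> carrier M" "q \<in> Q" "y = f x \<oplus>\<^bsub>N\<^esub> q" for x y q
  proof -
    have "y \<in> carrier N" using that fD(2) by simp
    from g[OF this] show ?thesis using uniq that by metis
  qed
  have gh: "g \<in> bimodule_hom R S N M"
  proof (rule bimodule_homI)
    fix y assume y: "y \<in> carrier N"
    then show gy: "g y \<in> carrier M" by (rule g)
    obtain q where q: "q \<in> Q" "y = f (g y) \<oplus>\<^bsub>N\<^esub> q" using g(2)[OF y] by blast
    { fix r assume r: "r \<in> carrier R"
      have "r \<triangleright>\<^bsub>N\<^esub> y = f (r \<triangleright>\<^bsub>M\<^esub> g y) \<oplus>\<^bsub>N\<^esub> r \<triangleright>\<^bsub>N\<^esub> q"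
        using r gy q(1) fD(2) by (subst q(2)) (simp add: fD(4) N.lsmult_add_right)
      then show "g (r \<triangleright>\<^bsub>N\<^esub> y) = r \<triangleright>\<^bsub>M\<^esub> g y"
        using r gy q(1) Q by (intro gI M.lsmult_closed) (auto simp: subbimodule_def) }
    { fix s assume s: "s \<in> carrier S"
      have "y \<triangleleft>\<^bsub>N\<^esub> s = f (g y \<triangleleft>\<^bsub>M\<^esub> s) \<oplus>\<^bsub>N\<^esub> q \<triangleleft>\<^bsub>N\<^esub> s"
        using s gy q(1) fD(2) by (subst q(2)) (simp add: fD(5) N.rsmult_add_left)
      then show "g (y \<triangleleft>\<^bsub>N\<^esub> s) = g y \<triangleleft>\<^bsub>M\<^esub> s"
        using s gy q(1) Q by (intro gI M.rsmult_closed) (auto simp: subbimodule_def) }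
    fix y' assume y': "y' \<in> carrier N"
    obtain q' where q': "q' \<in> Q" "y' = f (g y') \<oplus>\<^bsub>N\<^esub> q'" using g(2)[OF y'] by blast
    have "y \<oplus>\<^bsub>N\<^esub> y' = (f (g y) \<oplus>\<^bsub>N\<^esub> q) \<oplus>\<^bsub>N\<^esub> (f (g y') \<oplus>\<^bsub>N\<^esub> q')"
      using q(2) q'(2) by simp
    also have "\<dots> = f (g y \<oplus>\<^bsub>M\<^esub> g y') \<oplus>\<^bsub>N\<^esub> (q \<oplus>\<^bsub>N\<^esub> q')"
      using g(1)[OF y] g(1)[OF y'] q(1) q'(1) by (simp add: fD(2,3) N.M.a_ac)
    finally show "g (y \<oplus>\<^bsub>N\<^esub> y') = g y \<oplus>\<^bsub>M\<^esub> g y'"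
      using g(1)[OF y] g(1)[OF y'] q(1) q'(1) by (intro gI[of _ "q \<oplus>\<^bsub>N\<^esub> q'"]) auto
  qed
  have "g (f x) = x" if "x \<in> carrier M" for x
    using that fD(2) by (intro gI[of _ "\<zero>\<^bsub>N\<^esub>"]) auto
  with fh gh that show ?thesis by blast
qed

text \<open>Reading off coordinate \<open>j\<close> is additive, hence commutes with the finite sum,
  and only the summand with \<open>i = j\<close> contributes to it.\<close>

lemma bimodule_power_unit_decomposition:
  assumes "ring A" and x: "x \<in> carrier (bimodule_power n (regular_bimodule A))"
  shows "(\<Oplus>\<^bsub>bimodule_power n (regular_bimodule A)\<^esub>i\<in>{..<n}. (\<lambda>j\<in>{..<n}. if i = j then x i else \<zero>\<^bsub>A\<^esub>)) = x"
    (is "finsum ?N ?d _ = x")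
proof (rule extensionalityI)
  interpret A: ring A by fact
  have N: "two_sided_module A A ?N"
    by (intro two_sided_module_power two_sided_module_regular assms)
  interpret N: two_sided_module A A ?N by (rule N)
  have xc: "x i \<in> carrier A" if "i < n" for i using x that by (simp add: bimodule_power_simps)
  have d: "?d \<in> {..<n} \<rightarrow> carrier ?N" using xc by (auto simp: bimodule_power_simps)
  show "finsum ?N ?d {..<n} \<in> extensional {..<n}" "x \<in> extensional {..<n}"
    using N.M.finsum_closed[OF d] x by (simp_all add: bimodule_power_simps)
  fix j assume j: "j \<in> {..<n}"
  have "(\<lambda>y. y j) \<in> hom (add_monoid ?N) (add_monoid A)"
    using j by (simp add: hom_def bimodule_power_simps)
  from additive_hom_finsum[OF N.M.abelian_group_axioms A.abelian_group_axioms this d]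
  have "finsum ?N ?d {..<n} j = (\<Oplus>\<^bsub>A\<^esub>i\<in>{..<n}. if j = i then x i else \<zero>\<^bsub>A\<^esub>)"
    using j by (simp add: eq_commute)
  also have "\<dots> = x j"
    using j xc by (intro A.add.finprod_singleton) auto
  finally show "finsum ?N ?d {..<n} j = x j" .
qed

section \<open>Nakayama's lemma over central scalars, and right ideals that contain the trace of a
  generator\<close>

lemma (in abelian_group) eq_of_diff_zero:
  "\<lbrakk>x \<oplus> \<ominus> y = \<zero>; x \<in> carrier G; y \<in> carrier G\<rbrakk> \<Longrightarrow> x = y"
  using minus_equality[of x "\<ominus> y"] by simp

text \<open>Nakayama's lemma by elimination instead of determinants. Multiplying by elements of the
  form \<open>\<one> \<ominus> k\<close> shortens the spanning family by one generator at a time.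
  When no generator is left, some \<open>\<one> \<ominus> k\<close> annihilates \<open>X\<close>, in
  particular \<open>\<one>\<close>, and therefore \<open>\<one> = k\<close>.\<close>

lemma (in ring) one_in_central_ideal:
  assumes K: "K \<subseteq> carrier R" "\<zero> \<in> K"
    and Kadd: "\<And>k k'. \<lbrakk>k \<in> K; k' \<in> K\<rbrakk> \<Longrightarrow> k \<oplus> k' \<in> K"
    and Kminus: "\<And>k. k \<in> K \<Longrightarrow> \<ominus> k \<in> K"
    and Kmult: "\<And>k k'. \<lbrakk>k \<in> K; k' \<in> K\<rbrakk> \<Longrightarrow> k \<otimes> k' \<in> K"
    and Kcentral: "\<And>k a. \<lbrakk>k \<in> K; a \<in> carrier R\<rbrakk> \<Longrightarrow> k \<otimes> a = a \<otimes> k"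
    and X: "X \<subseteq> carrier R" "\<one> \<in> X" "\<And>i. x i \<in> X"
    and span: "\<And>y. y \<in> X \<Longrightarrow> \<exists>k. (\<forall>i. k i \<in> K) \<and> y = (\<Oplus>i\<in>{..<n :: nat}. k i \<otimes> x i)"
  shows "\<one> \<in> K"
proof -
  \<comment> \<open>The elements congruent to \<open>\<one>\<close> modulo \<open>K\<close>. They
    are closed under products and under subtraction of elements of \<open>K\<close>, and they
    multiply \<open>K\<close> into itself, so they can serve as multipliers throughout the
    elimination.\<close>
  define U where "U = {\<one> \<ominus> k | k. k \<in> K}"
  have Kc [simp]: "k \<in> carrier R" if "k \<in> K" for k using that K by blast
  have xc [simp]: "x i \<in> carrier R" for i using X by blast
  have Uc [simp]: "z \<in> carrier R" if "z \<in> U" for z using that by (auto simp: U_def)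
  have UK: "z \<otimes> k \<in> K" if "z \<in> U" "k \<in> K" for z k
  proof -
    obtain k' where k': "k' \<in> K" "z = \<one> \<ominus> k'" using \<open>z \<in> U\<close> by (auto simp: U_def)
    then have "z \<otimes> k = k \<oplus> \<ominus> (k' \<otimes> k)" using that by (simp add: a_minus_def l_distr l_minus)
    then show ?thesis using k' that by (simp only: Kadd Kminus Kmult)
  qed
  have Uminus: "z \<ominus> k \<in> U" if z: "z \<in> U" and k: "k \<in> K" for z k
  proof -
    obtain k' where k': "k' \<in> K" "z = \<one> \<ominus> k'" using z by (auto simp: U_def)
    then have "z \<ominus> k = \<one> \<ominus> (k' \<oplus> k)" using k by (simp add: a_minus_def minus_add a_assoc)
    then show ?thesis using Kadd[OF k'(1) k] by (auto simp: U_def)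
  qed
  have Umult: "w \<otimes> z \<in> U" if w: "w \<in> U" and z: "z \<in> U" for w z
  proof -
    obtain k where k: "k \<in> K" "w = \<one> \<ominus> k" using w by (auto simp: U_def)
    then have "w \<otimes> z = z \<ominus> z \<otimes> k"
      using z Kcentral[of k z] by (simp add: a_minus_def l_distr l_minus)
    then show ?thesis using Uminus[OF z UK[OF z k(1)]] by simp
  qed
  have "\<exists>z\<in>U. \<forall>y\<in>X. \<exists>k. (\<forall>i. k i \<in> K) \<and> z \<otimes> y = (\<Oplus>i\<in>{..<0 :: nat}. k i \<otimes> x i)"
  \<comment> \<open>The induction runs downwards from \<open>n\<close> to \<open>0\<close> in the
    number of generators still in use. It starts with \<open>z = \<one>\<close>.\<close>
  proof (rule inc_induct[of 0 n])
    have "\<one> = \<one> \<ominus> \<zero>" by (simp add: a_minus_def)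
    then have "\<one> \<in> U" using K(2) unfolding U_def by blast
    then show "\<exists>z\<in>U. \<forall>y\<in>X. \<exists>k. (\<forall>i. k i \<in> K) \<and> z \<otimes> y = (\<Oplus>i\<in>{..<n}. k i \<otimes> x i)"
      by (rule bexI[rotated]) (use span X in \<open>simp add: subset_iff\<close>)
  next
    fix m assume "\<exists>z\<in>U. \<forall>y\<in>X. \<exists>k. (\<forall>i. k i \<in> K) \<and> z \<otimes> y = (\<Oplus>i\<in>{..<Suc m}. k i \<otimes> x i)"
    then obtain z where z: "z \<in> U"
      and zy: "\<And>y. y \<in> X \<Longrightarrow> \<exists>k. (\<forall>i. k i \<in> K) \<and> z \<otimes> y = (\<Oplus>i\<in>{..<Suc m}. k i \<otimes> x i)"
      by blast
    have Suc: "(\<Oplus>i\<in>{..<Suc m}. k i \<otimes> x i) = k m \<otimes> x m \<oplus> (\<Oplus>i\<in>{..<m}. k i \<otimes> x i)"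
      if "\<And>i. k i \<in> K" for k
      using that unfolding lessThan_Suc by (subst finsum_insert) auto
    obtain j where j: "\<And>i. j i \<in> K" and zj: "z \<otimes> x m = (\<Oplus>i\<in>{..<Suc m}. j i \<otimes> x i)"
      using zy[OF X(3)] by blast
    \<comment> \<open>Moving the last term of \<open>z \<otimes> x m\<close> to the left-hand side
      leaves \<open>w \<otimes> x m\<close> as a combination of the generators below
      \<open>m\<close>. Multiplication by \<open>w\<close> thus removes \<open>x m\<close> from
      \<open>z \<otimes> y\<close>; since \<open>k m\<close> is central, \<open>w\<close> can pass
      it to reach \<open>x m\<close>.\<close>
    define w where "w = z \<ominus> j m"
    have w: "w \<in> U" unfolding w_def by (rule Uminus[OF z j])
    have fs [simp]: "(\<Oplus>i\<in>{..<m}. k i \<otimes> x i) \<in> carrier R" if "\<And>i. k i \<in> K" for k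
      using that by (intro finsum_closed) auto
    have wx: "w \<otimes> x m = (\<Oplus>i\<in>{..<m}. j i \<otimes> x i)"
      using z j by (simp add: w_def a_minus_def l_distr l_minus zj Suc[OF j] a_ac r_neg1 r_neg2)
    show "\<exists>z\<in>U. \<forall>y\<in>X. \<exists>k. (\<forall>i. k i \<in> K) \<and> z \<otimes> y = (\<Oplus>i\<in>{..<m}. k i \<otimes> x i)"
    proof (rule bexI[of _ "w \<otimes> z"], rule ballI)
      fix y assume y: "y \<in> X"
      then have yc: "y \<in> carrier R" using X by blast
      obtain k where k: "\<And>i. k i \<in> K" and zk: "z \<otimes> y = (\<Oplus>i\<in>{..<Suc m}. k i \<otimes> x i)"
        using zy[OF y] by blast
      have "w \<otimes> z \<otimes> y = w \<otimes> (k m \<otimes> x m) \<oplus> w \<otimes> (\<Oplus>i\<in>{..<m}. k i \<otimes> x i)"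
        using w z yc k by (simp add: m_assoc zk Suc[OF k] r_distr)
      also have "w \<otimes> (k m \<otimes> x m) = k m \<otimes> (\<Oplus>i\<in>{..<m}. j i \<otimes> x i)"
        using w k Kcentral[of "k m" w] by (simp flip: wx m_assoc)
      also have "k m \<otimes> (\<Oplus>i\<in>{..<m}. j i \<otimes> x i) = (\<Oplus>i\<in>{..<m}. k m \<otimes> j i \<otimes> x i)"
        using k j by (subst finsum_rdistr) (auto simp: m_assoc)
      also have "w \<otimes> (\<Oplus>i\<in>{..<m}. k i \<otimes> x i) = (\<Oplus>i\<in>{..<m}. w \<otimes> k i \<otimes> x i)"
        using k w by (subst finsum_rdistr) (auto simp: m_assoc)
      also have "(\<Oplus>i\<in>{..<m}. k m \<otimes> j i \<otimes> x i) \<oplus> (\<Oplus>i\<in>{..<m}. w \<otimes> k i \<otimes> x i)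
          = (\<Oplus>i\<in>{..<m}. (k m \<otimes> j i \<oplus> w \<otimes> k i) \<otimes> x i)"
        using k j w by (subst finsum_addf[symmetric]) (auto simp: l_distr)
      finally have "w \<otimes> z \<otimes> y = (\<Oplus>i\<in>{..<m}. (k m \<otimes> j i \<oplus> w \<otimes> k i) \<otimes> x i)" .
      moreover have "\<forall>i. k m \<otimes> j i \<oplus> w \<otimes> k i \<in> K" using k j w by (auto intro: Kadd Kmult UK)
      ultimately show "\<exists>k. (\<forall>i. k i \<in> K) \<and> w \<otimes> z \<otimes> y = (\<Oplus>i\<in>{..<m}. k i \<otimes> x i)"
        by (intro exI[of _ "\<lambda>i. k m \<otimes> j i \<oplus> w \<otimes> k i"]) simp
    qed (rule Umult[OF w z])
  qed simp
  \<comment> \<open>The sum over no generators is zero, and \<open>y = \<one>\<close> is admissible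
    because \<open>\<one> \<in> X\<close>.\<close>
  then obtain z where z: "z \<in> U" "z \<otimes> \<one> = \<zero>" using X(2) by auto
  then obtain k where k: "k \<in> K" "\<one> \<ominus> k = \<zero>" by (auto simp: U_def a_minus_def)
  then have "\<one> = k" using eq_of_diff_zero[of \<one> k] by (simp add: a_minus_def)
  then show ?thesis using k by simp
qed

text \<open>If \<open>\<one>\<close> were outside \<open>J\<close>, the projection from
  \<open>S\<close> onto \<open>S / J\<close> and the zero map would differ, and a linear map from
  \<open>G\<close> to \<open>S\<close> would tell them apart. But all values of such a map lie in
  \<open>J\<close>, where both vanish. Linearity is spelled out in \<open>hJ\<close> because
  \<open>S\<close> itself is not a module record.\<close>

lemma generator_right_ideal:
  fixes S :: "('s, 'k) ring_scheme" and G :: "('s, 'g, 'i) rmodule_scheme"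
  assumes G: "generator S G" and J: "additive_subgroup J S"
    and Jr: "\<And>x s. \<lbrakk>x \<in> J; s \<in> carrier S\<rbrakk> \<Longrightarrow> x \<otimes>\<^bsub>S\<^esub> s \<in> J"
    and hJ: "\<And>h x. \<lbrakk>h \<in> hom (add_monoid G) (add_monoid S);
      \<And>x s. \<lbrakk>x \<in> carrier G; s \<in> carrier S\<rbrakk> \<Longrightarrow> h (x \<triangleleft>\<^bsub>G\<^esub> s) = h x \<otimes>\<^bsub>S\<^esub> s; x \<in> carrier G\<rbrakk> \<Longrightarrow> h x \<in> J"
  shows "\<one>\<^bsub>S\<^esub> \<in> J"
proof (rule ccontr)
  assume n: "\<one>\<^bsub>S\<^esub> \<notin> J"
  interpret G: right_module S G using G by (simp add: generator_def generator_in_def)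
  interpret J: additive_subgroup J S by (rule J)
  interpret JA: abelian_subgroup J S
    by (rule abelian_subgroupI3[OF J]) (rule G.S.abelian_group_axioms)
  let ?Q = "\<lambda>J. \<lparr>carrier = a_rcosets\<^bsub>S\<^esub> J, monoid.mult = (\<lambda>_ _. undefined), one = undefined,
      ring.zero = J, add = set_add S, rsmult = (\<lambda>X s. \<Union>x\<in>X. J +>\<^bsub>S\<^esub> (x \<otimes>\<^bsub>S\<^esub> s))\<rparr> :: ('s, 's set) rmodule"
  have J0: "additive_subgroup {\<zero>\<^bsub>S\<^esub>} S" using G.S.add.triv_subgroup by (auto intro: additive_subgroup.intro)
  define Q where "Q = ?Q J"
  \<comment> \<open>The regular module in the guise of \<open>S / 0\<close>, with singletons as
    elements: \<open>generator\<close> tests only modules whose elements have type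
    \<open>'s set\<close>.\<close>
  define Q0 where "Q0 = ?Q {\<zero>\<^bsub>S\<^esub>}"
  have Jr': "\<forall>x\<in>J. \<forall>s\<in>carrier S. x \<otimes>\<^bsub>S\<^esub> s \<in> J" using Jr by blast
  have zr: "\<forall>x\<in>{\<zero>\<^bsub>S\<^esub>}. \<forall>s\<in>carrier S. x \<otimes>\<^bsub>S\<^esub> s \<in> {\<zero>\<^bsub>S\<^esub>}" by simp
  note qJ = right_module_regular_quotient[OF G.S.ring_axioms J Jr', folded Q_def]
  note q0 = right_module_regular_quotient[OF G.S.ring_axioms J0 zr, folded Q0_def]
  interpret Q: right_module S Q by (rule qJ)
  have single: "{\<zero>\<^bsub>S\<^esub>} +>\<^bsub>S\<^esub> s = {s}" if "s \<in> carrier S" for s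
    using that by (simp add: a_r_coset_def')
  have car0: "carrier Q0 = (\<lambda>s. {s}) ` carrier S" by (simp add: q0(4) single)
  have add0: "{x} \<oplus>\<^bsub>Q0\<^esub> {y} = {x \<oplus>\<^bsub>S\<^esub> y}" if "x \<in> carrier S" "y \<in> carrier S" for x y
    using hom_mult[OF q0(2), of x y] that by (simp add: single)
  have act0: "{x} \<triangleleft>\<^bsub>Q0\<^esub> s = {x \<otimes>\<^bsub>S\<^esub> s}" if "x \<in> carrier S" "s \<in> carrier S" for x s
    using q0(3)[OF that] that by (simp add: single)
  have J_zero: "J = \<zero>\<^bsub>Q\<^esub>" by (simp add: Q_def)
  define f where "f X = J +>\<^bsub>S\<^esub> the_elem X" for X
  have f: "f \<in> rmodule_hom S Q0 Q"
    using hom_mult[OF qJ(2)] by (auto simp: rmodule_hom_def hom_def car0 f_def add0 act0 qJ(3) qJ(4))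
  have g: "(\<lambda>X. J) \<in> rmodule_hom S Q0 Q"
    unfolding J_zero by (simp add: rmodule_hom_def hom_def Q.rsmult_zero_left)
  have "\<one>\<^bsub>S\<^esub> \<in> f {\<one>\<^bsub>S\<^esub>}" using JA.a_rcos_self by (simp add: f_def)
  then have "f {\<one>\<^bsub>S\<^esub>} \<noteq> J" "{\<one>\<^bsub>S\<^esub>} \<in> carrier Q0" using n by (auto simp: car0)
  then obtain h x where h: "h \<in> rmodule_hom S G Q0" and x: "x \<in> carrier G" and ne: "f (h x) \<noteq> J"
    using G qJ(1) q0(1) f g unfolding generator_def generator_in_def by metis
  have hc: "\<exists>s\<in>carrier S. h y = {s}" if "y \<in> carrier G" for y
  proof -
    have "h y \<in> carrier Q0" using h that by (auto simp: rmodule_hom_def hom_def)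
    then show ?thesis by (auto simp: car0)
  qed
  \<comment> \<open>Unwrapping the singletons turns \<open>h\<close> into a linear map from
    \<open>G\<close> to \<open>S\<close>, to which \<open>hJ\<close> applies.\<close>
  have "the_elem (h x) \<in> J"
  proof (rule hJ[OF _ _ x])
    have "the_elem (h (y \<oplus>\<^bsub>G\<^esub> z)) = the_elem (h y) \<oplus>\<^bsub>S\<^esub> the_elem (h z)"
      if "y \<in> carrier G" "z \<in> carrier G" for y z
    proof -
      have "h (y \<oplus>\<^bsub>G\<^esub> z) = h y \<oplus>\<^bsub>Q0\<^esub> h z" using h that by (simp add: rmodule_hom_def hom_def)
      then show ?thesis using hc[OF that(1)] hc[OF that(2)] by (auto simp: add0)
    qed
    then show "(\<lambda>y. the_elem (h y)) \<in> hom (add_monoid G) (add_monoid S)"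
      using hc by (force simp: hom_def)
    fix y s assume ys: "y \<in> carrier G" "s \<in> carrier S"
    then have "h (y \<triangleleft>\<^bsub>G\<^esub> s) = h y \<triangleleft>\<^bsub>Q0\<^esub> s" using h by (simp add: rmodule_hom_def)
    then show "the_elem (h (y \<triangleleft>\<^bsub>G\<^esub> s)) = the_elem (h y) \<otimes>\<^bsub>S\<^esub> s"
      using hc[OF ys(1)] ys(2) by (auto simp: act0)
  qed
  then have "f (h x) = J" unfolding f_def by (rule JA.a_rcos_const)
  then show False using ne by simp
qed

section \<open>Tensor products\<close>

text \<open>Closure of the left action keeps the defining relations inside the free group on
  \<open>carrier M \<times> carrier N\<close>; the laws for pure tensors come from these
  relations.\<close>

locale tensor_factors = right_module S M + N?: abelian_group N
  for S :: "('s, 'k) ring_scheme" and M :: "('s, 'm, 'i) rmodule_scheme"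
    and N :: "('s, 'q, 'n, 'j) bimodule_scheme" +
  assumes left_act_closed: "\<lbrakk>y \<in> carrier N; s \<in> carrier S\<rbrakk> \<Longrightarrow> s \<triangleright>\<^bsub>N\<^esub> y \<in> carrier N"
begin

abbreviation "tgroup \<equiv> tensor_group S M N"
abbreviation "ptensor \<equiv> pure_tensor S M N"
abbreviation "tclass p \<equiv> tensor_kernel S M N #>\<^bsub>tensor_free M N\<^esub> p"

lemmas factors_closed = rsmult_closed M.a_closed left_act_closed N.a_closed

sublocale tgroup: abelian_group tgroup
  by (rule tensor_group_abelian) (fact factors_closed)+

lemma tgroup_carrier: "carrier tgroup = tclass ` carrier (tensor_free M N)"
  by (auto simp: tensor_group_def Let_def carrier_FactGroup)

lemma tclass_add:
  assumes "p \<in> carrier (tensor_free M N)" "q \<in> carrier (tensor_free M N)"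
  shows "tclass p \<oplus>\<^bsub>tgroup\<^esub> tclass q = tclass (p + q)"
proof -
  have "tensor_kernel S M N \<lhd> tensor_free M N"
    by (rule tensor_kernel_normal) (fact factors_closed)+
  from normal.rcos_sum[OF this assms] show ?thesis
    by (simp add: tensor_group_def FactGroup_def tensor_free_def)
qed

lemma tclass_eqI:
  assumes p: "p \<in> carrier (tensor_free M N)" and q: "q \<in> carrier (tensor_free M N)"
    and "p - q \<in> tensor_relations S M N"
  shows "tclass p = tclass q"
proof -
  interpret F: comm_group "tensor_free M N" by (rule tensor_free_comm_group)
  have sub: "subgroup (tensor_kernel S M N) (tensor_free M N)"
    by (rule tensor_kernel_subgroup) (fact factors_closed)+
  have "p - q \<in> tensor_kernel S M N"
    using assms(3) by (simp add: tensor_kernel_def generate.incl)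
  then have "p \<in> tclass q"
    by (auto simp: r_coset_def tensor_free_def intro!: bexI[of _ "p - q"])
  then show ?thesis
    using F.repr_independence[OF _ q sub] by simp
qed

lemma tclass_zero: "tclass 0 = \<zero>\<^bsub>tgroup\<^esub>"
proof -
  have 0: "0 \<in> carrier (tensor_free M N)" by (simp add: tensor_free_def)
  have "tclass 0 \<oplus>\<^bsub>tgroup\<^esub> tclass 0 = tclass 0" by (simp add: tclass_add[OF 0 0])
  then show ?thesis using 0 by (simp add: tgroup_carrier tgroup.add.l_cancel_one')
qed

lemma tclass_inverse:
  assumes "p \<in> carrier (tensor_free M N)"
  shows "tclass (- p) = \<ominus>\<^bsub>tgroup\<^esub> tclass p"
proof -
  have m: "- p \<in> carrier (tensor_free M N)" using assms by (simp add: tensor_free_def)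
  then have "tclass (- p) \<oplus>\<^bsub>tgroup\<^esub> tclass p = \<zero>\<^bsub>tgroup\<^esub>"
    using tclass_add[OF m assms] by (simp add: tclass_zero)
  then show ?thesis
    using assms m by (intro tgroup.minus_equality[symmetric]) (auto simp: tgroup_carrier)
qed

lemma ptensor_class: "ptensor x y = tclass (frag_of (x, y))"
  by (simp add: pure_tensor_def)

lemma frag_closed:
  "\<lbrakk>x \<in> carrier M; y \<in> carrier N\<rbrakk> \<Longrightarrow> frag_of (x, y) \<in> carrier (tensor_free M N)"
  by (simp add: tensor_free_def)

lemma free_add_closed:
  "\<lbrakk>p \<in> carrier (tensor_free M N); q \<in> carrier (tensor_free M N)\<rbrakk> \<Longrightarrow> p + q \<in> carrier (tensor_free M N)"
  using comm_group.axioms(2)[OF tensor_free_comm_group, of M N]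
  by (metis group.subgroup_self mult_free_Abelian_group subgroup.m_closed tensor_free_def)

lemma ptensor_closed [simp]: "\<lbrakk>x \<in> carrier M; y \<in> carrier N\<rbrakk> \<Longrightarrow> ptensor x y \<in> carrier tgroup"
  by (auto simp: ptensor_class tgroup_carrier intro: frag_closed)

lemma ptensor_balanced: "balanced S M N tgroup ptensor"
  unfolding balanced_def
proof (intro conjI ballI)
  fix x y z assume *: "x \<in> carrier M" "y \<in> carrier M" "z \<in> carrier N"
  then have "frag_of (x \<oplus>\<^bsub>M\<^esub> y, z) - frag_of (x, z) - frag_of (y, z) \<in> tensor_relations S M N"
    unfolding tensor_relations_def by blast
  with * show "ptensor (x \<oplus>\<^bsub>M\<^esub> y) z = ptensor x z \<oplus>\<^bsub>tgroup\<^esub> ptensor y z"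
    by (simp add: ptensor_class tclass_add tclass_eqI frag_closed free_add_closed diff_diff_add)
next
  fix x y z assume *: "x \<in> carrier M" "y \<in> carrier N" "z \<in> carrier N"
  then have "frag_of (x, y \<oplus>\<^bsub>N\<^esub> z) - frag_of (x, y) - frag_of (x, z) \<in> tensor_relations S M N"
    unfolding tensor_relations_def by blast
  with * show "ptensor x (y \<oplus>\<^bsub>N\<^esub> z) = ptensor x y \<oplus>\<^bsub>tgroup\<^esub> ptensor x z"
    by (simp add: ptensor_class tclass_add tclass_eqI frag_closed free_add_closed diff_diff_add)
next
  fix x s z assume "x \<in> carrier M" "s \<in> carrier S" "z \<in> carrier N"
  then show "ptensor (x \<triangleleft>\<^bsub>M\<^esub> s) z = ptensor x (s \<triangleright>\<^bsub>N\<^esub> z)"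
    unfolding ptensor_class
    by (intro tclass_eqI frag_closed factors_closed) (auto simp: tensor_relations_def)
qed auto

lemma ptensor_add_left:
  "\<lbrakk>x \<in> carrier M; y \<in> carrier M; z \<in> carrier N\<rbrakk> \<Longrightarrow> ptensor (x \<oplus>\<^bsub>M\<^esub> y) z = ptensor x z \<oplus>\<^bsub>tgroup\<^esub> ptensor y z"
  using ptensor_balanced unfolding balanced_def by blast

lemma ptensor_add_right:
  "\<lbrakk>x \<in> carrier M; y \<in> carrier N; z \<in> carrier N\<rbrakk> \<Longrightarrow> ptensor x (y \<oplus>\<^bsub>N\<^esub> z) = ptensor x y \<oplus>\<^bsub>tgroup\<^esub> ptensor x z"
  using ptensor_balanced unfolding balanced_def by blast

lemma ptensor_swap:
  "\<lbrakk>x \<in> carrier M; s \<in> carrier S; z \<in> carrier N\<rbrakk> \<Longrightarrow> ptensor (x \<triangleleft>\<^bsub>M\<^esub> s) z = ptensor x (s \<triangleright>\<^bsub>N\<^esub> z)"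
  using ptensor_balanced unfolding balanced_def by blast

text \<open>Pure tensors generate the tensor group. Identities between lifted maps are proved below
  by this principle: both sides are additive, so they are compared on pure tensors.\<close>

lemma tgroup_hom_eqI:
  fixes H :: "('h, 'p) ring_scheme"
  assumes H: "abelian_group H"
    and f: "f \<in> hom (add_monoid tgroup) (add_monoid H)"
    and g: "g \<in> hom (add_monoid tgroup) (add_monoid H)"
    and eq: "\<And>x y. \<lbrakk>x \<in> carrier M; y \<in> carrier N\<rbrakk> \<Longrightarrow> f (ptensor x y) = g (ptensor x y)"
    and z: "z \<in> carrier tgroup"
  shows "f z = g z"
proof -
  have tg: "abelian_group tgroup" by (rule tgroup.abelian_group_axioms)
  obtain p where p: "p \<in> carrier (tensor_free M N)" "z = tclass p"
    using z by (auto simp: tgroup_carrier)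
  let ?K = "carrier M \<times> carrier N"
  have "Poly_Mapping.keys p \<subseteq> ?K" using p by (simp add: tensor_free_def)
  \<comment> \<open>Membership in the free group is part of the induction claim because the
    \<open>diff\<close> case supplies nothing but the claims for \<open>a\<close> and
    \<open>b\<close>, and classes can be added only for members.\<close>
  then have "p \<in> carrier (tensor_free M N) \<and> f (tclass p) = g (tclass p)"
  proof (induction p rule: frag_induction)
    case zero
    show ?case
      using additive_hom_zero[OF tg H f] additive_hom_zero[OF tg H g]
      by (simp add: tclass_zero) (simp add: tensor_free_def)
  next
    case (one xy)
    then show ?case using eq frag_closed by (cases xy) (auto simp: ptensor_class)
  next
    case (diff a b)
    then have ab: "a \<in> carrier (tensor_free M N)" "b \<in> carrier (tensor_free M N)"
      "- b \<in> carrier (tensor_free M N)" by (auto simp: tensor_free_def)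
    then have cl: "tclass a \<in> carrier tgroup" "tclass b \<in> carrier tgroup" by (auto simp: tgroup_carrier)
    have "tclass (a - b) = tclass a \<oplus>\<^bsub>tgroup\<^esub> (\<ominus>\<^bsub>tgroup\<^esub> tclass b)"
      using tclass_add[OF ab(1,3)] tclass_inverse[OF ab(2)] by simp
    then have k: "k (tclass (a - b)) = k (tclass a) \<oplus>\<^bsub>H\<^esub> (\<ominus>\<^bsub>H\<^esub> k (tclass b))"
      if k: "k \<in> hom (add_monoid tgroup) (add_monoid H)" for k
      using hom_mult[OF k, of "tclass a" "\<ominus>\<^bsub>tgroup\<^esub> tclass b"] cl additive_hom_minus[OF tg H k cl(2)]
      by simp
    then show ?case using diff k[OF f] k[OF g] free_add_closed[OF ab(1,3)] by simp
  qed
  then show ?thesis using p by simp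
qed

lemma tlift_hom:
  assumes "abelian_group H" "balanced S M N H \<phi>"
  shows "tensor_lift H \<phi> \<in> hom (add_monoid tgroup) (add_monoid H)"
  by (rule tensor_lift_hom) (fact factors_closed assms)+

lemma tlift_ptensor:
  assumes "abelian_group H" "balanced S M N H \<phi>" "x \<in> carrier M" "y \<in> carrier N"
  shows "tensor_lift H \<phi> (ptensor x y) = \<phi> x y"
  by (rule tensor_lift_pure) (fact factors_closed assms)+

end

section \<open>Bimodule structures on tensor products\<close>

lemma hom_add_id: "(\<lambda>x. x) \<in> hom G G"
  by (simp add: hom_def)

lemma hom_add_compose: "\<lbrakk>f \<in> hom G H; g \<in> hom H K\<rbrakk> \<Longrightarrow> (\<lambda>x. g (f x)) \<in> hom G K"
  by (auto simp: hom_def Pi_iff)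

lemma hom_add_sum:
  assumes "abelian_group N"
    and f: "f \<in> hom (add_monoid M) (add_monoid N)" and g: "g \<in> hom (add_monoid M) (add_monoid N)"
  shows "(\<lambda>x. f x \<oplus>\<^bsub>N\<^esub> g x) \<in> hom (add_monoid M) (add_monoid N)"
proof -
  interpret N: abelian_group N by fact
  show ?thesis using f g by (auto simp: hom_def N.a_ac Pi_iff)
qed

lemma balanced_cong:
  assumes "balanced S M N G \<phi>" and "right_module S M"
    and "abelian_group N" and "\<And>s y. \<lbrakk>s \<in> carrier S; y \<in> carrier N\<rbrakk> \<Longrightarrow> s \<triangleright>\<^bsub>N\<^esub> y \<in> carrier N"
    and "\<And>x y. \<lbrakk>x \<in> carrier M; y \<in> carrier N\<rbrakk> \<Longrightarrow> \<psi> x y = \<phi> x y"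
  shows "balanced S M N G \<psi>"
proof -
  interpret M: right_module S M by fact
  interpret N: abelian_group N by fact
  show ?thesis using assms(1) by (auto simp: balanced_def assms(4,5) M.rsmult_closed)
qed

context tensor_factors
begin

text \<open>The bimodule laws are identities between additive maps, so it suffices to have them on
  pure tensors. The values \<open>l r x y\<close> and \<open>\<rho> x y s\<close> prescribed there
  may be any elements of the tensor group, which is why composites are expressed with
  \<open>tensor_lift\<close>. The lemma serves for \<open>A \<otimes>\<^sub>B A\<close> and again
  for \<open>R \<otimes>\<^sub>T (A \<otimes>\<^sub>B A)\<close>.\<close>

lemma two_sided_module_tensor:
  fixes R :: "('r, 'p) ring_scheme" and S' :: "('t, 'p') ring_scheme"
  assumes R: "ring R" and S': "ring S'"
    and bl: "\<And>r. r \<in> carrier R \<Longrightarrow> balanced S M N tgroup (l r)"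
    and br: "\<And>s. s \<in> carrier S' \<Longrightarrow> balanced S M N tgroup (\<lambda>x y. \<rho> x y s)"
    and ladd: "\<And>r r' x y. \<lbrakk>r \<in> carrier R; r' \<in> carrier R; x \<in> carrier M; y \<in> carrier N\<rbrakk> \<Longrightarrow>
      l (r \<oplus>\<^bsub>R\<^esub> r') x y = l r x y \<oplus>\<^bsub>tgroup\<^esub> l r' x y"
    and radd: "\<And>s s' x y. \<lbrakk>s \<in> carrier S'; s' \<in> carrier S'; x \<in> carrier M; y \<in> carrier N\<rbrakk> \<Longrightarrow>
      \<rho> x y (s \<oplus>\<^bsub>S'\<^esub> s') = \<rho> x y s \<oplus>\<^bsub>tgroup\<^esub> \<rho> x y s'"
    and lmult: "\<And>r r' x y. \<lbrakk>r \<in> carrier R; r' \<in> carrier R; x \<in> carrier M; y \<in> carrier N\<rbrakk> \<Longrightarrow>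
      l (r \<otimes>\<^bsub>R\<^esub> r') x y = tensor_lift tgroup (l r) (l r' x y)"
    and rmult: "\<And>s s' x y. \<lbrakk>s \<in> carrier S'; s' \<in> carrier S'; x \<in> carrier M; y \<in> carrier N\<rbrakk> \<Longrightarrow>
      \<rho> x y (s \<otimes>\<^bsub>S'\<^esub> s') = tensor_lift tgroup (\<lambda>x y. \<rho> x y s') (\<rho> x y s)"
    and lone: "\<And>x y. \<lbrakk>x \<in> carrier M; y \<in> carrier N\<rbrakk> \<Longrightarrow> l \<one>\<^bsub>R\<^esub> x y = ptensor x y"
    and rone: "\<And>x y. \<lbrakk>x \<in> carrier M; y \<in> carrier N\<rbrakk> \<Longrightarrow> \<rho> x y \<one>\<^bsub>S'\<^esub> = ptensor x y"
    and lr: "\<And>r s x y. \<lbrakk>r \<in> carrier R; s \<in> carrier S'; x \<in> carrier M; y \<in> carrier N\<rbrakk> \<Longrightarrow>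
      tensor_lift tgroup (\<lambda>x y. \<rho> x y s) (l r x y) = tensor_lift tgroup (l r) (\<rho> x y s)"
  shows "two_sided_module R S' \<lparr>carrier = carrier tgroup, monoid.mult = monoid.mult tgroup,
    one = one tgroup, ring.zero = ring.zero tgroup, add = add tgroup,
    rsmult = (\<lambda>z s. tensor_lift tgroup (\<lambda>x y. \<rho> x y s) z),
    lsmult = (\<lambda>r z. tensor_lift tgroup (l r) z)\<rparr>" (is "two_sided_module R S' ?X")
proof -
  interpret R: ring R by fact
  interpret S': ring S' by fact
  note tg = tgroup.abelian_group_axioms
  note hl = tlift_hom[OF tg bl] and hr = tlift_hom[OF tg br]
  note pl = tlift_ptensor[OF tg bl] and pr = tlift_ptensor[OF tg br]
  note comp = hom_add_compose[where G = "add_monoid tgroup" and H = "add_monoid tgroup" and K = "add_monoid tgroup"]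
  note eqI = tgroup_hom_eqI[OF tg]
  have ab: "abelian_group ?X"
  proof (rule abelian_groupI)
    fix x assume "x \<in> carrier ?X"
    then show "\<exists>y\<in>carrier ?X. y \<oplus>\<^bsub>?X\<^esub> x = \<zero>\<^bsub>?X\<^esub>"
      by (intro bexI[of _ "\<ominus>\<^bsub>tgroup\<^esub> x"]) (auto simp: tgroup.l_neg)
  qed (auto simp: tgroup.a_ac)
  show ?thesis
  proof (intro two_sided_module.intro right_module.intro right_module_axioms.intro
        two_sided_module_axioms.intro R S' ab)
    fix x s assume xs: "x \<in> carrier ?X" "s \<in> carrier S'"
    then show "x \<triangleleft>\<^bsub>?X\<^esub> s \<in> carrier ?X" using hom_in_carrier[OF hr] by simp
    fix y assume "y \<in> carrier ?X"
    then show "(x \<oplus>\<^bsub>?X\<^esub> y) \<triangleleft>\<^bsub>?X\<^esub> s = x \<triangleleft>\<^bsub>?X\<^esub> s \<oplus>\<^bsub>?X\<^esub> y \<triangleleft>\<^bsub>?X\<^esub> s"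
      using xs hom_mult[OF hr[of s], of x y] by simp
  next
    fix r x y assume xs: "r \<in> carrier R" "x \<in> carrier ?X"
    then show "r \<triangleright>\<^bsub>?X\<^esub> x \<in> carrier ?X" using hom_in_carrier[OF hl] by simp
    fix y assume "y \<in> carrier ?X"
    then show "r \<triangleright>\<^bsub>?X\<^esub> (x \<oplus>\<^bsub>?X\<^esub> y) = r \<triangleright>\<^bsub>?X\<^esub> x \<oplus>\<^bsub>?X\<^esub> r \<triangleright>\<^bsub>?X\<^esub> y"
      using xs hom_mult[OF hl[of r], of x y] by simp
  next
    fix x s s' assume *: "x \<in> carrier ?X" "s \<in> carrier S'" "s' \<in> carrier S'"
    have "tensor_lift tgroup (\<lambda>x y. \<rho> x y (s \<oplus>\<^bsub>S'\<^esub> s')) x =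
        tensor_lift tgroup (\<lambda>x y. \<rho> x y s) x \<oplus>\<^bsub>tgroup\<^esub> tensor_lift tgroup (\<lambda>x y. \<rho> x y s') x"
      by (rule eqI[OF hr hom_add_sum[OF tg hr hr]]) (use * in \<open>simp_all add: pr radd\<close>)
    then show "x \<triangleleft>\<^bsub>?X\<^esub> (s \<oplus>\<^bsub>S'\<^esub> s') = x \<triangleleft>\<^bsub>?X\<^esub> s \<oplus>\<^bsub>?X\<^esub> x \<triangleleft>\<^bsub>?X\<^esub> s'" by simp
    have "tensor_lift tgroup (\<lambda>x y. \<rho> x y (s \<otimes>\<^bsub>S'\<^esub> s')) x =
        tensor_lift tgroup (\<lambda>x y. \<rho> x y s') (tensor_lift tgroup (\<lambda>x y. \<rho> x y s) x)"
      by (rule eqI[OF hr comp[OF hr hr]]) (use * in \<open>simp_all add: pr rmult\<close>)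
    then show "x \<triangleleft>\<^bsub>?X\<^esub> (s \<otimes>\<^bsub>S'\<^esub> s') = (x \<triangleleft>\<^bsub>?X\<^esub> s) \<triangleleft>\<^bsub>?X\<^esub> s'" by simp
  next
    fix r r' x assume *: "r \<in> carrier R" "r' \<in> carrier R" "x \<in> carrier ?X"
    have "tensor_lift tgroup (l (r \<oplus>\<^bsub>R\<^esub> r')) x =
        tensor_lift tgroup (l r) x \<oplus>\<^bsub>tgroup\<^esub> tensor_lift tgroup (l r') x"
      by (rule eqI[OF hl hom_add_sum[OF tg hl hl]]) (use * in \<open>simp_all add: pl ladd\<close>)
    then show "(r \<oplus>\<^bsub>R\<^esub> r') \<triangleright>\<^bsub>?X\<^esub> x = r \<triangleright>\<^bsub>?X\<^esub> x \<oplus>\<^bsub>?X\<^esub> r' \<triangleright>\<^bsub>?X\<^esub> x" by simp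
    have "tensor_lift tgroup (l (r \<otimes>\<^bsub>R\<^esub> r')) x = tensor_lift tgroup (l r) (tensor_lift tgroup (l r') x)"
      by (rule eqI[OF hl comp[OF hl hl]]) (use * in \<open>simp_all add: pl lmult\<close>)
    then show "(r \<otimes>\<^bsub>R\<^esub> r') \<triangleright>\<^bsub>?X\<^esub> x = r \<triangleright>\<^bsub>?X\<^esub> r' \<triangleright>\<^bsub>?X\<^esub> x" by simp
  next
    fix x assume *: "x \<in> carrier ?X"
    have "tensor_lift tgroup (\<lambda>x y. \<rho> x y \<one>\<^bsub>S'\<^esub>) x = x"
      by (rule eqI[OF hr hom_add_id]) (use * in \<open>simp_all add: pr rone\<close>)
    then show "x \<triangleleft>\<^bsub>?X\<^esub> \<one>\<^bsub>S'\<^esub> = x" by simp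
    have "tensor_lift tgroup (l \<one>\<^bsub>R\<^esub>) x = x"
      by (rule eqI[OF hl hom_add_id]) (use * in \<open>simp_all add: pl lone\<close>)
    then show "\<one>\<^bsub>R\<^esub> \<triangleright>\<^bsub>?X\<^esub> x = x" by simp
  next
    fix r x s assume *: "r \<in> carrier R" "x \<in> carrier ?X" "s \<in> carrier S'"
    have "tensor_lift tgroup (\<lambda>x y. \<rho> x y s) (tensor_lift tgroup (l r) x)
        = tensor_lift tgroup (l r) (tensor_lift tgroup (\<lambda>x y. \<rho> x y s) x)"
      by (rule eqI[OF comp[OF hl hr] comp[OF hr hl]]) (use * in \<open>simp_all add: pl pr lr\<close>)
    then show "(r \<triangleright>\<^bsub>?X\<^esub> x) \<triangleleft>\<^bsub>?X\<^esub> s = r \<triangleright>\<^bsub>?X\<^esub> (x \<triangleleft>\<^bsub>?X\<^esub> s)" by simp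
  qed
qed

end

section \<open>The bimodule \<open>A \<otimes>\<^sub>B A\<close>, the ring \<open>T\<close> and its module \<open>R\<close>\<close>

lemma ext_right_simps [simp]:
  "carrier (ext_right A \<iota>) = carrier A"
  "\<zero>\<^bsub>ext_right A \<iota>\<^esub> = \<zero>\<^bsub>A\<^esub>"
  "x \<oplus>\<^bsub>ext_right A \<iota>\<^esub> y = x \<oplus>\<^bsub>A\<^esub> y"
  "x \<triangleleft>\<^bsub>ext_right A \<iota>\<^esub> b = x \<otimes>\<^bsub>A\<^esub> \<iota> b"
  by (simp_all add: ext_right_def)

lemma ext_left_simps [simp]:
  "carrier (ext_left A \<iota>) = carrier A"
  "\<zero>\<^bsub>ext_left A \<iota>\<^esub> = \<zero>\<^bsub>A\<^esub>"
  "x \<oplus>\<^bsub>ext_left A \<iota>\<^esub> y = x \<oplus>\<^bsub>A\<^esub> y"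
  "b \<triangleright>\<^bsub>ext_left A \<iota>\<^esub> x = \<iota> b \<otimes>\<^bsub>A\<^esub> x"
  by (simp_all add: ext_left_def)

locale ring_extension = A: ring A + B: ring B
  for A :: "('a, 'k) ring_scheme" and B :: "('b, 'l) ring_scheme" +
  fixes \<iota> :: "'b \<Rightarrow> 'a"
  assumes \<iota>: "\<iota> \<in> ring_hom B A"
begin

lemma \<iota>_simps [simp]:
  "b \<in> carrier B \<Longrightarrow> \<iota> b \<in> carrier A"
  "\<lbrakk>b \<in> carrier B; b' \<in> carrier B\<rbrakk> \<Longrightarrow> \<iota> (b \<oplus>\<^bsub>B\<^esub> b') = \<iota> b \<oplus>\<^bsub>A\<^esub> \<iota> b'"
  "\<lbrakk>b \<in> carrier B; b' \<in> carrier B\<rbrakk> \<Longrightarrow> \<iota> (b \<otimes>\<^bsub>B\<^esub> b') = \<iota> b \<otimes>\<^bsub>A\<^esub> \<iota> b'"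
  "\<iota> \<one>\<^bsub>B\<^esub> = \<one>\<^bsub>A\<^esub>"
  using \<iota> by (auto simp: ring_hom_def)

sublocale reg: two_sided_module A A "regular_bimodule A"
  by (rule two_sided_module_regular) (rule A.ring_axioms)

lemma abelian_ext_left: "abelian_group (ext_left A \<iota>)"
proof (rule abelian_groupI)
  fix x assume "x \<in> carrier (ext_left A \<iota>)"
  then show "\<exists>y\<in>carrier (ext_left A \<iota>). y \<oplus>\<^bsub>ext_left A \<iota>\<^esub> x = \<zero>\<^bsub>ext_left A \<iota>\<^esub>"
    by (intro bexI[of _ "\<ominus>\<^bsub>A\<^esub> x"]) (auto simp: A.l_neg)
qed (auto simp: A.a_ac)

lemma abelian_ext_right: "abelian_group (ext_right A \<iota>)"
proof (rule abelian_groupI)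
  fix x assume "x \<in> carrier (ext_right A \<iota>)"
  then show "\<exists>y\<in>carrier (ext_right A \<iota>). y \<oplus>\<^bsub>ext_right A \<iota>\<^esub> x = \<zero>\<^bsub>ext_right A \<iota>\<^esub>"
    by (intro bexI[of _ "\<ominus>\<^bsub>A\<^esub> x"]) (auto simp: A.l_neg)
qed (auto simp: A.a_ac)

sublocale AA: tensor_factors B "ext_right A \<iota>" "ext_left A \<iota>"
  by (intro tensor_factors.intro right_module.intro right_module_axioms.intro tensor_factors_axioms.intro
      abelian_ext_left abelian_ext_right B.ring_axioms)
    (auto simp: A.l_distr A.r_distr A.m_assoc)

abbreviation "sq \<equiv> tensor_square A B \<iota>"
abbreviation pt (infixl \<open>\<otimes>\<^sub>B\<close> 70) where "a \<otimes>\<^sub>B a' \<equiv> pure_tensor B (ext_right A \<iota>) (ext_left A \<iota>) a a'"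
abbreviation "u \<equiv> \<one>\<^bsub>A\<^esub> \<otimes>\<^sub>B \<one>\<^bsub>A\<^esub>"

lemma sq_simps:
  "carrier sq = carrier AA.tgroup"
  "\<zero>\<^bsub>sq\<^esub> = \<zero>\<^bsub>AA.tgroup\<^esub>"
  "x \<oplus>\<^bsub>sq\<^esub> y = x \<oplus>\<^bsub>AA.tgroup\<^esub> y"
  "x \<triangleleft>\<^bsub>sq\<^esub> c = tensor_lift AA.tgroup (\<lambda>a a'. a \<otimes>\<^sub>B (a' \<otimes>\<^bsub>A\<^esub> c)) x"
  "c \<triangleright>\<^bsub>sq\<^esub> x = tensor_lift AA.tgroup (\<lambda>a a'. (c \<otimes>\<^bsub>A\<^esub> a) \<otimes>\<^sub>B a') x"
  by (simp_all add: tensor_square_def Let_def ext_tensor_group_def ext_tensor_def)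

lemma pt_closed [simp]: "\<lbrakk>a \<in> carrier A; a' \<in> carrier A\<rbrakk> \<Longrightarrow> a \<otimes>\<^sub>B a' \<in> carrier sq"
  by (simp add: sq_simps)

lemmas pt_add_left = AA.ptensor_add_left[simplified]
lemmas pt_add_right = AA.ptensor_add_right[simplified]
lemmas pt_swap = AA.ptensor_swap[simplified]

text \<open>Here the scalar \<open>\<iota> b\<close> is the innermost factor of a right-nested
  product, a shape that \<open>pt_swap\<close> does not match.\<close>

lemma pt_swap_assoc:
  "\<lbrakk>c \<in> carrier A; a \<in> carrier A; b \<in> carrier B; a' \<in> carrier A\<rbrakk> \<Longrightarrow>
    (c \<otimes>\<^bsub>A\<^esub> (a \<otimes>\<^bsub>A\<^esub> \<iota> b)) \<otimes>\<^sub>B a' = (c \<otimes>\<^bsub>A\<^esub> a) \<otimes>\<^sub>B (\<iota> b \<otimes>\<^bsub>A\<^esub> a')"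
  using pt_swap[of "c \<otimes>\<^bsub>A\<^esub> a" b a'] by (simp add: A.m_assoc)

lemma balanced_left: "c \<in> carrier A \<Longrightarrow>
    balanced B (ext_right A \<iota>) (ext_left A \<iota>) AA.tgroup (\<lambda>a a'. (c \<otimes>\<^bsub>A\<^esub> a) \<otimes>\<^sub>B a')"
  by (simp add: balanced_def A.r_distr pt_add_left pt_add_right pt_swap_assoc)

lemma balanced_right: "c \<in> carrier A \<Longrightarrow>
    balanced B (ext_right A \<iota>) (ext_left A \<iota>) AA.tgroup (\<lambda>a a'. a \<otimes>\<^sub>B (a' \<otimes>\<^bsub>A\<^esub> c))"
  by (simp add: balanced_def A.l_distr pt_add_left pt_add_right pt_swap A.m_assoc)

lemma lsmult_pt: "\<lbrakk>c \<in> carrier A; a \<in> carrier A; a' \<in> carrier A\<rbrakk> \<Longrightarrow>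
    c \<triangleright>\<^bsub>sq\<^esub> (a \<otimes>\<^sub>B a') = (c \<otimes>\<^bsub>A\<^esub> a) \<otimes>\<^sub>B a'"
  and rsmult_pt: "\<lbrakk>c \<in> carrier A; a \<in> carrier A; a' \<in> carrier A\<rbrakk> \<Longrightarrow>
    (a \<otimes>\<^sub>B a') \<triangleleft>\<^bsub>sq\<^esub> c = a \<otimes>\<^sub>B (a' \<otimes>\<^bsub>A\<^esub> c)"
  by (simp_all add: sq_simps
      AA.tlift_ptensor[OF AA.tgroup.abelian_group_axioms balanced_left, simplified]
      AA.tlift_ptensor[OF AA.tgroup.abelian_group_axioms balanced_right, simplified])

sublocale sq: two_sided_module A A sq
proof -
  have "two_sided_module A A \<lparr>carrier = carrier AA.tgroup, monoid.mult = monoid.mult AA.tgroup,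
    one = one AA.tgroup, ring.zero = ring.zero AA.tgroup, add = add AA.tgroup,
    rsmult = (\<lambda>z c. tensor_lift AA.tgroup (\<lambda>a a'. a \<otimes>\<^sub>B (a' \<otimes>\<^bsub>A\<^esub> c)) z),
    lsmult = (\<lambda>c z. tensor_lift AA.tgroup (\<lambda>a a'. (c \<otimes>\<^bsub>A\<^esub> a) \<otimes>\<^sub>B a') z)\<rparr>"
    by (rule AA.two_sided_module_tensor)
      (simp_all add: A.ring_axioms balanced_left balanced_right A.l_distr A.r_distr pt_add_left pt_add_right
        A.m_assoc AA.tlift_ptensor[OF AA.tgroup.abelian_group_axioms balanced_left, simplified]
        AA.tlift_ptensor[OF AA.tgroup.abelian_group_axioms balanced_right, simplified])
  then show "two_sided_module A A sq"
    by (simp add: tensor_square_def Let_def ext_tensor_group_def ext_tensor_def)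
qed

section \<open>The universal property of \<open>A \<otimes>\<^sub>B A\<close>\<close>

lemma u_closed: "u \<in> carrier sq"
  by simp

lemma pt_eq: "\<lbrakk>a \<in> carrier A; a' \<in> carrier A\<rbrakk> \<Longrightarrow> a \<otimes>\<^sub>B a' = (a \<triangleright>\<^bsub>sq\<^esub> u) \<triangleleft>\<^bsub>sq\<^esub> a'"
  by (simp add: lsmult_pt rsmult_pt)

text \<open>As a bimodule, \<open>A \<otimes>\<^sub>B A\<close> is generated by \<open>u\<close>,
  because \<open>a \<otimes>\<^sub>B a' = a u a'\<close>.\<close>

lemma bimodule_hom_sq_eqI:
  assumes "two_sided_module A A X" and f: "f \<in> bimodule_hom A A sq X" and g: "g \<in> bimodule_hom A A sq X"
    and "f u = g u" and z: "z \<in> carrier sq"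
  shows "f z = g z"
proof -
  interpret X: two_sided_module A A X by fact
  have "f \<in> hom (add_monoid AA.tgroup) (add_monoid X)" "g \<in> hom (add_monoid AA.tgroup) (add_monoid X)"
    using bimodule_homD(1)[OF f] bimodule_homD(1)[OF g] by (simp_all add: sq_simps hom_def)
  then show ?thesis
  proof (rule AA.tgroup_hom_eqI[OF X.M.abelian_group_axioms])
    fix a a' assume "a \<in> carrier (ext_right A \<iota>)" "a' \<in> carrier (ext_left A \<iota>)"
    then have a: "a \<in> carrier A" "a' \<in> carrier A" by simp_all
    show "f (a \<otimes>\<^sub>B a') = g (a \<otimes>\<^sub>B a')"
      unfolding pt_eq[OF a] using a assms(4)
      by (simp only: sq.lsmult_closed u_closed bimodule_homD[OF f] bimodule_homD[OF g])
  qed (use z in \<open>simp add: sq_simps\<close>)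
qed

text \<open>For an invariant \<open>x\<close> this is the bimodule map from
  \<open>A \<otimes>\<^sub>B A\<close> to \<open>X\<close> that sends \<open>u\<close> to
  \<open>x\<close>. With \<open>X = sq\<close> it is the action of \<open>T\<close> on
  \<open>A \<otimes>\<^sub>B A\<close> and the product of \<open>T\<close>; with
  \<open>X = rg\<close> it is \<open>t\<^sup>1 r t\<^sup>2\<close>, the action of \<open>T\<close>
  on \<open>R\<close>. A single family of maps thus covers all these operations.\<close>

definition theta :: "('a, 'a, 'x, 'y) bimodule_scheme \<Rightarrow> 'x \<Rightarrow> ('a \<times> 'a \<Rightarrow>\<^sub>0 int) set \<Rightarrow> 'x"
  where "theta X x = tensor_lift X (\<lambda>a a'. (a \<triangleright>\<^bsub>X\<^esub> x) \<triangleleft>\<^bsub>X\<^esub> a')"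

text \<open>Invariance of \<open>x\<close> is what carries \<open>\<iota> b\<close> across
  \<open>x\<close>, from \<open>a\<close> to \<open>a'\<close>.\<close>

lemma balanced_theta:
  assumes "two_sided_module A A X" and x: "x \<in> invariants B \<iota> X"
  shows "balanced B (ext_right A \<iota>) (ext_left A \<iota>) X (\<lambda>a a'. (a \<triangleright>\<^bsub>X\<^esub> x) \<triangleleft>\<^bsub>X\<^esub> a')"
proof -
  interpret X: two_sided_module A A X by fact
  have xc: "x \<in> carrier X" and xb: "\<And>b. b \<in> carrier B \<Longrightarrow> \<iota> b \<triangleright>\<^bsub>X\<^esub> x = x \<triangleleft>\<^bsub>X\<^esub> \<iota> b"
    using x by (auto simp: invariants_def)
  show ?thesis
    by (simp add: balanced_def xc X.lsmult_closed X.rsmult_closed X.lsmult_add_left X.rsmult_add_left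
        X.rsmult_add_right X.lsmult_assoc xb X.rsmult_assoc X.smult_commute)
qed

lemma
  assumes X: "two_sided_module A A X" and x: "x \<in> invariants B \<iota> X"
  shows theta_pt: "\<lbrakk>a \<in> carrier A; a' \<in> carrier A\<rbrakk> \<Longrightarrow> theta X x (a \<otimes>\<^sub>B a') = (a \<triangleright>\<^bsub>X\<^esub> x) \<triangleleft>\<^bsub>X\<^esub> a'"
    and theta_u: "theta X x u = x"
    and theta_hom: "theta X x \<in> bimodule_hom A A sq X"
proof -
  interpret X: two_sided_module A A X by fact
  have xc: "x \<in> carrier X" using x by (simp add: invariants_def)
  note ab = X.M.abelian_group_axioms
  show pt: "theta X x (a \<otimes>\<^sub>B a') = (a \<triangleright>\<^bsub>X\<^esub> x) \<triangleleft>\<^bsub>X\<^esub> a'" if "a \<in> carrier A" "a' \<in> carrier A" for a a'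
    using AA.tlift_ptensor[OF ab balanced_theta[OF X x]] that by (simp add: theta_def)
  then show "theta X x u = x" by (simp add: xc X.lsmult_one X.rsmult_one)
  have h: "theta X x \<in> hom (add_monoid AA.tgroup) (add_monoid X)"
    using AA.tlift_hom[OF ab balanced_theta[OF X x]] by (simp add: theta_def)
  have hl: "(\<lambda>z. c \<triangleright>\<^bsub>sq\<^esub> z) \<in> hom (add_monoid AA.tgroup) (add_monoid AA.tgroup)"
    and hr: "(\<lambda>z. z \<triangleleft>\<^bsub>sq\<^esub> c) \<in> hom (add_monoid AA.tgroup) (add_monoid AA.tgroup)" if "c \<in> carrier A" for c
    using sq.lsmult_hom[OF that] sq.rsmult_hom[OF that] by (simp_all add: hom_def sq_simps)
  show "theta X x \<in> bimodule_hom A A sq X"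
  proof (rule bimodule_homI)
    fix z assume z: "z \<in> carrier sq"
    then show "theta X x z \<in> carrier X" using hom_in_carrier[OF h] by (simp add: sq_simps)
    { fix y assume "y \<in> carrier sq"
      then show "theta X x (z \<oplus>\<^bsub>sq\<^esub> y) = theta X x z \<oplus>\<^bsub>X\<^esub> theta X x y"
        using z hom_mult[OF h] by (simp add: sq_simps) }
    fix c assume c: "c \<in> carrier A"
    show "theta X x (c \<triangleright>\<^bsub>sq\<^esub> z) = c \<triangleright>\<^bsub>X\<^esub> theta X x z"
      by (rule AA.tgroup_hom_eqI[OF ab hom_add_compose[OF hl h] hom_add_compose[OF h X.lsmult_hom]])
        (use c z xc in \<open>simp_all add: pt lsmult_pt X.lsmult_closed X.smult_commute X.lsmult_assoc sq_simps(1)\<close>)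
    show "theta X x (z \<triangleleft>\<^bsub>sq\<^esub> c) = theta X x z \<triangleleft>\<^bsub>X\<^esub> c"
      by (rule AA.tgroup_hom_eqI[OF ab hom_add_compose[OF hr h] hom_add_compose[OF h X.rsmult_hom]])
        (use c z xc in \<open>simp_all add: pt rsmult_pt X.lsmult_closed X.rsmult_assoc sq_simps(1)\<close>)
  qed
qed


section \<open>Invariants under \<open>B\<close> and their correspondence with bimodule maps\<close>

lemma invariants_zero: "two_sided_module A A X \<Longrightarrow> \<zero>\<^bsub>X\<^esub> \<in> invariants B \<iota> X"
proof -
  assume "two_sided_module A A X"
  then interpret X: two_sided_module A A X .
  show ?thesis by (simp add: invariants_def X.lsmult_zero_right X.rsmult_zero_left)
qed

lemma invariants_add:
  "\<lbrakk>two_sided_module A A X; x \<in> invariants B \<iota> X; y \<in> invariants B \<iota> X\<rbrakk> \<Longrightarrow>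
    x \<oplus>\<^bsub>X\<^esub> y \<in> invariants B \<iota> X"
proof -
  assume "two_sided_module A A X" and xy: "x \<in> invariants B \<iota> X" "y \<in> invariants B \<iota> X"
  then interpret X: two_sided_module A A X by simp
  show ?thesis using xy by (simp add: invariants_def X.lsmult_add_right X.rsmult_add_left)
qed

lemma invariants_minus:
  "\<lbrakk>two_sided_module A A X; x \<in> invariants B \<iota> X\<rbrakk> \<Longrightarrow> \<ominus>\<^bsub>X\<^esub> x \<in> invariants B \<iota> X"
proof -
  assume "two_sided_module A A X" and x: "x \<in> invariants B \<iota> X"
  then interpret X: two_sided_module A A X by simp
  note ab = X.M.abelian_group_axioms
  show ?thesis
    using x additive_hom_minus[OF ab ab X.lsmult_hom] additive_hom_minus[OF ab ab X.rsmult_hom]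
    by (simp add: invariants_def)
qed

lemma invariants_hom:
  "\<lbrakk>h \<in> bimodule_hom A A X Y; x \<in> invariants B \<iota> X\<rbrakk> \<Longrightarrow> h x \<in> invariants B \<iota> Y"
  by (simp add: invariants_def bimodule_homD flip: bimodule_homD(4,5))

lemma invariants_closed: "x \<in> invariants B \<iota> X \<Longrightarrow> x \<in> carrier X"
  by (simp add: invariants_def)

lemma u_invariant: "u \<in> invariants B \<iota> sq"
  using pt_swap[of "\<one>\<^bsub>A\<^esub>" _ "\<one>\<^bsub>A\<^esub>"] by (simp add: invariants_def lsmult_pt rsmult_pt)

lemma theta_closed:
  "\<lbrakk>two_sided_module A A X; x \<in> invariants B \<iota> X; z \<in> carrier sq\<rbrakk> \<Longrightarrow> theta X x z \<in> carrier X"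
  using bimodule_homD(2)[OF theta_hom] .

lemma theta_invariant:
  "\<lbrakk>two_sided_module A A X; x \<in> invariants B \<iota> X; z \<in> invariants B \<iota> sq\<rbrakk> \<Longrightarrow>
    theta X x z \<in> invariants B \<iota> X"
  using invariants_hom[OF theta_hom] .

text \<open>Both sides are bimodule maps with the same value at \<open>u\<close>. Several identities
  for \<open>theta\<close> below arise by writing down a bimodule map and computing its value at
  \<open>u\<close>.\<close>

lemma theta_unique:
  assumes X: "two_sided_module A A X" and h: "h \<in> bimodule_hom A A sq X" and z: "z \<in> carrier sq"
  shows "theta X (h u) z = h z"
proof -
  have "h u \<in> invariants B \<iota> X" by (rule invariants_hom[OF h u_invariant])
  from bimodule_hom_sq_eqI[OF X theta_hom[OF X this] h theta_u[OF X this] z] show ?thesis .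
qed

text \<open>The composite of \<open>theta sq t\<close> with \<open>theta X x\<close> sends
  \<open>u\<close> to \<open>theta X x t\<close>. With \<open>X = sq\<close> this is associativity
  of \<open>T\<close> and of its action on \<open>A \<otimes>\<^sub>B A\<close>; with
  \<open>X = rg\<close> it is associativity of the action on \<open>R\<close>.\<close>

lemma theta_theta:
  assumes X: "two_sided_module A A X" and x: "x \<in> invariants B \<iota> X"
    and t: "t \<in> invariants B \<iota> sq" and z: "z \<in> carrier sq"
  shows "theta X (theta X x t) z = theta X x (theta sq t z)"
  using theta_unique[OF X bimodule_hom_compose[OF theta_hom[OF sq.two_sided_module_axioms t] theta_hom[OF X x]] z]
  by (simp add: theta_u[OF sq.two_sided_module_axioms t])

lemma theta_add:
  assumes X: "two_sided_module A A X" and x: "x \<in> invariants B \<iota> X" and y: "y \<in> invariants B \<iota> X"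
    and z: "z \<in> carrier sq"
  shows "theta X (x \<oplus>\<^bsub>X\<^esub> y) z = theta X x z \<oplus>\<^bsub>X\<^esub> theta X y z"
proof -
  interpret X: two_sided_module A A X by fact
  note h = bimodule_homD[OF theta_hom[OF X x]] bimodule_homD[OF theta_hom[OF X y]]
  have "(\<lambda>z. theta X x z \<oplus>\<^bsub>X\<^esub> theta X y z) \<in> bimodule_hom A A sq X"
    by (rule bimodule_homI) (simp_all add: h X.M.a_ac X.lsmult_add_right X.rsmult_add_left)
  from theta_unique[OF X this z] show ?thesis by (simp add: theta_u X x y)
qed

lemma theta_sq_u: "z \<in> carrier sq \<Longrightarrow> theta sq u z = z"
  using theta_unique[OF sq.two_sided_module_axioms, of "\<lambda>z. z"] by (simp add: bimodule_homI)

text \<open>The inner lift in \<open>T_action\<close> has the value \<open>a t a'\<close>, since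
  \<open>z \<mapsto> a z a'\<close> is additive and agrees with it on pure tensors. The outer lift
  is then the one that defines \<open>theta sq t\<close>.\<close>

lemma T_action_theta:
  assumes t: "t \<in> invariants B \<iota> sq" and x: "x \<in> carrier sq"
  shows "T_action A B \<iota> t x = theta sq t x"
proof -
  note tg = AA.tgroup.abelian_group_axioms and sqm = sq.two_sided_module_axioms
  define \<psi> where "\<psi> a a' = tensor_lift AA.tgroup (\<lambda>t1 t2. (a \<otimes>\<^bsub>A\<^esub> t1) \<otimes>\<^sub>B (t2 \<otimes>\<^bsub>A\<^esub> a')) t" for a a'
  have \<psi>: "\<psi> a a' = (a \<triangleright>\<^bsub>sq\<^esub> t) \<triangleleft>\<^bsub>sq\<^esub> a'" if a: "a \<in> carrier A" "a' \<in> carrier A" for a a'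
  proof -
    have bal: "balanced B (ext_right A \<iota>) (ext_left A \<iota>) AA.tgroup (\<lambda>t1 t2. (a \<otimes>\<^bsub>A\<^esub> t1) \<otimes>\<^sub>B (t2 \<otimes>\<^bsub>A\<^esub> a'))"
      using a by (simp add: balanced_def A.l_distr A.r_distr pt_add_left pt_add_right pt_swap_assoc A.m_assoc)
    have h: "(\<lambda>z. (a \<triangleright>\<^bsub>sq\<^esub> z) \<triangleleft>\<^bsub>sq\<^esub> a') \<in> hom (add_monoid AA.tgroup) (add_monoid AA.tgroup)"
      using hom_add_compose[OF sq.lsmult_hom[OF a(1)] sq.rsmult_hom[OF a(2)]]
      by (simp add: hom_def sq_simps(1,3))
    show ?thesis unfolding \<psi>_def
      by (rule AA.tgroup_hom_eqI[OF tg AA.tlift_hom[OF tg bal] h])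
        (use a t in \<open>simp_all add: AA.tlift_ptensor[OF tg bal] lsmult_pt rsmult_pt invariants_def sq_simps(1)\<close>)
  qed
  \<comment> \<open>This is where the invariance of \<open>t\<close> enters, through
    \<open>balanced_theta\<close>.\<close>
  have "balanced B (ext_right A \<iota>) (ext_left A \<iota>) sq \<psi>"
    by (rule balanced_cong[OF balanced_theta[OF sqm t] AA.right_module_axioms AA.N.abelian_group_axioms])
      (simp_all add: \<psi>)
  then have bal: "balanced B (ext_right A \<iota>) (ext_left A \<iota>) AA.tgroup \<psi>"
    by (simp add: balanced_def sq_simps(1,3))
  have "theta sq t \<in> hom (add_monoid AA.tgroup) (add_monoid AA.tgroup)"
    using bimodule_homD(1)[OF theta_hom[OF sqm t]] by (simp add: hom_def sq_simps(1,3))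
  from AA.tgroup_hom_eqI[OF tg AA.tlift_hom[OF tg bal] this] x
  have "tensor_lift AA.tgroup \<psi> x = theta sq t x"
    by (simp add: AA.tlift_ptensor[OF tg bal] \<psi> theta_pt[OF sqm t] sq_simps(1))
  then show ?thesis
    by (simp add: T_action_def ext_tensor_group_def ext_tensor_def \<psi>_def[abs_def])
qed

section \<open>The ring \<open>T\<close> and the right \<open>T\<close>-module
  \<open>R\<close>\<close>

abbreviation "rg \<equiv> regular_bimodule A"
abbreviation "T \<equiv> T_ring A B \<iota>"
abbreviation "R \<equiv> centralizer_module A B \<iota>"

lemma T_simps [simp]:
  "carrier T = invariants B \<iota> sq"
  "\<zero>\<^bsub>T\<^esub> = \<zero>\<^bsub>sq\<^esub>"
  "\<one>\<^bsub>T\<^esub> = u"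
  "x \<oplus>\<^bsub>T\<^esub> y = x \<oplus>\<^bsub>sq\<^esub> y"
  "\<lbrakk>t \<in> invariants B \<iota> sq; x \<in> carrier sq\<rbrakk> \<Longrightarrow> t \<otimes>\<^bsub>T\<^esub> x = theta sq t x"
  by (simp_all add: T_ring_def Let_def T_action_theta sq_simps ext_tensor_group_def ext_tensor_def)

lemma R_simps [simp]:
  "carrier R = invariants B \<iota> rg"
  "\<zero>\<^bsub>R\<^esub> = \<zero>\<^bsub>A\<^esub>"
  "x \<oplus>\<^bsub>R\<^esub> y = x \<oplus>\<^bsub>A\<^esub> y"
  by (simp_all add: centralizer_module_def)

lemma R_action [simp]:
  assumes r: "r \<in> invariants B \<iota> rg" and t: "t \<in> carrier sq"
  shows "r \<triangleleft>\<^bsub>R\<^esub> t = theta rg r t"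
proof -
  note ab = A.abelian_group_axioms and rm = reg.two_sided_module_axioms
  have bal: "balanced B (ext_right A \<iota>) (ext_left A \<iota>) A (\<lambda>t1 t2. t1 \<otimes>\<^bsub>A\<^esub> r \<otimes>\<^bsub>A\<^esub> t2)"
    using balanced_theta[OF rm r] by (simp add: balanced_def)
  have "theta rg r \<in> hom (add_monoid AA.tgroup) (add_monoid A)"
    using bimodule_homD(1)[OF theta_hom[OF rm r]] by (simp add: hom_def sq_simps(1,3))
  from AA.tgroup_hom_eqI[OF ab AA.tlift_hom[OF ab bal] this] t
  show ?thesis
    by (simp add: AA.tlift_ptensor[OF ab bal] theta_pt[OF rm r] sq_simps(1) centralizer_module_def)
qed

text \<open>Through \<open>t \<mapsto> theta sq t\<close> the elements of \<open>T\<close>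
  correspond to the bimodule endomorphisms of \<open>A \<otimes>\<^sub>B A\<close>, and the product
  to composition. The left unit law is \<open>theta_sq_u\<close>, the right one is
  \<open>theta_u\<close>.\<close>

lemma ring_T: "ring T"
proof (rule ringI)
  note sqm = sq.two_sided_module_axioms
  show "abelian_group T"
  proof (rule abelian_groupI)
    fix x assume "x \<in> carrier T"
    then show "\<exists>y\<in>carrier T. y \<oplus>\<^bsub>T\<^esub> x = \<zero>\<^bsub>T\<^esub>"
      by (intro bexI[of _ "\<ominus>\<^bsub>sq\<^esub> x"]) (auto simp: sq.M.l_neg invariants_minus[OF sqm] invariants_closed)
  qed (auto simp: sq.M.a_ac invariants_zero[OF sqm] invariants_add[OF sqm] invariants_closed)
  show "monoid T"
    by (rule monoidI)
      (auto simp: u_invariant invariants_closed theta_invariant[OF sqm] theta_theta[OF sqm] theta_closed[OF sqm]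
        theta_sq_u theta_u[OF sqm])
qed (auto simp: invariants_closed theta_add[OF sq.two_sided_module_axioms] invariants_add[OF sq.two_sided_module_axioms]
    bimodule_homD(3)[OF theta_hom[OF sq.two_sided_module_axioms]])

text \<open>Through \<open>theta rg\<close> the elements of \<open>R\<close> correspond to the
  bimodule maps from \<open>A \<otimes>\<^sub>B A\<close> to \<open>A\<close>, on which
  \<open>T\<close> acts by precomposition.\<close>

lemma right_module_R: "right_module T R"
proof -
  note rm = reg.two_sided_module_axioms
  have ab: "abelian_group R"
  proof (rule abelian_groupI)
    fix x assume x: "x \<in> carrier R"
    then have "\<ominus>\<^bsub>rg\<^esub> x \<in> invariants B \<iota> rg" by (simp add: invariants_minus[OF rm])
    moreover have "\<ominus>\<^bsub>rg\<^esub> x \<oplus>\<^bsub>A\<^esub> x = \<zero>\<^bsub>A\<^esub>" using reg.M.l_neg[of x] x invariants_closed[of x rg] by simp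
    ultimately show "\<exists>y\<in>carrier R. y \<oplus>\<^bsub>R\<^esub> x = \<zero>\<^bsub>R\<^esub>" by auto
  qed (use invariants_zero[OF rm] invariants_add[OF rm] invariants_closed[of _ rg] A.a_ac in auto)
  show ?thesis
    by (intro right_module.intro right_module_axioms.intro ring_T ab)
      (use invariants_closed[of _ rg] in \<open>auto simp: theta_invariant[OF rm] theta_invariant[OF sq.two_sided_module_axioms] 
        invariants_closed theta_add[OF rm, simplified] invariants_add[OF rm, simplified]
        bimodule_homD(3)[OF theta_hom[OF rm], simplified] theta_theta[OF rm] theta_u[OF rm] u_invariant
        invariants_add[OF sq.two_sided_module_axioms]\<close>)
qed

section \<open>The bimodule \<open>R \<otimes>\<^sub>T (A \<otimes>\<^sub>B A)\<close>\<close>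


abbreviation "Tsq \<equiv> T_tensor_square A B \<iota>"

lemma Tsq_simps [simp]:
  "carrier Tsq = carrier sq"
  "\<zero>\<^bsub>Tsq\<^esub> = \<zero>\<^bsub>sq\<^esub>"
  "x \<oplus>\<^bsub>Tsq\<^esub> y = x \<oplus>\<^bsub>sq\<^esub> y"
  "\<lbrakk>t \<in> invariants B \<iota> sq; x \<in> carrier sq\<rbrakk> \<Longrightarrow> t \<triangleright>\<^bsub>Tsq\<^esub> x = theta sq t x"
  by (simp_all add: T_tensor_square_def Let_def T_action_theta)

lemma abelian_Tsq: "abelian_group Tsq"
proof (rule abelian_groupI)
  fix x assume "x \<in> carrier Tsq"
  then show "\<exists>y\<in>carrier Tsq. y \<oplus>\<^bsub>Tsq\<^esub> x = \<zero>\<^bsub>Tsq\<^esub>"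
    by (intro bexI[of _ "\<ominus>\<^bsub>sq\<^esub> x"]) (auto simp: sq.M.l_neg)
qed (auto simp: sq.M.a_ac)

sublocale RT: tensor_factors T R Tsq
  by (intro tensor_factors.intro right_module_R abelian_Tsq tensor_factors_axioms.intro)
    (simp add: theta_closed[OF sq.two_sided_module_axioms])

abbreviation "W \<equiv> R_tensor_square A B \<iota>"
abbreviation pR (infixl \<open>\<otimes>\<^sub>T\<close> 70) where "r \<otimes>\<^sub>T x \<equiv> pure_tensor T R Tsq r x"

lemma W_simps:
  "carrier W = carrier RT.tgroup"
  "\<zero>\<^bsub>W\<^esub> = \<zero>\<^bsub>RT.tgroup\<^esub>"
  "x \<oplus>\<^bsub>W\<^esub> y = x \<oplus>\<^bsub>RT.tgroup\<^esub> y"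
  "z \<triangleleft>\<^bsub>W\<^esub> c = tensor_lift RT.tgroup (\<lambda>r x. r \<otimes>\<^sub>T (x \<triangleleft>\<^bsub>sq\<^esub> c)) z"
  "c \<triangleright>\<^bsub>W\<^esub> z = tensor_lift RT.tgroup (\<lambda>r x. r \<otimes>\<^sub>T (c \<triangleright>\<^bsub>sq\<^esub> x)) z"
  by (simp_all add: R_tensor_square_def Let_def)

lemma pR_closed [simp]: "\<lbrakk>r \<in> invariants B \<iota> rg; x \<in> carrier sq\<rbrakk> \<Longrightarrow> r \<otimes>\<^sub>T x \<in> carrier W"
  by (simp add: W_simps)

lemma pR_add_right: "\<lbrakk>r \<in> invariants B \<iota> rg; x \<in> carrier sq; y \<in> carrier sq\<rbrakk> \<Longrightarrow>
    r \<otimes>\<^sub>T (x \<oplus>\<^bsub>sq\<^esub> y) = r \<otimes>\<^sub>T x \<oplus>\<^bsub>RT.tgroup\<^esub> r \<otimes>\<^sub>T y"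
  using RT.ptensor_add_right[of r x y] by simp

lemma pR_add_left: "\<lbrakk>r \<in> invariants B \<iota> rg; r' \<in> invariants B \<iota> rg; x \<in> carrier sq\<rbrakk> \<Longrightarrow>
    (r \<oplus>\<^bsub>A\<^esub> r') \<otimes>\<^sub>T x = r \<otimes>\<^sub>T x \<oplus>\<^bsub>RT.tgroup\<^esub> r' \<otimes>\<^sub>T x"
  using RT.ptensor_add_left[of r r' x] by simp

lemma pR_swap: "\<lbrakk>r \<in> invariants B \<iota> rg; t \<in> invariants B \<iota> sq; x \<in> carrier sq\<rbrakk> \<Longrightarrow>
    theta rg r t \<otimes>\<^sub>T x = r \<otimes>\<^sub>T theta sq t x"
  using RT.ptensor_swap[of r t x] by (simp add: invariants_closed)

text \<open>A \<open>T\<close>-linear endomorphism \<open>h\<close> of the second factor induces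
  \<open>1 \<otimes> h\<close>. Left and right multiplication by an element of \<open>A\<close>
  qualify because every \<open>theta sq t\<close> is a bimodule map.\<close>

lemma balanced_W_endo:
  assumes h: "\<And>x. x \<in> carrier sq \<Longrightarrow> h x \<in> carrier sq"
    and "\<And>x y. \<lbrakk>x \<in> carrier sq; y \<in> carrier sq\<rbrakk> \<Longrightarrow> h (x \<oplus>\<^bsub>sq\<^esub> y) = h x \<oplus>\<^bsub>sq\<^esub> h y"
    and "\<And>t x. \<lbrakk>t \<in> invariants B \<iota> sq; x \<in> carrier sq\<rbrakk> \<Longrightarrow> h (theta sq t x) = theta sq t (h x)"
  shows "balanced T R Tsq RT.tgroup (\<lambda>r x. r \<otimes>\<^sub>T h x)"
  using assms by (simp add: balanced_def pR_add_left pR_add_right pR_swap invariants_closed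
      theta_closed[OF sq.two_sided_module_axioms])

lemma balanced_W_left: "c \<in> carrier A \<Longrightarrow> balanced T R Tsq RT.tgroup (\<lambda>r x. r \<otimes>\<^sub>T (c \<triangleright>\<^bsub>sq\<^esub> x))"
  by (rule balanced_W_endo)
    (simp_all add: sq.lsmult_closed sq.lsmult_add_right bimodule_homD[OF theta_hom[OF sq.two_sided_module_axioms]])

lemma balanced_W_right: "c \<in> carrier A \<Longrightarrow> balanced T R Tsq RT.tgroup (\<lambda>r x. r \<otimes>\<^sub>T (x \<triangleleft>\<^bsub>sq\<^esub> c))"
  by (rule balanced_W_endo)
    (simp_all add: sq.rsmult_closed sq.rsmult_add_left bimodule_homD[OF theta_hom[OF sq.two_sided_module_axioms]])

lemmas lift_W_left = RT.tlift_ptensor[OF RT.tgroup.abelian_group_axioms balanced_W_left, simplified]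
lemmas lift_W_right = RT.tlift_ptensor[OF RT.tgroup.abelian_group_axioms balanced_W_right, simplified]

lemma lsmult_pR: "\<lbrakk>c \<in> carrier A; r \<in> invariants B \<iota> rg; x \<in> carrier sq\<rbrakk> \<Longrightarrow>
    c \<triangleright>\<^bsub>W\<^esub> (r \<otimes>\<^sub>T x) = r \<otimes>\<^sub>T (c \<triangleright>\<^bsub>sq\<^esub> x)"
  by (simp add: W_simps lift_W_left)

lemma rsmult_pR: "\<lbrakk>c \<in> carrier A; r \<in> invariants B \<iota> rg; x \<in> carrier sq\<rbrakk> \<Longrightarrow>
    (r \<otimes>\<^sub>T x) \<triangleleft>\<^bsub>W\<^esub> c = r \<otimes>\<^sub>T (x \<triangleleft>\<^bsub>sq\<^esub> c)"
  by (simp add: W_simps lift_W_right)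

sublocale W: two_sided_module A A W
proof -
  have "two_sided_module A A \<lparr>carrier = carrier RT.tgroup, monoid.mult = monoid.mult RT.tgroup,
    one = one RT.tgroup, ring.zero = ring.zero RT.tgroup, add = add RT.tgroup,
    rsmult = (\<lambda>z c. tensor_lift RT.tgroup (\<lambda>r x. r \<otimes>\<^sub>T (x \<triangleleft>\<^bsub>sq\<^esub> c)) z),
    lsmult = (\<lambda>c z. tensor_lift RT.tgroup (\<lambda>r x. r \<otimes>\<^sub>T (c \<triangleright>\<^bsub>sq\<^esub> x)) z)\<rparr>"
    by (rule RT.two_sided_module_tensor)
      (simp_all add: A.ring_axioms balanced_W_left balanced_W_right lift_W_left lift_W_right
        sq.lsmult_add_left sq.rsmult_add_right sq.lsmult_assoc sq.rsmult_assoc sq.lsmult_one sq.rsmult_one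
        sq.smult_commute sq.lsmult_closed sq.rsmult_closed pR_add_right)
  then show "two_sided_module A A W"
    by (simp add: R_tensor_square_def Let_def)
qed

section \<open>Bimodule maps out of
  \<open>R \<otimes>\<^sub>T (A \<otimes>\<^sub>B A)\<close>\<close>

lemma W_hom_iff: "hom (add_monoid W) K = hom (add_monoid RT.tgroup) K"
  "hom K (add_monoid W) = hom K (add_monoid RT.tgroup)"
  by (auto simp: hom_def W_simps)

lemma W_hom_eqI:
  assumes "abelian_group H" "f \<in> hom (add_monoid W) (add_monoid H)" "g \<in> hom (add_monoid W) (add_monoid H)"
    and "\<And>r x. \<lbrakk>r \<in> invariants B \<iota> rg; x \<in> carrier sq\<rbrakk> \<Longrightarrow> f (r \<otimes>\<^sub>T x) = g (r \<otimes>\<^sub>T x)"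
    and "z \<in> carrier W"
  shows "f z = g z"
  by (rule RT.tgroup_hom_eqI[OF assms(1) assms(2,3)[unfolded W_hom_iff]])
    (use assms(4,5) in \<open>simp_all add: W_simps(1)\<close>)

text \<open>Intended for \<open>h\<close> from \<open>R\<close> to the invariants of
  \<open>X\<close> that is linear for the action \<open>x \<cdot> t = theta X x t\<close>. With
  \<open>X = sq\<close> it is \<open>r \<otimes> x \<mapsto> h(r) \<cdot> x\<close> for a
  \<open>T\<close>-linear map \<open>h\<close> from \<open>R\<close> to \<open>T\<close>; with
  \<open>X = rg\<close> and \<open>h\<close> the identity it is the evaluation
  \<open>r \<otimes> x \<mapsto> x\<^sup>1 r x\<^sup>2\<close>.\<close>

definition pairing :: "('a, 'a, 'x, 'y) bimodule_scheme \<Rightarrow> ('a \<Rightarrow> 'x) \<Rightarrow> ('a \<times> ('a \<times> 'a \<Rightarrow>\<^sub>0 int) set \<Rightarrow>\<^sub>0 int) set \<Rightarrow> 'x"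
  where "pairing X h = tensor_lift X (\<lambda>r x. theta X (h r) x)"

lemma
  assumes X: "two_sided_module A A X"
    and hc: "\<And>r. r \<in> invariants B \<iota> rg \<Longrightarrow> h r \<in> invariants B \<iota> X"
    and hadd: "\<And>r r'. \<lbrakk>r \<in> invariants B \<iota> rg; r' \<in> invariants B \<iota> rg\<rbrakk> \<Longrightarrow> h (r \<oplus>\<^bsub>A\<^esub> r') = h r \<oplus>\<^bsub>X\<^esub> h r'"
    and hact: "\<And>r t. \<lbrakk>r \<in> invariants B \<iota> rg; t \<in> invariants B \<iota> sq\<rbrakk> \<Longrightarrow> h (theta rg r t) = theta X (h r) t"
  shows pairing_pR: "\<lbrakk>r \<in> invariants B \<iota> rg; x \<in> carrier sq\<rbrakk> \<Longrightarrow> pairing X h (r \<otimes>\<^sub>T x) = theta X (h r) x"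
    and pairing_hom: "pairing X h \<in> bimodule_hom A A W X"
proof -
  interpret X: two_sided_module A A X by fact
  note ab = X.M.abelian_group_axioms
  note th = bimodule_homD[OF theta_hom[OF X hc]]
  \<comment> \<open>Moving \<open>t\<close> across the tensor sign is \<open>hact\<close> followed
    by \<open>theta_theta\<close>.\<close>
  have bal: "balanced T R Tsq X (\<lambda>r x. theta X (h r) x)"
    by (simp add: balanced_def th theta_add[OF X hc hc] hadd hact theta_theta[OF X hc] invariants_closed)
  show pR: "pairing X h (r \<otimes>\<^sub>T x) = theta X (h r) x" if "r \<in> invariants B \<iota> rg" "x \<in> carrier sq" for r x
    using RT.tlift_ptensor[OF ab bal] that by (simp add: pairing_def)
  have h: "pairing X h \<in> hom (add_monoid W) (add_monoid X)"
    using RT.tlift_hom[OF ab bal] by (simp add: pairing_def W_hom_iff)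
  show "pairing X h \<in> bimodule_hom A A W X"
  proof (rule bimodule_homI)
    fix z assume z: "z \<in> carrier W"
    then show "pairing X h z \<in> carrier X" using hom_in_carrier[OF h] by simp
    { fix y assume "y \<in> carrier W"
      then show "pairing X h (z \<oplus>\<^bsub>W\<^esub> y) = pairing X h z \<oplus>\<^bsub>X\<^esub> pairing X h y"
        using z hom_mult[OF h] by simp }
    fix c assume c: "c \<in> carrier A"
    show "pairing X h (c \<triangleright>\<^bsub>W\<^esub> z) = c \<triangleright>\<^bsub>X\<^esub> pairing X h z"
      by (rule W_hom_eqI[OF ab hom_add_compose[OF W.lsmult_hom h] hom_add_compose[OF h X.lsmult_hom]])
        (use c z in \<open>simp_all add: pR lsmult_pR sq.lsmult_closed th\<close>)
    show "pairing X h (z \<triangleleft>\<^bsub>W\<^esub> c) = pairing X h z \<triangleleft>\<^bsub>X\<^esub> c"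
      by (rule W_hom_eqI[OF ab hom_add_compose[OF W.rsmult_hom h] hom_add_compose[OF h X.rsmult_hom]])
        (use c z in \<open>simp_all add: pR rsmult_pR sq.rsmult_closed th\<close>)
  qed
qed

section \<open>Casimir elements and H-separability\<close>


lemmas sqm = sq.two_sided_module_axioms
lemmas rgm = reg.two_sided_module_axioms

definition casimir :: "('a \<times> 'a \<Rightarrow>\<^sub>0 int) set set"
  where "casimir = {e \<in> carrier sq. \<forall>a\<in>carrier A. a \<triangleright>\<^bsub>sq\<^esub> e = e \<triangleleft>\<^bsub>sq\<^esub> a}"

lemma casimirD:
  assumes "e \<in> casimir"
  shows "e \<in> carrier sq" "a \<in> carrier A \<Longrightarrow> e \<triangleleft>\<^bsub>sq\<^esub> a = a \<triangleright>\<^bsub>sq\<^esub> e" "e \<in> invariants B \<iota> sq"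
  using assms by (auto simp: casimir_def invariants_def)

lemma centralizerD:
  assumes "r \<in> invariants B \<iota> rg"
  shows "r \<in> carrier A" "b \<in> carrier B \<Longrightarrow> r \<otimes>\<^bsub>A\<^esub> \<iota> b = \<iota> b \<otimes>\<^bsub>A\<^esub> r"
  using assms by (auto simp: invariants_def)

lemma smult_casimir_hom:
  assumes e: "e \<in> casimir"
  shows "(\<lambda>a. a \<triangleright>\<^bsub>sq\<^esub> e) \<in> bimodule_hom A A rg sq"
  by (rule bimodule_homI)
    (simp_all add: casimirD[OF e] sq.lsmult_closed sq.lsmult_add_left sq.lsmult_assoc sq.smult_commute)

lemma smult_casimir_invariant:
  "\<lbrakk>r \<in> invariants B \<iota> rg; e \<in> casimir\<rbrakk> \<Longrightarrow> r \<triangleright>\<^bsub>sq\<^esub> e \<in> invariants B \<iota> sq"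
  using invariants_hom[OF smult_casimir_hom] .

text \<open>The map \<open>theta sq (r e)\<close> factors through \<open>A\<close>, as
  \<open>theta rg r\<close> followed by \<open>a \<mapsto> a e\<close>, since both send
  \<open>u\<close> to \<open>r e\<close>. In \<open>T\<close> this reads
  \<open>(r e) t = (r \<cdot> t) e\<close>, so \<open>r \<mapsto> r e\<close> is a
  \<open>T\<close>-linear map from \<open>R\<close> to \<open>T\<close>.\<close>

lemma theta_smult_casimir:
  assumes r: "r \<in> invariants B \<iota> rg" and e: "e \<in> casimir" and z: "z \<in> carrier sq"
  shows "theta sq (r \<triangleright>\<^bsub>sq\<^esub> e) z = theta rg r z \<triangleright>\<^bsub>sq\<^esub> e"
  using theta_unique[OF sqm bimodule_hom_compose[OF theta_hom[OF rgm r] smult_casimir_hom[OF e]] z]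
  by (simp add: theta_u[OF rgm r])

section \<open>The right ideal of \<open>T\<close> spanned by the products
  \<open>r e\<close>\<close>

definition casimir_sum :: "nat \<Rightarrow> (nat \<Rightarrow> 'a) \<Rightarrow> (nat \<Rightarrow> ('a \<times> 'a \<Rightarrow>\<^sub>0 int) set) \<Rightarrow> ('a \<times> 'a \<Rightarrow>\<^sub>0 int) set"
  where "casimir_sum n r e = (\<Oplus>\<^bsub>sq\<^esub>i\<in>{..<n}. r i \<triangleright>\<^bsub>sq\<^esub> e i)"

text \<open>These are the elements of \<open>T\<close> whose action on
  \<open>A \<otimes>\<^sub>B A\<close> factors through a finite power of \<open>A\<close>. The
  families are constrained at every index, not only below \<open>n\<close>, so that sums of any
  length formed from them stay in the span.\<close>

definition casimir_span :: "('a \<times> 'a \<Rightarrow>\<^sub>0 int) set set"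
  where "casimir_span = {casimir_sum n r e | n r e.
    (\<forall>i. r i \<in> invariants B \<iota> rg) \<and> (\<forall>i. e i \<in> casimir)}"

lemma bimodule_hom_casimir_sum:
  assumes e: "\<And>i. i < n \<Longrightarrow> e i \<in> casimir"
  shows "(\<lambda>x. \<Oplus>\<^bsub>sq\<^esub>i\<in>{..<n}. x i \<triangleright>\<^bsub>sq\<^esub> e i) \<in> bimodule_hom A A (bimodule_power n rg) sq"
proof (rule bimodule_homI)
  note ab = sq.M.abelian_group_axioms
  have cl: "(\<lambda>i. x i \<triangleright>\<^bsub>sq\<^esub> e i) \<in> {..<n} \<rightarrow> carrier sq" if "x \<in> carrier (bimodule_power n rg)" for x
    using that e casimirD(1) by (auto simp: bimodule_power_simps intro!: sq.lsmult_closed)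
  fix x assume x: "x \<in> carrier (bimodule_power n rg)"
  then have xi: "\<And>i. i < n \<Longrightarrow> x i \<in> carrier A" by (simp add: bimodule_power_simps)
  show "(\<Oplus>\<^bsub>sq\<^esub>i\<in>{..<n}. x i \<triangleright>\<^bsub>sq\<^esub> e i) \<in> carrier sq" by (rule sq.M.finsum_closed[OF cl[OF x]])
  { fix y assume y: "y \<in> carrier (bimodule_power n rg)"
    have "(\<Oplus>\<^bsub>sq\<^esub>i\<in>{..<n}. (x \<oplus>\<^bsub>bimodule_power n rg\<^esub> y) i \<triangleright>\<^bsub>sq\<^esub> e i)
        = (\<Oplus>\<^bsub>sq\<^esub>i\<in>{..<n}. x i \<triangleright>\<^bsub>sq\<^esub> e i \<oplus>\<^bsub>sq\<^esub> y i \<triangleright>\<^bsub>sq\<^esub> e i)"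
      using cl[OF x] cl[OF y] x y e casimirD(1)
      by (intro sq.M.finsum_cong') (auto simp: bimodule_power_simps sq.lsmult_add_left)
    then show "(\<Oplus>\<^bsub>sq\<^esub>i\<in>{..<n}. (x \<oplus>\<^bsub>bimodule_power n rg\<^esub> y) i \<triangleright>\<^bsub>sq\<^esub> e i)
        = (\<Oplus>\<^bsub>sq\<^esub>i\<in>{..<n}. x i \<triangleright>\<^bsub>sq\<^esub> e i) \<oplus>\<^bsub>sq\<^esub> (\<Oplus>\<^bsub>sq\<^esub>i\<in>{..<n}. y i \<triangleright>\<^bsub>sq\<^esub> e i)"
      by (simp add: sq.M.finsum_addf[OF cl[OF x] cl[OF y]]) }
  fix c assume c: "c \<in> carrier A"
  have "c \<triangleright>\<^bsub>sq\<^esub> (\<Oplus>\<^bsub>sq\<^esub>i\<in>{..<n}. x i \<triangleright>\<^bsub>sq\<^esub> e i) = (\<Oplus>\<^bsub>sq\<^esub>i\<in>{..<n}. c \<triangleright>\<^bsub>sq\<^esub> x i \<triangleright>\<^bsub>sq\<^esub> e i)"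
    by (rule additive_hom_finsum[OF ab ab sq.lsmult_hom[OF c] cl[OF x]])
  also have "\<dots> = (\<Oplus>\<^bsub>sq\<^esub>i\<in>{..<n}. (c \<triangleright>\<^bsub>bimodule_power n rg\<^esub> x) i \<triangleright>\<^bsub>sq\<^esub> e i)"
    using c xi e casimirD(1)
    by (intro sq.M.finsum_cong') (auto simp: bimodule_power_simps sq.lsmult_assoc sq.lsmult_closed)
  finally show "(\<Oplus>\<^bsub>sq\<^esub>i\<in>{..<n}. (c \<triangleright>\<^bsub>bimodule_power n rg\<^esub> x) i \<triangleright>\<^bsub>sq\<^esub> e i)
      = c \<triangleright>\<^bsub>sq\<^esub> (\<Oplus>\<^bsub>sq\<^esub>i\<in>{..<n}. x i \<triangleright>\<^bsub>sq\<^esub> e i)" by simp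
  \<comment> \<open>The factor \<open>c\<close> passes from the right of \<open>e i\<close> to its
    left because \<open>e i\<close> is a Casimir element.\<close>
  have "(\<Oplus>\<^bsub>sq\<^esub>i\<in>{..<n}. x i \<triangleright>\<^bsub>sq\<^esub> e i) \<triangleleft>\<^bsub>sq\<^esub> c = (\<Oplus>\<^bsub>sq\<^esub>i\<in>{..<n}. (x i \<triangleright>\<^bsub>sq\<^esub> e i) \<triangleleft>\<^bsub>sq\<^esub> c)"
    by (rule additive_hom_finsum[OF ab ab sq.rsmult_hom[OF c] cl[OF x]])
  also have "\<dots> = (\<Oplus>\<^bsub>sq\<^esub>i\<in>{..<n}. (x \<triangleleft>\<^bsub>bimodule_power n rg\<^esub> c) i \<triangleright>\<^bsub>sq\<^esub> e i)"
    using c xi e casimirD(1,2)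
    by (intro sq.M.finsum_cong') (auto simp: bimodule_power_simps sq.lsmult_assoc sq.lsmult_closed sq.smult_commute)
  finally show "(\<Oplus>\<^bsub>sq\<^esub>i\<in>{..<n}. (x \<triangleleft>\<^bsub>bimodule_power n rg\<^esub> c) i \<triangleright>\<^bsub>sq\<^esub> e i)
      = (\<Oplus>\<^bsub>sq\<^esub>i\<in>{..<n}. x i \<triangleright>\<^bsub>sq\<^esub> e i) \<triangleleft>\<^bsub>sq\<^esub> c" by simp
qed

lemma casimir_sum_Suc:
  assumes "\<And>i. r i \<in> invariants B \<iota> rg" "\<And>i. e i \<in> casimir"
  shows "casimir_sum (Suc n) r e = r n \<triangleright>\<^bsub>sq\<^esub> e n \<oplus>\<^bsub>sq\<^esub> casimir_sum n r e"
proof -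
  have "r i \<triangleright>\<^bsub>sq\<^esub> e i \<in> carrier sq" for i
    using assms[of i] centralizerD casimirD by (auto intro: sq.lsmult_closed)
  then show ?thesis unfolding casimir_sum_def lessThan_Suc by (subst sq.M.finsum_insert) auto
qed

lemma zero_casimir: "\<zero>\<^bsub>sq\<^esub> \<in> casimir"
  by (simp add: casimir_def sq.lsmult_zero_right sq.rsmult_zero_left)

lemma smult_casimir_in_span:
  assumes "r \<in> invariants B \<iota> rg" "e \<in> casimir"
  shows "r \<triangleright>\<^bsub>sq\<^esub> e \<in> casimir_span"
proof -
  have "casimir_sum (Suc 0) (\<lambda>_. r) (\<lambda>_. e) = r \<triangleright>\<^bsub>sq\<^esub> e"
    using assms centralizerD(1) casimirD(1)
    by (subst casimir_sum_Suc) (simp_all add: casimir_sum_def sq.lsmult_closed)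
  with assms show ?thesis unfolding casimir_span_def by blast
qed

lemma casimir_span_add_smult:
  assumes x: "x \<in> casimir_span" and r: "r \<in> invariants B \<iota> rg" and e: "e \<in> casimir"
  shows "r \<triangleright>\<^bsub>sq\<^esub> e \<oplus>\<^bsub>sq\<^esub> x \<in> casimir_span"
proof -
  obtain n r' e' where x: "x = casimir_sum n r' e'" and r': "\<And>i. r' i \<in> invariants B \<iota> rg"
    and e': "\<And>i. e' i \<in> casimir"
    using x unfolding casimir_span_def by blast
  \<comment> \<open>Overwriting position \<open>n\<close> does not affect the sum over
    \<open>{..<n}\<close>, so the new product can be appended as the term with index
    \<open>n\<close>.\<close>
  have "casimir_sum n (r'(n := r)) (e'(n := e)) = casimir_sum n r' e'"
    unfolding casimir_sum_def using r' e' centralizerD(1) casimirD(1)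
    by (intro sq.M.finsum_cong') (auto simp: sq.lsmult_closed)
  then have "r \<triangleright>\<^bsub>sq\<^esub> e \<oplus>\<^bsub>sq\<^esub> x = casimir_sum (Suc n) (r'(n := r)) (e'(n := e))"
    using r e r' e' by (subst casimir_sum_Suc) (auto simp: x)
  moreover have "\<forall>i. (r'(n := r)) i \<in> invariants B \<iota> rg" "\<forall>i. (e'(n := e)) i \<in> casimir"
    using r e r' e' by auto
  ultimately show ?thesis unfolding casimir_span_def by blast
qed

text \<open>Allows closure properties of the span to be proved one product at a time, without
  reindexing sums.\<close>

lemma casimir_span_induct [consumes 1, case_names zero smult]:
  assumes "x \<in> casimir_span" and z: "P \<zero>\<^bsub>sq\<^esub>"
    and step: "\<And>r e y. \<lbrakk>r \<in> invariants B \<iota> rg; e \<in> casimir; y \<in> casimir_span; P y\<rbrakk> \<Longrightarrow>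
      P (r \<triangleright>\<^bsub>sq\<^esub> e \<oplus>\<^bsub>sq\<^esub> y)"
  shows "P x"
proof -
  obtain n r e where x: "x = casimir_sum n r e" and r: "\<And>i. r i \<in> invariants B \<iota> rg"
    and e: "\<And>i. e i \<in> casimir"
    using assms(1) unfolding casimir_span_def by blast
  have "P (casimir_sum k r e)" for k
  proof (induction k)
    case 0
    then show ?case using z by (simp add: casimir_sum_def)
  next
    case (Suc k)
    moreover have "casimir_sum k r e \<in> casimir_span" using r e unfolding casimir_span_def by blast
    ultimately show ?case unfolding casimir_sum_Suc[OF r e] using step r e by blast
  qed
  then show ?thesis by (simp add: x)
qed

lemma zero_casimir_span: "\<zero>\<^bsub>sq\<^esub> \<in> casimir_span"
  using smult_casimir_in_span[OF invariants_zero[OF rgm] zero_casimir] sq.lsmult_zero_right by simp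

lemma casimir_span_invariant: "x \<in> casimir_span \<Longrightarrow> x \<in> invariants B \<iota> sq"
  by (induction rule: casimir_span_induct)
    (simp_all add: invariants_zero[OF sqm] invariants_add[OF sqm] smult_casimir_invariant)

lemma casimir_span_add: "\<lbrakk>x \<in> casimir_span; y \<in> casimir_span\<rbrakk> \<Longrightarrow> x \<oplus>\<^bsub>sq\<^esub> y \<in> casimir_span"
proof (induction rule: casimir_span_induct)
  case zero
  then show ?case by (simp add: invariants_closed casimir_span_invariant)
next
  case (smult r e x)
  have "r \<triangleright>\<^bsub>sq\<^esub> e \<oplus>\<^bsub>sq\<^esub> x \<oplus>\<^bsub>sq\<^esub> y = r \<triangleright>\<^bsub>sq\<^esub> e \<oplus>\<^bsub>sq\<^esub> (x \<oplus>\<^bsub>sq\<^esub> y)"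
    using smult by (intro sq.M.a_assoc)
      (simp_all add: invariants_closed casimir_span_invariant smult_casimir_invariant)
  then show ?case using smult casimir_span_add_smult by simp
qed

text \<open>The reason is \<open>(r e) t = (r \<cdot> t) e\<close>, where \<open>r \<cdot> t\<close>
  is again in \<open>R\<close>.\<close>

lemma casimir_span_mult:
  "\<lbrakk>x \<in> casimir_span; t \<in> invariants B \<iota> sq\<rbrakk> \<Longrightarrow> theta sq x t \<in> casimir_span"
proof (induction rule: casimir_span_induct)
  case zero
  \<comment> \<open>Additivity at \<open>0 + 0\<close> forces \<open>0 \<cdot> t\<close> to be
    zero.\<close>
  have "theta sq (\<zero>\<^bsub>sq\<^esub> \<oplus>\<^bsub>sq\<^esub> \<zero>\<^bsub>sq\<^esub>) t = theta sq \<zero>\<^bsub>sq\<^esub> t \<oplus>\<^bsub>sq\<^esub> theta sq \<zero>\<^bsub>sq\<^esub> t"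
    using zero by (intro theta_add[OF sqm] invariants_zero[OF sqm]) (simp add: invariants_closed)
  moreover have "theta sq \<zero>\<^bsub>sq\<^esub> t \<in> carrier sq"
    using zero by (intro theta_closed[OF sqm] invariants_zero[OF sqm]) (simp add: invariants_closed)
  ultimately show ?case using zero_casimir_span by simp
next
  case (smult r e x)
  then have "theta sq (r \<triangleright>\<^bsub>sq\<^esub> e \<oplus>\<^bsub>sq\<^esub> x) t = theta rg r t \<triangleright>\<^bsub>sq\<^esub> e \<oplus>\<^bsub>sq\<^esub> theta sq x t"
    by (simp add: theta_add[OF sqm] theta_smult_casimir smult_casimir_invariant casimir_span_invariant
        invariants_closed)
  then show ?case using smult casimir_span_add_smult theta_invariant[OF rgm] by simp
qed

text \<open>In \<open>T\<close> one has \<open>- x = x (- 1)\<close>, so closure under right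
  multiplication suffices.\<close>

lemma casimir_span_minus: "x \<in> casimir_span \<Longrightarrow> \<ominus>\<^bsub>sq\<^esub> x \<in> casimir_span"
proof -
  assume x: "x \<in> casimir_span"
  have xc: "x \<in> invariants B \<iota> sq" by (rule casimir_span_invariant[OF x])
  have um: "\<ominus>\<^bsub>sq\<^esub> u \<in> invariants B \<iota> sq" by (rule invariants_minus[OF sqm u_invariant])
  have "theta sq x (\<ominus>\<^bsub>sq\<^esub> u) = \<ominus>\<^bsub>sq\<^esub> theta sq x u"
    by (rule additive_hom_minus[OF sq.M.abelian_group_axioms sq.M.abelian_group_axioms
          bimodule_homD(1)[OF theta_hom[OF sqm xc]] u_closed])
  then show "\<ominus>\<^bsub>sq\<^esub> x \<in> casimir_span"
    using casimir_span_mult[OF x um] by (simp add: theta_u[OF sqm xc])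
qed

lemma casimir_span_ideal: "additive_subgroup casimir_span T"
proof (rule additive_subgroup.intro)
  show "subgroup casimir_span (add_monoid T)"
  proof (rule RT.S.add.subgroupI)
    show "casimir_span \<noteq> {}" using zero_casimir_span by blast
    fix x assume x: "x \<in> casimir_span"
    have "x \<in> invariants B \<iota> sq" "\<ominus>\<^bsub>sq\<^esub> x \<in> invariants B \<iota> sq" "\<ominus>\<^bsub>sq\<^esub> x \<oplus>\<^bsub>sq\<^esub> x = \<zero>\<^bsub>sq\<^esub>"
      using x by (simp_all add: casimir_span_invariant casimir_span_minus invariants_closed sq.M.l_neg)
    then have "\<ominus>\<^bsub>T\<^esub> x = \<ominus>\<^bsub>sq\<^esub> x" by (intro RT.S.minus_equality) simp_all
    then show "\<ominus>\<^bsub>T\<^esub> x \<in> casimir_span" by (simp add: casimir_span_minus x)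
  qed (simp_all add: subsetI casimir_span_invariant casimir_span_add)
qed

text \<open>A splitting \<open>g f = id\<close> through a power of \<open>A\<close> is determined at
  \<open>u\<close>. Given \<open>f\<close> and \<open>g\<close>, the coordinates of
  \<open>f u\<close> lie in \<open>R\<close> and \<open>g\<close> maps the unit vectors to Casimir
  elements, which turns \<open>u = g (f u)\<close> into the required sum. Conversely, the
  \<open>r i\<close> define \<open>f\<close>, the \<open>e i\<close> define \<open>g\<close>, and
  \<open>g f\<close> fixes \<open>u\<close>.\<close>

lemma H_separable_iff: "H_separable A B \<iota> \<longleftrightarrow> u \<in> casimir_span"
proof
  assume "H_separable A B \<iota>"
  then obtain n where n: "isomorphic_to_summand A A sq (bimodule_power n rg)"
    unfolding H_separable_def by blast
  let ?N = "bimodule_power n rg"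
  have N: "two_sided_module A A ?N" by (rule two_sided_module_power[OF rgm])
  obtain f g where f: "f \<in> bimodule_hom A A sq ?N" and g: "g \<in> bimodule_hom A A ?N sq"
    and gf: "\<And>x. x \<in> carrier sq \<Longrightarrow> g (f x) = x"
    using isomorphic_to_summandE[OF sqm N n] by blast
  note gD = bimodule_homD[OF g]
  define x where "x = f u"
  \<comment> \<open>The standard unit vectors. Their entries are \<open>0\<close> and
    \<open>1\<close>, so they commute with all of \<open>A\<close>, and so do their images under
    \<open>g\<close>.\<close>
  define d where "d i = (\<lambda>j\<in>{..<n}. if i = j then \<one>\<^bsub>A\<^esub> else \<zero>\<^bsub>A\<^esub>)" for i
  have x: "x \<in> invariants B \<iota> ?N" unfolding x_def by (rule invariants_hom[OF f u_invariant])
  then have xc: "x \<in> carrier ?N" by (rule invariants_closed)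
  have xi: "x i \<in> invariants B \<iota> rg" if i: "i < n" for i
  proof -
    have "\<iota> b \<otimes>\<^bsub>A\<^esub> x i = x i \<otimes>\<^bsub>A\<^esub> \<iota> b" if "b \<in> carrier B" for b
    proof -
      have "\<iota> b \<triangleright>\<^bsub>?N\<^esub> x = x \<triangleleft>\<^bsub>?N\<^esub> \<iota> b" using x that by (simp add: invariants_def)
      from fun_cong[OF this, of i] i show ?thesis by (simp add: bimodule_power_simps)
    qed
    then show ?thesis using xc i by (simp add: invariants_def bimodule_power_simps)
  qed
  have xA: "x i \<in> carrier A" if "i < n" for i using xi[OF that] by (rule centralizerD)
  have dc: "d i \<in> carrier ?N" for i by (simp add: d_def bimodule_power_simps)
  have "g (d i) \<in> casimir" for i
  proof -
    have "a \<triangleright>\<^bsub>?N\<^esub> d i = d i \<triangleleft>\<^bsub>?N\<^esub> a" if "a \<in> carrier A" for a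
      using that by (auto simp: d_def bimodule_power_simps intro!: restrict_ext)
    then show ?thesis using dc by (simp add: casimir_def gD(2) flip: gD(4,5))
  qed
  moreover have "u = (\<Oplus>\<^bsub>sq\<^esub>i\<in>{..<n}. x i \<triangleright>\<^bsub>sq\<^esub> g (d i))"
  proof -
    let ?d = "\<lambda>i. (\<lambda>j\<in>{..<n}. if i = j then x i else \<zero>\<^bsub>A\<^esub>)"
    have xd: "?d i = x i \<triangleright>\<^bsub>?N\<^esub> d i" if "i < n" for i
      using xA[OF that] by (auto simp: d_def bimodule_power_simps intro!: restrict_ext)
    have dN: "?d \<in> {..<n} \<rightarrow> carrier ?N" using xA by (auto simp: bimodule_power_simps)
    interpret N: two_sided_module A A ?N by (rule N)
    have "u = g (finsum ?N ?d {..<n})"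
      using bimodule_power_unit_decomposition[OF A.ring_axioms xc] gf[OF u_closed] by (simp add: x_def)
    also have "\<dots> = (\<Oplus>\<^bsub>sq\<^esub>i\<in>{..<n}. g (?d i))"
      by (rule additive_hom_finsum[OF N.M.abelian_group_axioms sq.M.abelian_group_axioms gD(1) dN])
    also have "\<dots> = (\<Oplus>\<^bsub>sq\<^esub>i\<in>{..<n}. x i \<triangleright>\<^bsub>sq\<^esub> g (d i))"
      using xd xA dc by (intro sq.M.finsum_cong') (auto simp: gD(2,4) sq.lsmult_closed)
    finally show ?thesis .
  qed
  \<comment> \<open>From index \<open>n\<close> on, \<open>x\<close> is undefined. The default zero
    puts the whole family into \<open>R\<close>, as \<open>casimir_span\<close> demands.\<close>
  moreover have "(\<Oplus>\<^bsub>sq\<^esub>i\<in>{..<n}. x i \<triangleright>\<^bsub>sq\<^esub> g (d i))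
      = casimir_sum n (\<lambda>i. if i < n then x i else \<zero>\<^bsub>A\<^esub>) (\<lambda>i. g (d i))"
    unfolding casimir_sum_def using xA dc by (intro sq.M.finsum_cong') (auto simp: gD(2) sq.lsmult_closed)
  ultimately show "u \<in> casimir_span"
    using xi invariants_zero[OF rgm] unfolding casimir_span_def
    by (intro CollectI exI[of _ n] exI[of _ "\<lambda>i. if i < n then x i else \<zero>\<^bsub>A\<^esub>"] exI[of _ "\<lambda>i. g (d i)"]) auto
next
  assume "u \<in> casimir_span"
  moreover have "\<zero>\<^bsub>A\<^esub> \<triangleright>\<^bsub>sq\<^esub> \<zero>\<^bsub>sq\<^esub> \<oplus>\<^bsub>sq\<^esub> u = u" by (simp add: sq.lsmult_zero_left)
  ultimately obtain n r e where ur: "u = casimir_sum n r e" and r: "\<And>i. r i \<in> invariants B \<iota> rg"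
    and e: "\<And>i. e i \<in> casimir"
    unfolding casimir_span_def by blast
  \<comment> \<open>The exponent of the power has to be positive while \<open>n\<close> may be
    \<open>0\<close>; a vanishing term with index \<open>n\<close> is appended to reach
    \<open>Suc n\<close>.\<close>
  define r' where "r' = r(n := \<zero>\<^bsub>A\<^esub>)"
  have r': "\<And>i. r' i \<in> invariants B \<iota> rg" using r invariants_zero[OF rgm] by (simp add: r'_def)
  have r'_n: "r' n = \<zero>\<^bsub>A\<^esub>" by (simp add: r'_def)
  have "casimir_sum (Suc n) r' e = casimir_sum n r' e"
    unfolding casimir_sum_Suc[OF r' e] using r' e centralizerD(1) casimirD(1)
    by (simp add: r'_n sq.lsmult_zero_left casimir_sum_def sq.lsmult_closed)
  also have "\<dots> = casimir_sum n r e"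
    unfolding casimir_sum_def using r e centralizerD(1) casimirD(1)
    by (intro sq.M.finsum_cong') (auto simp: r'_def sq.lsmult_closed)
  finally have u: "casimir_sum (Suc n) r' e = u" using ur by simp
  let ?N = "bimodule_power (Suc n) rg"
  have N: "two_sided_module A A ?N" by (rule two_sided_module_power[OF rgm])
  let ?f = "\<lambda>z. \<lambda>i\<in>{..<Suc n}. theta rg (r' i) z"
  let ?g = "\<lambda>x. \<Oplus>\<^bsub>sq\<^esub>i\<in>{..<Suc n}. x i \<triangleright>\<^bsub>sq\<^esub> e i"
  note th = bimodule_homD[OF theta_hom[OF rgm r'], simplified]
  have f: "?f \<in> bimodule_hom A A sq ?N"
    by (rule bimodule_homI) (auto simp: bimodule_power_simps th intro!: restrict_ext)
  have g: "?g \<in> bimodule_hom A A ?N sq" by (rule bimodule_hom_casimir_sum) (rule e)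
  have "?g (?f u) = casimir_sum (Suc n) r' e"
    unfolding casimir_sum_def using r' e centralizerD(1) casimirD(1)
    by (intro sq.M.finsum_cong') (auto simp: theta_u[OF rgm] sq.lsmult_closed)
  then have gfu: "?g (?f u) = u" using u by simp
  \<comment> \<open>The composite and the identity are bimodule maps that agree at
    \<open>u\<close>.\<close>
  have gf: "?g (?f z) = z" if "z \<in> carrier sq" for z
    using theta_unique[OF sqm bimodule_hom_compose[OF f g] that] by (simp only: gfu theta_sq_u[OF that])
  have "isomorphic_to_summand A A sq ?N"
    by (rule isomorphic_to_summandI[OF sqm N f g]) (rule gf)
  then show "H_separable A B \<iota>"
    unfolding H_separable_def by blast
qed

section \<open>The generator property and the evaluation isomorphism\<close>


text \<open>For \<open>m\<close> in \<open>M\<close> and a Casimir element \<open>e\<close>, the map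
  \<open>r \<mapsto> m (r e)\<close> is a homomorphism from \<open>R\<close> to \<open>M\<close>;
  its linearity is \<open>theta_smult_casimir\<close>. If \<open>f\<close> and \<open>g\<close>
  agree after all of these, they agree on \<open>m t\<close> for every \<open>t\<close> in the span,
  and \<open>t = u\<close> gives \<open>f m = g m\<close>.\<close>

lemma generator_of_span:
  assumes "u \<in> casimir_span"
  shows "generator T R"
  unfolding generator_def generator_in_def
proof (intro conjI allI impI ballI right_module_R)
  fix M N :: "(('a \<times> 'a \<Rightarrow>\<^sub>0 int) set, ('a \<times> 'a \<Rightarrow>\<^sub>0 int) set set) rmodule" and f g
  assume M: "right_module T M" and N: "right_module T N"
    and f: "f \<in> rmodule_hom T M N" and g: "g \<in> rmodule_hom T M N" and "\<exists>x\<in>carrier M. f x \<noteq> g x"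
  then obtain m where m: "m \<in> carrier M" and ne: "f m \<noteq> g m" by blast
  interpret M: right_module T M by (rule M)
  show "\<exists>h\<in>rmodule_hom T R M. \<exists>x\<in>carrier R. f (h x) \<noteq> g (h x)"
  proof (rule ccontr)
    assume "\<not> ?thesis"
    then have eq: "f (h x) = g (h x)" if "h \<in> rmodule_hom T R M" "x \<in> invariants B \<iota> rg" for h x
      using that by auto
    have add: "k (x \<oplus>\<^bsub>M\<^esub> y) = k x \<oplus>\<^bsub>N\<^esub> k y" if "k \<in> rmodule_hom T M N" "x \<in> carrier M" "y \<in> carrier M" for k x y
      using that by (simp add: rmodule_hom_def hom_def)
    have act: "m \<triangleleft>\<^bsub>M\<^esub> t \<in> carrier M" if "t \<in> invariants B \<iota> sq" for t
      using M.rsmult_closed[OF m, of t] that by simp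
    have act_add: "m \<triangleleft>\<^bsub>M\<^esub> (t \<oplus>\<^bsub>sq\<^esub> t') = m \<triangleleft>\<^bsub>M\<^esub> t \<oplus>\<^bsub>M\<^esub> m \<triangleleft>\<^bsub>M\<^esub> t'"
      if "t \<in> invariants B \<iota> sq" "t' \<in> invariants B \<iota> sq" for t t'
      using M.rsmult_add_right[OF m, of t t'] that by simp
    have "f (m \<triangleleft>\<^bsub>M\<^esub> t) = g (m \<triangleleft>\<^bsub>M\<^esub> t)" if "t \<in> casimir_span" for t
      using that
    proof (induction rule: casimir_span_induct)
      case zero
      interpret N: right_module T N by (rule N)
      have m0: "m \<triangleleft>\<^bsub>M\<^esub> \<zero>\<^bsub>sq\<^esub> = \<zero>\<^bsub>M\<^esub>" using M.rsmult_zero_right[OF m] by simp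
      have k0: "k \<zero>\<^bsub>M\<^esub> = \<zero>\<^bsub>N\<^esub>" if "k \<in> rmodule_hom T M N" for k
        using that by (intro additive_hom_zero[OF M.M.abelian_group_axioms N.M.abelian_group_axioms])
          (simp add: rmodule_hom_def)
      show ?case by (simp only: m0 k0[OF f] k0[OF g])
    next
      case (smult r e t)
      have re: "r' \<triangleright>\<^bsub>sq\<^esub> e \<in> invariants B \<iota> sq" if "r' \<in> invariants B \<iota> rg" for r'
        using smult_casimir_invariant that smult by blast
      have "(\<lambda>r. m \<triangleleft>\<^bsub>M\<^esub> (r \<triangleright>\<^bsub>sq\<^esub> e)) \<in> rmodule_hom T R M"
        unfolding rmodule_hom_def hom_def
      proof (intro CollectI conjI ballI)
        show "(\<lambda>r. m \<triangleleft>\<^bsub>M\<^esub> (r \<triangleright>\<^bsub>sq\<^esub> e)) \<in> carrier (add_monoid R) \<rightarrow> carrier (add_monoid M)"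
          using re act by simp
      next
        fix r1 r2 assume "r1 \<in> carrier (add_monoid R)" "r2 \<in> carrier (add_monoid R)"
        then show "m \<triangleleft>\<^bsub>M\<^esub> ((r1 \<otimes>\<^bsub>add_monoid R\<^esub> r2) \<triangleright>\<^bsub>sq\<^esub> e)
            = (m \<triangleleft>\<^bsub>M\<^esub> (r1 \<triangleright>\<^bsub>sq\<^esub> e)) \<otimes>\<^bsub>add_monoid M\<^esub> (m \<triangleleft>\<^bsub>M\<^esub> (r2 \<triangleright>\<^bsub>sq\<^esub> e))"
          using smult re by (simp add: sq.lsmult_add_left centralizerD(1) casimirD(1) act_add)
      next
        fix r1 s assume r1: "r1 \<in> carrier R" and s: "s \<in> carrier T"
        then have "(m \<triangleleft>\<^bsub>M\<^esub> (r1 \<triangleright>\<^bsub>sq\<^esub> e)) \<triangleleft>\<^bsub>M\<^esub> s = m \<triangleleft>\<^bsub>M\<^esub> ((r1 \<triangleright>\<^bsub>sq\<^esub> e) \<otimes>\<^bsub>T\<^esub> s)"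
          using M.rsmult_assoc[OF m, of "r1 \<triangleright>\<^bsub>sq\<^esub> e" s] re by simp
        then show "m \<triangleleft>\<^bsub>M\<^esub> ((r1 \<triangleleft>\<^bsub>R\<^esub> s) \<triangleright>\<^bsub>sq\<^esub> e) = (m \<triangleleft>\<^bsub>M\<^esub> (r1 \<triangleright>\<^bsub>sq\<^esub> e)) \<triangleleft>\<^bsub>M\<^esub> s"
          using r1 s smult re by (simp add: invariants_closed theta_smult_casimir)
      qed
      from eq[OF this smult(1)] smult re show ?case
        by (simp add: act_add casimir_span_invariant add[OF f] add[OF g] act)
    qed
    from this[OF assms] show False using ne M.rsmult_one[OF m] by simp
  qed
qed

text \<open>By \<open>generator_right_ideal\<close> the span only has to contain every value of
  every \<open>T\<close>-linear map \<open>h\<close> from \<open>R\<close> to \<open>T\<close>. The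
  isomorphism, which may be different from evaluation, converts the pairing with \<open>h\<close>
  into a bimodule map from \<open>A\<close> to \<open>A \<otimes>\<^sub>B A\<close>.\<close>

lemma span_of_generator:
  assumes G: "generator T R" and iso: "bimodule_isomorphic A A W rg"
  shows "u \<in> casimir_span"
proof -
  obtain \<Phi> where iso: "\<Phi> \<in> bimodule_iso A A W rg" using iso unfolding bimodule_isomorphic_def by blast
  then have \<Phi>: "\<Phi> \<in> bimodule_hom A A W rg" by (auto simp: bimodule_iso_def bimodule_hom_def iso_def)
  obtain \<Psi> where \<Psi>: "\<Psi> \<in> bimodule_hom A A rg W" and \<Psi>\<Phi>: "\<And>x. x \<in> carrier W \<Longrightarrow> \<Psi> (\<Phi> x) = x"
    using bimodule_iso_inverse[OF W.two_sided_module_axioms iso] by blast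
  have "\<one>\<^bsub>T\<^esub> \<in> casimir_span"
  proof (rule generator_right_ideal[OF G casimir_span_ideal])
    fix x s assume "x \<in> casimir_span" "s \<in> carrier T"
    then show "x \<otimes>\<^bsub>T\<^esub> s \<in> casimir_span"
      by (simp add: casimir_span_mult casimir_span_invariant invariants_closed)
  next
    fix h r assume h: "h \<in> hom (add_monoid R) (add_monoid T)"
      and hact: "\<And>x s. \<lbrakk>x \<in> carrier R; s \<in> carrier T\<rbrakk> \<Longrightarrow> h (x \<triangleleft>\<^bsub>R\<^esub> s) = h x \<otimes>\<^bsub>T\<^esub> s"
      and r: "r \<in> carrier R"
    have hc: "h r \<in> invariants B \<iota> sq" if "r \<in> invariants B \<iota> rg" for r
      using hom_in_carrier[OF h] that by simp
    have hadd: "h (r \<oplus>\<^bsub>A\<^esub> r') = h r \<oplus>\<^bsub>sq\<^esub> h r'" if "r \<in> invariants B \<iota> rg" "r' \<in> invariants B \<iota> rg" for r r'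
      using hom_mult[OF h] that by simp
    have ht: "h (theta rg r t) = theta sq (h r) t" if "r \<in> invariants B \<iota> rg" "t \<in> invariants B \<iota> sq" for r t
      using hact[of r t] that hc by (simp add: invariants_closed)
    note Gh = pairing_hom[where h = h, OF sqm hc hadd ht] pairing_pR[where h = h, OF sqm hc hadd ht]
    define k where "k a = pairing sq h (\<Psi> a)" for a
    have k: "k \<in> bimodule_hom A A rg sq"
      unfolding k_def by (rule bimodule_hom_compose[OF \<Psi> Gh(1)])
    \<comment> \<open>A bimodule map on \<open>A\<close> is multiplication by its value at
      \<open>1\<close>, from either side; comparing the two sides shows that this value is a Casimir
      element.\<close>
    have ka: "k a = a \<triangleright>\<^bsub>sq\<^esub> k \<one>\<^bsub>A\<^esub>" "k a = k \<one>\<^bsub>A\<^esub> \<triangleleft>\<^bsub>sq\<^esub> a" if "a \<in> carrier A" for a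
      using bimodule_homD(4,5)[OF k, of "\<one>\<^bsub>A\<^esub>" a] that by simp_all
    have cas: "k \<one>\<^bsub>A\<^esub> \<in> casimir"
      unfolding casimir_def using bimodule_homD(2)[OF k, of "\<one>\<^bsub>A\<^esub>"] trans[OF ka(1)[symmetric] ka(2)] by simp
    have rT: "r \<in> invariants B \<iota> rg" using r by simp
    \<comment> \<open>Invariance of \<open>r \<otimes>\<^sub>T u\<close> places the coefficient
      \<open>\<Phi> (r \<otimes>\<^sub>T u)\<close> in \<open>R\<close>.\<close>
    have "\<iota> b \<triangleright>\<^bsub>W\<^esub> (r \<otimes>\<^sub>T u) = (r \<otimes>\<^sub>T u) \<triangleleft>\<^bsub>W\<^esub> \<iota> b" if "b \<in> carrier B" for b
      using u_invariant that rT by (simp add: lsmult_pR rsmult_pR invariants_def)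
    then have "r \<otimes>\<^sub>T u \<in> invariants B \<iota> W" using rT by (simp add: invariants_def)
    then have c: "\<Phi> (r \<otimes>\<^sub>T u) \<in> invariants B \<iota> rg" by (rule invariants_hom[OF \<Phi>])
    \<comment> \<open>The isomorphism cancels, and the pairing sends
      \<open>r \<otimes>\<^sub>T u\<close> to \<open>h(r) \<cdot> u = h r\<close>.\<close>
    have "h r = k (\<Phi> (r \<otimes>\<^sub>T u))"
      using rT by (simp add: k_def \<Psi>\<Phi> Gh(2) theta_u[OF sqm hc])
    also have "\<dots> = \<Phi> (r \<otimes>\<^sub>T u) \<triangleright>\<^bsub>sq\<^esub> k \<one>\<^bsub>A\<^esub>" using ka(1) centralizerD(1)[OF c] .
    finally show "h r \<in> casimir_span" using smult_casimir_in_span[OF c cas] by simp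
  qed
  then show ?thesis by simp
qed

section \<open>The evaluation map and the annihilator of its kernel\<close>

abbreviation "ev \<equiv> pairing rg (\<lambda>r. r)"

lemma ev_hom: "ev \<in> bimodule_hom A A W rg"
  by (rule pairing_hom[OF rgm]) simp_all

lemma ev_pR: "\<lbrakk>r \<in> invariants B \<iota> rg; x \<in> carrier sq\<rbrakk> \<Longrightarrow> ev (r \<otimes>\<^sub>T x) = theta rg r x"
  by (rule pairing_pR[OF rgm]) simp_all

text \<open>Bimodule maps preserve the Casimir condition, and in \<open>A\<close> this condition
  means centrality.\<close>

lemma theta_casimir_central:
  "\<lbrakk>r \<in> invariants B \<iota> rg; e \<in> casimir; a \<in> carrier A\<rbrakk> \<Longrightarrow> theta rg r e \<otimes>\<^bsub>A\<^esub> a = a \<otimes>\<^bsub>A\<^esub> theta rg r e"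
  using bimodule_homD(4,5)[OF theta_hom[OF rgm], of r e a] by (simp add: casimirD(1,2))

text \<open>Multiplication by \<open>z = e\<^sup>1 r e\<^sup>2\<close> depends on \<open>x\<close>
  through \<open>ev x\<close> alone, so \<open>z\<close> annihilates the kernel of
  \<open>ev\<close>. On pure tensors, \<open>r \<otimes> ev(r' \<otimes> m) e = r \<otimes> (r' e)
  \<cdot> m = r \<cdot> (r' e) \<otimes> m = r' z \<otimes> m = z (r' \<otimes> m)\<close>.\<close>

lemma smult_ev:
  assumes r: "r \<in> invariants B \<iota> rg" and e: "e \<in> casimir" and x: "x \<in> carrier W"
  shows "theta rg r e \<triangleright>\<^bsub>W\<^esub> x = r \<otimes>\<^sub>T (ev x \<triangleright>\<^bsub>sq\<^esub> e)"
proof -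
  define z where "z = theta rg r e"
  have z: "z \<in> carrier A" using theta_closed[OF rgm r casimirD(1)[OF e]] by (simp add: z_def)
  have zc: "z \<otimes>\<^bsub>A\<^esub> a = a \<otimes>\<^bsub>A\<^esub> z" if "a \<in> carrier A" for a
    using theta_casimir_central[OF r e that] by (simp add: z_def)
  \<comment> \<open>Left multiplication by the central element \<open>z\<close> is a bimodule
    endomorphism of \<open>A \<otimes>\<^sub>B A\<close>, hence the action of \<open>z u\<close> in
    \<open>T\<close>. In this form \<open>z\<close> can cross the tensor sign over
    \<open>T\<close>.\<close>
  have zh: "(\<lambda>m. z \<triangleright>\<^bsub>sq\<^esub> m) \<in> bimodule_hom A A sq sq"
    using z zc by (intro bimodule_homI)
      (simp_all add: sq.lsmult_closed sq.lsmult_add_right sq.smult_commute flip: sq.lsmult_assoc)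
  have zu: "z \<triangleright>\<^bsub>sq\<^esub> u \<in> invariants B \<iota> sq" by (rule invariants_hom[OF zh u_invariant])
  have pure: "z \<triangleright>\<^bsub>W\<^esub> (r' \<otimes>\<^sub>T m) = r \<otimes>\<^sub>T (ev (r' \<otimes>\<^sub>T m) \<triangleright>\<^bsub>sq\<^esub> e)"
    if r': "r' \<in> invariants B \<iota> rg" and m: "m \<in> carrier sq" for r' m
  proof -
    have re: "r' \<triangleright>\<^bsub>sq\<^esub> e \<in> invariants B \<iota> sq" by (rule smult_casimir_invariant[OF r' e])
    have "r \<otimes>\<^sub>T (ev (r' \<otimes>\<^sub>T m) \<triangleright>\<^bsub>sq\<^esub> e) = r \<otimes>\<^sub>T theta sq (r' \<triangleright>\<^bsub>sq\<^esub> e) m"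
      by (simp add: ev_pR[OF r' m] theta_smult_casimir[OF r' e m])
    also have "\<dots> = theta rg r (r' \<triangleright>\<^bsub>sq\<^esub> e) \<otimes>\<^sub>T m" by (simp add: pR_swap[OF r re m])
    also have "theta rg r (r' \<triangleright>\<^bsub>sq\<^esub> e) = r' \<otimes>\<^bsub>A\<^esub> z"
      using bimodule_homD(4)[OF theta_hom[OF rgm r], of e r'] centralizerD(1)[OF r'] casimirD(1)[OF e]
      by (simp add: z_def)
    also have "\<dots> = theta rg r' (z \<triangleright>\<^bsub>sq\<^esub> u)"
      using bimodule_homD(4)[OF theta_hom[OF rgm r'] u_closed z] zc[OF centralizerD(1)[OF r']]
      by (simp add: theta_u[OF rgm r'])
    also have "\<dots> \<otimes>\<^sub>T m = r' \<otimes>\<^sub>T theta sq (z \<triangleright>\<^bsub>sq\<^esub> u) m" by (rule pR_swap[OF r' zu m])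
    also have "theta sq (z \<triangleright>\<^bsub>sq\<^esub> u) m = z \<triangleright>\<^bsub>sq\<^esub> m" by (rule theta_unique[OF sqm zh m])
    finally show ?thesis by (simp add: lsmult_pR[OF z r' m])
  qed
  have eh: "ev \<in> hom (add_monoid W) (add_monoid A)"
    using bimodule_homD(1)[OF ev_hom] by (simp add: hom_def)
  have rh: "(\<lambda>y. r \<otimes>\<^sub>T y) \<in> hom (add_monoid sq) (add_monoid W)"
    using r by (simp add: hom_def pR_add_right W_simps(3))
  show ?thesis
    unfolding z_def[symmetric]
    by (rule W_hom_eqI[OF W.M.abelian_group_axioms W.lsmult_hom[OF z]
          hom_add_compose[OF hom_add_compose[OF eh sq.lsmult_scalar_hom[OF casimirD(1)[OF e]]] rh] pure x])
qed

lemma iso_of_span: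
  assumes "u \<in> casimir_span"
  shows "bimodule_isomorphic A A W rg"
proof -
  note eD = bimodule_homD[OF ev_hom]
  have one: "\<one>\<^bsub>A\<^esub> \<in> invariants B \<iota> rg" by (simp add: invariants_def)
  \<comment> \<open>The central elements that annihilate the kernel of \<open>ev\<close>.
    Injectivity of \<open>ev\<close> follows once \<open>\<one>\<close> is among them.\<close>
  define K where "K = {z \<in> carrier A. (\<forall>a\<in>carrier A. z \<otimes>\<^bsub>A\<^esub> a = a \<otimes>\<^bsub>A\<^esub> z) \<and>
    (\<forall>x\<in>carrier W. ev x = \<zero>\<^bsub>A\<^esub> \<longrightarrow> z \<triangleright>\<^bsub>W\<^esub> x = \<zero>\<^bsub>W\<^esub>)}"
  have KI: "z \<in> K" if "z \<in> carrier A" "\<And>a. a \<in> carrier A \<Longrightarrow> z \<otimes>\<^bsub>A\<^esub> a = a \<otimes>\<^bsub>A\<^esub> z"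
    "\<And>x. \<lbrakk>x \<in> carrier W; ev x = \<zero>\<^bsub>A\<^esub>\<rbrakk> \<Longrightarrow> z \<triangleright>\<^bsub>W\<^esub> x = \<zero>\<^bsub>W\<^esub>" for z
    using that unfolding K_def by blast
  have KD: "z \<in> carrier A" "a \<in> carrier A \<Longrightarrow> z \<otimes>\<^bsub>A\<^esub> a = a \<otimes>\<^bsub>A\<^esub> z"
    "\<lbrakk>x \<in> carrier W; ev x = \<zero>\<^bsub>A\<^esub>\<rbrakk> \<Longrightarrow> z \<triangleright>\<^bsub>W\<^esub> x = \<zero>\<^bsub>W\<^esub>" if "z \<in> K" for z a x
    using that unfolding K_def by blast+
  have thK: "theta rg r e \<in> K" if r: "r \<in> invariants B \<iota> rg" and e: "e \<in> casimir" for r e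
  proof -
    have "r \<otimes>\<^sub>T \<zero>\<^bsub>sq\<^esub> = \<zero>\<^bsub>W\<^esub>"
      using r by (intro additive_hom_zero[OF sq.M.abelian_group_axioms W.M.abelian_group_axioms])
        (simp add: hom_def pR_add_right W_simps(3))
    then show ?thesis
      using theta_closed[OF rgm r casimirD(1)[OF e]]
      by (intro KI theta_casimir_central[OF r e])
        (simp_all add: smult_ev[OF r e] sq.lsmult_zero_left casimirD(1)[OF e])
  qed
  obtain n r e where ur: "u = casimir_sum n r e" and r: "\<And>i. r i \<in> invariants B \<iota> rg"
    and e: "\<And>i. e i \<in> casimir"
    using assms unfolding casimir_span_def by blast
  have oneK: "\<one>\<^bsub>A\<^esub> \<in> K"
  proof (rule A.one_in_central_ideal[where X = "invariants B \<iota> rg" and x = r and n = n])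
    show "\<exists>k. (\<forall>i. k i \<in> K) \<and> y = (\<Oplus>\<^bsub>A\<^esub>i\<in>{..<n}. k i \<otimes>\<^bsub>A\<^esub> r i)" if y: "y \<in> invariants B \<iota> rg" for y
    proof (intro exI conjI allI)
      show "theta rg y (e i) \<in> K" for i by (rule thK[OF y e])
      note th = bimodule_homD[OF theta_hom[OF rgm y]]
      have h: "theta rg y \<in> hom (add_monoid sq) (add_monoid A)" using th(1) by (simp add: hom_def)
      \<comment> \<open>Applying \<open>theta rg y\<close> to \<open>u = \<Sum> r i e i\<close>
        writes \<open>y\<close> as a combination of the fixed elements \<open>r i\<close>. The
        coefficients \<open>theta rg y (e i)\<close> are central, so they can be moved to the
        left.\<close>
      have "y = theta rg y (casimir_sum n r e)" using theta_u[OF rgm y] by (simp flip: ur)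
      also have "\<dots> = (\<Oplus>\<^bsub>A\<^esub>i\<in>{..<n}. theta rg y (r i \<triangleright>\<^bsub>sq\<^esub> e i))"
        unfolding casimir_sum_def
        by (rule additive_hom_finsum[OF sq.M.abelian_group_axioms A.abelian_group_axioms h])
          (simp add: sq.lsmult_closed centralizerD(1)[OF r] casimirD(1)[OF e])
      also have "\<dots> = (\<Oplus>\<^bsub>A\<^esub>i\<in>{..<n}. theta rg y (e i) \<otimes>\<^bsub>A\<^esub> r i)"
        using th(2,4) centralizerD(1)[OF r] casimirD(1)[OF e] theta_casimir_central[OF y e]
        by (intro A.finsum_cong') auto
      finally show "y = (\<Oplus>\<^bsub>A\<^esub>i\<in>{..<n}. theta rg y (e i) \<otimes>\<^bsub>A\<^esub> r i)" .
    qed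
    show "\<ominus>\<^bsub>A\<^esub> k \<in> K" if k: "k \<in> K" for k
      by (rule KI) (simp_all add: KD[OF k] A.l_minus A.r_minus W.lsmult_minus_left)
    show "k \<oplus>\<^bsub>A\<^esub> k' \<in> K" if k: "k \<in> K" and k': "k' \<in> K" for k k'
      by (rule KI) (simp_all add: KD[OF k] KD[OF k'] A.l_distr A.r_distr W.lsmult_add_left)
    show "k \<otimes>\<^bsub>A\<^esub> k' \<in> K" if k: "k \<in> K" and k': "k' \<in> K" for k k'
    proof (rule KI)
      fix a assume a: "a \<in> carrier A"
      have "k \<otimes>\<^bsub>A\<^esub> k' \<otimes>\<^bsub>A\<^esub> a = (k \<otimes>\<^bsub>A\<^esub> a) \<otimes>\<^bsub>A\<^esub> k'"
        using KD(1)[OF k] KD(1,2)[OF k'] a by (simp add: A.m_assoc)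
      also have "\<dots> = a \<otimes>\<^bsub>A\<^esub> (k \<otimes>\<^bsub>A\<^esub> k')"
        unfolding KD(2)[OF k a] using KD(1)[OF k] KD(1)[OF k'] a by (simp add: A.m_assoc)
      finally show "k \<otimes>\<^bsub>A\<^esub> k' \<otimes>\<^bsub>A\<^esub> a = a \<otimes>\<^bsub>A\<^esub> (k \<otimes>\<^bsub>A\<^esub> k')" .
    qed (simp_all add: KD(1,3)[OF k] KD(1,3)[OF k'] W.lsmult_assoc W.lsmult_zero_right)
    show "K \<subseteq> carrier A" using KD(1) by blast
    show "k \<otimes>\<^bsub>A\<^esub> a = a \<otimes>\<^bsub>A\<^esub> k" if "k \<in> K" "a \<in> carrier A" for k a
      by (rule KD(2)[OF that])
    show "\<zero>\<^bsub>A\<^esub> \<in> K" by (rule KI) (simp_all add: W.lsmult_zero_left)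
    show "invariants B \<iota> rg \<subseteq> carrier A" by (auto simp: centralizerD(1))
  qed (rule one r)+
  have ker: "x = \<zero>\<^bsub>W\<^esub>" if "x \<in> carrier W" "ev x = \<zero>\<^bsub>A\<^esub>" for x
    using KD(3)[OF oneK that] W.lsmult_one[OF that(1)] by simp
  have eh: "ev \<in> hom (add_monoid W) (add_monoid A)" using eD(1) by (simp add: hom_def)
  have "inj_on ev (carrier W)"
  proof (rule inj_onI)
    fix x y assume xy: "x \<in> carrier W" "y \<in> carrier W" "ev x = ev y"
    have "ev (x \<oplus>\<^bsub>W\<^esub> \<ominus>\<^bsub>W\<^esub> y) = \<zero>\<^bsub>A\<^esub>"
      using xy eD(2)[of y] eD(3) additive_hom_minus[OF W.M.abelian_group_axioms A.abelian_group_axioms eh]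
      by (simp add: A.r_neg)
    then have "x \<oplus>\<^bsub>W\<^esub> \<ominus>\<^bsub>W\<^esub> y = \<zero>\<^bsub>W\<^esub>" using ker xy by simp
    then show "x = y" using xy W.M.eq_of_diff_zero by blast
  qed
  moreover have "ev ` carrier W = carrier A"
  proof (rule equalityI)
    show "ev ` carrier W \<subseteq> carrier A" using eD(2) by auto
    show "carrier A \<subseteq> ev ` carrier W"
    proof
      fix a assume a: "a \<in> carrier A"
      \<comment> \<open>Evaluation at \<open>r = 1\<close> is multiplication
        \<open>a \<otimes> a' \<mapsto> a a'\<close>, so \<open>a u\<close> supplies a preimage of
        \<open>a\<close>.\<close>
      have "ev (\<one>\<^bsub>A\<^esub> \<otimes>\<^sub>T (a \<triangleright>\<^bsub>sq\<^esub> u)) = a"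
        using bimodule_homD(4)[OF theta_hom[OF rgm one] u_closed a] a
        by (simp add: ev_pR[OF one] sq.lsmult_closed theta_u[OF rgm one])
      then show "a \<in> ev ` carrier W"
        using a one by (intro image_eqI[of _ _ "\<one>\<^bsub>A\<^esub> \<otimes>\<^sub>T (a \<triangleright>\<^bsub>sq\<^esub> u)"]) (simp_all add: sq.lsmult_closed)
    qed
  qed
  ultimately have "ev \<in> bimodule_iso A A W rg"
    using eD by (auto simp: bimodule_iso_def iso_def bij_betw_def)
  then show ?thesis unfolding bimodule_isomorphic_def by blast
qed

end

theorem theorem4p2:
  fixes A :: "('a, 'k) ring_scheme" and B :: "('b, 'l) ring_scheme" and \<iota> :: "'b \<Rightarrow> 'a"
  assumes "ring A" and "ring B" and "\<iota> \<in> ring_hom B A"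
  shows "H_separable A B \<iota> \<longleftrightarrow>
    generator (T_ring A B \<iota>) (centralizer_module A B \<iota>) \<and>
    bimodule_isomorphic A A (R_tensor_square A B \<iota>) (regular_bimodule A)"
proof -
  interpret ring_extension A B \<iota>
    using assms by (simp add: ring_extension_def ring_extension_axioms_def)
  show ?thesis
    using H_separable_iff generator_of_span span_of_generator iso_of_span by blast
qed

end
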